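(* Let $G=GL(q,\mathbb F)$, $K=U(q,\mathbb F)$, let $\nu_G$ be a $K$-biinvariant probability measure on $G$, let $(X_k)_{k\ge1}$ be i.i.d. $G$-valued random variables with law $\nu_G$, put $S_k:=X_1X_2\cdots X_k$, and let $\nu\in M^1(C_q^A)$ be the image of $\nu_G$ under $g\mapsto\ln\sigma_{sing}(g)$. (1) If $\int_{C_q^A}|t_j|\,d\nu(t)<\infty$ for all $j=1,\dots,q$, then $\frac1k\ln\sigma_{sing}(S_k)\to m_{\bf 1}(\nu)$ almost surely as $k\to\infty$. (2) If $\int_{C_q^A}t_j^2\,d\nu(t)<\infty$ for all $j=1,\dots,q$, then for every $\epsilon>1/2$, $k^{-\epsilon}\bigl(\ln\sigma_{sing}(S_k)-k\,m_{\bf 1}(\nu)\bigr)\to0$ almost surely as $k\to\infty$.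
   Context: $\mathbb F\in\{\mathbb R,\mathbb C,\mathbb H\}$, $d=\dim_{\mathbb R}\mathbb F\in\{1,2,4\}$, $q\ge2$ an integer, $K=U(q,\mathbb F)$ with normalized Haar measure $du$. $C_q^A=\{t\in\mathbb R^q: t_1\ge t_2\ge\dots\ge t_q\}$. For $g\in GL(q,\mathbb F)$, $\sigma_{sing}(g)=(x_1,\dots,x_q)$ with $x_1\ge\dots\ge x_q>0$ the singular values of $g$ (square roots of eigenvalues of $g^*g$) and $\ln\sigma_{sing}(g)=(\ln x_1,\dots,\ln x_q)\in C_q^A$. For $t\in\mathbb R^q$, $e^{2\underline t}=\mathrm{diag}(e^{2t_1},\dots,e^{2t_q})$. For a positive definite Hermitian $q\times q$ matrix $x=(x_{ij})$ over $\mathbb F$, $\Delta_r(x)=\det((x_{ij})_{1\le i,j\le r})$ for $r=1,\dots,q$ and $\Delta_0:=1$; for $\mathbb F=\mathbb H$ determinants are Dieudonné determinants, $\det A=(\det_{\mathbb C}A)^{1/2}$ with $A$ regarded as a complex matrix. For $l\in\mathbb N_0^q$ and $t\in C_q^A$ the moment function is $m_l(t)=2^{-|l|}\int_K\prod_{j=1}^q\bigl(\ln(\Delta_j(u^{-1}e^{2\underline t}u)/\Delta_{j-1}(u^{-1}e^{2\underline t}u))\bigr)^{l_j}\,du$, $|l|=l_1+\dots+l_q$. With $e_j$ the unit vectors, $m_{\bf 1}(t)=(m_{e_1}(t),\dots,m_{e_q}(t))$ (row vector), and for a probability measure $\nu$ with finite first moments $m_{\bf 1}(\nu)=\int_{C_q^A}m_{\bf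 1}(t)\,d\nu(t)$. *)

theory Defs
  imports "HOL-Probability.Probability" "HOL-Computational_Algebra.Polynomial"
begin

text \<open>The skew field F in {R, C, H}.  A q x q matrix over F is represented as a complex
 matrix of size cF F * q: real matrices are complex matrices with real entries, complex
 matrices are themselves, and a quaternionic matrix is represented by its standard complex
 2q x 2q form, where the quaternion z + w j (z, w complex) becomes the 2 x 2 block
 [[z, w], [-cnj w, cnj z]].  Matrices are functions nat => nat => complex, vanishing outside
 the index range {0..<m}.\<close>

datatype fld = FR | FC | FH

fun dimF :: "fld \<Rightarrow> nat" where
  "dimF FR = 1" | "dimF FC = 2" | "dimF FH = 4"

fun cF :: "fld \<Rightarrow> nat" where
  "cF FR = 1" | "cF FC = 1" | "cF FH = 2"

definition msz :: "fld \<Rightarrow> nat \<Rightarrow> nat" where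
  "msz F q = cF F * q"

type_synonym cmat = "nat \<Rightarrow> nat \<Rightarrow> complex"

definition in_mat :: "nat \<Rightarrow> cmat \<Rightarrow> bool" where
  "in_mat m A \<longleftrightarrow> (\<forall>i j. (m \<le> i \<or> m \<le> j) \<longrightarrow> A i j = 0)"

definition mmul :: "nat \<Rightarrow> cmat \<Rightarrow> cmat \<Rightarrow> cmat" where
  "mmul m A B = (\<lambda>i j. if i < m \<and> j < m then (\<Sum>k<m. A i k * B k j) else 0)"

definition idm :: "nat \<Rightarrow> cmat" where
  "idm m = (\<lambda>i j. if i < m \<and> j = i then 1 else 0)"

definition ctr :: "nat \<Rightarrow> cmat \<Rightarrow> cmat" where
  "ctr m A = (\<lambda>i j. if i < m \<and> j < m then cnj (A j i) else 0)"

definition minv :: "nat \<Rightarrow> cmat \<Rightarrow> cmat" where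
  "minv m A = (THE B. in_mat m B \<and> mmul m A B = idm m \<and> mmul m B A = idm m)"

definition Frep :: "fld \<Rightarrow> nat \<Rightarrow> cmat \<Rightarrow> bool" where
  "Frep F q A \<longleftrightarrow> in_mat (msz F q) A \<and>
     (case F of
        FR \<Rightarrow> (\<forall>i j. Im (A i j) = 0)
      | FC \<Rightarrow> True
      | FH \<Rightarrow> (\<forall>i<q. \<forall>j<q. A (2*i+1) (2*j+1) = cnj (A (2*i) (2*j)) \<and>
                            A (2*i+1) (2*j) = - cnj (A (2*i) (2*j+1))))"

definition GLF :: "fld \<Rightarrow> nat \<Rightarrow> cmat set" where
  "GLF F q = {A. Frep F q A \<and> (\<exists>B. Frep F q B \<and> mmul (msz F q) A B = idm (msz F q)
                                  \<and> mmul (msz F q) B A = idm (msz F q))}"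

definition UF :: "fld \<Rightarrow> nat \<Rightarrow> cmat set" where
  "UF F q = {u. Frep F q u \<and> mmul (msz F q) (ctr (msz F q) u) u = idm (msz F q)}"

definition detm :: "nat \<Rightarrow> (nat \<Rightarrow> nat \<Rightarrow> 'a::comm_ring_1) \<Rightarrow> 'a" where
  "detm m A = (\<Sum>p\<in>{p. p permutes {..<m}}. of_int (sign p) * (\<Prod>i<m. A i (p i)))"

definition charpoly :: "nat \<Rightarrow> cmat \<Rightarrow> complex poly" where
  "charpoly m A = detm m (\<lambda>i j. (if i = j then [:0, 1:] else 0) - [:A i j:])"

definition eigs :: "nat \<Rightarrow> cmat \<Rightarrow> real list" where
  "eigs m A = (THE xs. length xs = m \<and> sorted_wrt (\<ge>) xs \<and>
      (\<forall>x. count (mset xs) x = order (complex_of_real x) (charpoly m A)))"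

text \<open>singular values x_1 >= ... >= x_q (index j = 0..q-1 stands for x_(j+1)); in the
 quaternionic case each eigenvalue of the complex 2q x 2q form of g^* g occurs twice\<close>
definition sing_vals :: "fld \<Rightarrow> nat \<Rightarrow> cmat \<Rightarrow> nat \<Rightarrow> real" where
  "sing_vals F q g = (\<lambda>j. if j < q then
      sqrt (eigs (msz F q) (mmul (msz F q) (ctr (msz F q) g) g) ! (cF F * j)) else 0)"

definition ln_sing :: "fld \<Rightarrow> nat \<Rightarrow> cmat \<Rightarrow> nat \<Rightarrow> real" where
  "ln_sing F q g = (\<lambda>j. if j < q then ln (sing_vals F q g j) else 0)"

definition weylA :: "nat \<Rightarrow> (nat \<Rightarrow> real) set" where
  "weylA q = {t. (\<forall>i j. i \<le> j \<longrightarrow> j < q \<longrightarrow> t j \<le> t i) \<and> (\<forall>j\<ge>q. t j = 0)}"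

definition exp2diag :: "fld \<Rightarrow> nat \<Rightarrow> (nat \<Rightarrow> real) \<Rightarrow> cmat" where
  "exp2diag F q t = (\<lambda>i j. if i < msz F q \<and> j = i
      then complex_of_real (exp (2 * t (i div cF F))) else 0)"

text \<open>principal minors Delta_r (Dieudonne determinant (det_C)^(1/2) in the quaternionic case)\<close>
definition Delta :: "fld \<Rightarrow> nat \<Rightarrow> cmat \<Rightarrow> real" where
  "Delta F r x = (if F = FH then sqrt (Re (detm (2 * r) x)) else Re (detm r x))"

definition haar :: "fld \<Rightarrow> nat \<Rightarrow> cmat measure" where
  "haar F q = (THE \<mu>. sets \<mu> = sets borel \<and> prob_space \<mu> \<and> emeasure \<mu> (UF F q) = 1 \<and>
       (\<forall>u\<in>UF F q. distr \<mu> borel (mmul (msz F q) u) = \<mu>))"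

definition m1 :: "fld \<Rightarrow> nat \<Rightarrow> (nat \<Rightarrow> real) \<Rightarrow> nat \<Rightarrow> real" where
  "m1 F q t j = (1/2) * (\<integral>u. (let x = mmul (msz F q) (mmul (msz F q) (minv (msz F q) u)
          (exp2diag F q t)) u in ln (Delta F (Suc j) x / Delta F j x)) \<partial>haar F q)"

definition m1_meas :: "fld \<Rightarrow> nat \<Rightarrow> (nat \<Rightarrow> real) measure \<Rightarrow> nat \<Rightarrow> real" where
  "m1_meas F q \<nu> = (\<lambda>j. \<integral>t. m1 F q t j \<partial>\<nu>)"

fun Sprod :: "nat \<Rightarrow> (nat \<Rightarrow> 'w \<Rightarrow> cmat) \<Rightarrow> nat \<Rightarrow> 'w \<Rightarrow> cmat" where
  "Sprod m X 0 \<omega> = idm m"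
| "Sprod m X (Suc k) \<omega> = mmul m (Sprod m X k \<omega>) (X (Suc k) \<omega>)"

end

theory Submission
  imports Defs "Jordan_Normal_Form.Char_Poly"
begin

text \<open>For invertible \<open>h\<close> write \<open>b_j(h)\<close> for half the logarithm of the ratio of the leading minors of
  orders \<open>j\<close> and \<open>j - 1\<close> of \<open>h h*\<close>, i.e. the logarithm of a diagonal entry of the triangular factor of
  \<open>h*\<close>.  If \<open>h* = u R\<close> with \<open>u\<close> unitary and \<open>R\<close> upper triangular, then \<open>b_j(h g) = b_j(h) + b_j(u* g)\<close>;
  hence, for a step law invariant under left multiplication by unitary matrices, the increments of
  \<open>b_j(w S_k)\<close> are i.i.d. for every fixed unitary \<open>w\<close>, and integration over the unitary group identifies
  their mean with the first moment function.  The strong law (and Kolmogorov's strong law with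
  normalisation \<open>k^\<epsilon>\<close>) applies to all these walks.

  No estimate of minors under the Haar measure is needed to return to the singular values: the
  \<open>b_j(g)\<close> and the \<open>ln \<sigma>_j(g)\<close> have the same sum over \<open>j\<close>, and a pivoting argument shows
  \<open>ln \<sigma>_j(g) \<le> max_w b_j(w g) + const\<close> where \<open>w\<close> ranges over finitely many permutation matrices.\<close>

subsection \<open>Matrices as functions\<close>

text \<open>A single walk is not enough: the leading minors of a unitary matrix can be arbitrarily
  small, so \<open>b_j(S_k)\<close> may stay far from the j-th logarithmic singular value. Left
  unitary factors w do not change the singular values of \<open>w S_k\<close>, which is why several
  walks can be compared with the same target; the loss in the pivoting step is
  \<open>ln (msz F q) / 2\<close>, independent of k, and disappears under any normalisation that
  tends to infinity.

  All three fields share one complex matrix format. The price is that orthonormalisation,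
  eigenvector bases and pivots must respect the quaternionic structure, because invariance of the
  law is given only under \<open>UF F q\<close>.

  \<open>eigs\<close>, \<open>minv\<close> and \<open>haar\<close> are definite descriptions, so
  existence and uniqueness come before any computation. Singular values and the inverse inside the
  moment function must moreover be measurable on the space of all matrices, singular ones included.
  Indices start at 0: \<open>iwa F j\<close> is the b with index j + 1.\<close>

lemma in_mat_mmul [simp]: "in_mat m (mmul m A B)"
  by (auto simp: in_mat_def mmul_def)

lemma in_mat_idm [simp]: "in_mat m (idm m)"
  by (auto simp: in_mat_def idm_def)

lemma in_mat_ctr [simp]: "in_mat m (ctr m A)"
  by (auto simp: in_mat_def ctr_def)

lemma in_mat_eqI:
  assumes "in_mat m A" "in_mat m B" "\<And>i j. i < m \<Longrightarrow> j < m \<Longrightarrow> A i j = B i j"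
  shows "A = B"
proof (intro ext)
  fix i j show "A i j = B i j"
    using assms by (cases "i < m \<and> j < m") (auto simp: in_mat_def not_less)
qed

lemma mmul_assoc: "mmul m (mmul m A B) C = mmul m A (mmul m B C)"
proof (rule in_mat_eqI[of m], goal_cases)
  case (3 i j)
  have "(\<Sum>k<m. (\<Sum>l<m. A i l * B l k) * C k j) = (\<Sum>k<m. \<Sum>l<m. A i l * B l k * C k j)"
    by (simp add: sum_distrib_right)
  also have "\<dots> = (\<Sum>l<m. \<Sum>k<m. A i l * B l k * C k j)" by (rule sum.swap)
  also have "\<dots> = (\<Sum>l<m. A i l * (\<Sum>k<m. B l k * C k j))"
    by (simp add: sum_distrib_left mult.assoc)
  finally show ?case using 3 by (simp add: mmul_def)
qed auto

lemma mmul_idm_left: "in_mat m A \<Longrightarrow> mmul m (idm m) A = A"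
  by (rule in_mat_eqI[of m]) (auto simp: in_mat_def mmul_def idm_def if_distrib[of "\<lambda>x. x * _"] cong: if_cong)

lemma mmul_idm_right: "in_mat m A \<Longrightarrow> mmul m A (idm m) = A"
  by (rule in_mat_eqI[of m]) (auto simp: in_mat_def mmul_def idm_def if_distrib[of "\<lambda>x. _ * x"] cong: if_cong)

lemma ctr_ctr: "in_mat m A \<Longrightarrow> ctr m (ctr m A) = A"
  by (rule in_mat_eqI[of m]) (auto simp: in_mat_def ctr_def)

lemma ctr_mmul: "ctr m (mmul m A B) = mmul m (ctr m B) (ctr m A)"
  by (rule in_mat_eqI[of m]) (auto simp: in_mat_def ctr_def mmul_def mult.commute)

lemma ctr_idm [simp]: "ctr m (idm m) = idm m"
  by (rule in_mat_eqI[of m]) (auto simp: in_mat_def ctr_def idm_def)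

section \<open>Determinants, inverses and characteristic polynomials through the type
  \<open>mat\<close>\<close>

definition jmat :: "nat \<Rightarrow> (nat \<Rightarrow> nat \<Rightarrow> 'a) \<Rightarrow> 'a mat" where
  "jmat m A = mat m m (\<lambda>(i, j). A i j)"

lemma jmat_carrier [simp]: "jmat m A \<in> carrier_mat m m"
  by (simp add: jmat_def)

lemma jmat_mmul: "jmat m (mmul m A B) = jmat m A * jmat m B"
  by (rule eq_matI) (auto simp: jmat_def mmul_def scalar_prod_def atLeast0LessThan)

lemma jmat_idm: "jmat m (idm m) = 1\<^sub>m m"
  by (rule eq_matI) (auto simp: jmat_def idm_def)

lemma jmat_eqD:
  assumes "jmat m A = jmat m B" "in_mat m A" "in_mat m B" shows "A = B"
proof (rule in_mat_eqI[of m])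
  fix i j assume "i < m" "j < m"
  with arg_cong[OF assms(1), of "\<lambda>M. M $$ (i, j)"] show "A i j = B i j" by (simp add: jmat_def)
qed (use assms in auto)

lemma mmul_left_right_inverse:
  assumes "mmul m A B = idm m" shows "mmul m B A = idm m"
proof (rule jmat_eqD[of m])
  have "jmat m A * jmat m B = 1\<^sub>m m" by (simp add: assms flip: jmat_mmul jmat_idm)
  then have "jmat m B * jmat m A = 1\<^sub>m m"
    by (rule mat_mult_left_right_inverse[rotated 2]) auto
  then show "jmat m (mmul m B A) = jmat m (idm m)" by (simp add: jmat_mmul jmat_idm)
qed auto

lemma detm_jmat: "detm m A = Determinant.det (jmat m A)"
  by (auto simp: detm_def Determinant.det_def jmat_def atLeast0LessThan intro!: sum.cong prod.cong
      dest: permutes_in_image)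

lemma detm_cong: "(\<And>i j. i < m \<Longrightarrow> j < m \<Longrightarrow> A i j = B i j) \<Longrightarrow> detm m A = detm m B"
  unfolding detm_jmat by (rule arg_cong[of _ _ Determinant.det], rule eq_matI) (auto simp: jmat_def)

lemma detm_mult:
  fixes A B :: "nat \<Rightarrow> nat \<Rightarrow> 'a::comm_ring_1"
  shows "detm m (\<lambda>i j. \<Sum>k<m. A i k * B k j) = detm m A * detm m B"
proof -
  have "jmat m (\<lambda>i j. \<Sum>k<m. A i k * B k j) = jmat m A * jmat m B"
    by (rule eq_matI) (auto simp: jmat_def scalar_prod_def atLeast0LessThan)
  then show ?thesis by (simp add: detm_jmat det_mult[of _ m])
qed

lemma detm_mmul: "detm m (mmul m A B) = detm m A * detm m B"
  by (subst detm_mult[symmetric], rule detm_cong) (simp add: mmul_def)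

lemma prod_list_diag_jmat: "prod_list (diag_mat (jmat m A)) = (\<Prod>i<m. A i i)"
  by (simp add: diag_mat_def jmat_def prod.list_conv_set_nth atLeast0LessThan)

lemma detm_upper:
  assumes "\<And>i j. j < i \<Longrightarrow> i < m \<Longrightarrow> A i j = 0" shows "detm m A = (\<Prod>i<m. A i i)"
proof -
  have "upper_triangular (jmat m A)" using assms by (auto simp: jmat_def upper_triangular_def)
  then show ?thesis
    by (simp add: detm_jmat det_upper_triangular[of _ m] flip: prod_list_diag_jmat)
qed

lemma detm_lower:
  assumes "\<And>i j. i < j \<Longrightarrow> j < m \<Longrightarrow> A i j = 0" shows "detm m A = (\<Prod>i<m. A i i)"
  using det_lower_triangular[of m "jmat m A"] assms
  by (auto simp: detm_jmat jmat_def simp flip: prod_list_diag_jmat)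

lemma detm_idm [simp]: "detm m (idm m) = 1"
  by (subst detm_upper) (auto simp: idm_def)

lemma charpoly_jmat: "charpoly m A = char_poly (jmat m A)"
  unfolding charpoly_def char_poly_def detm_jmat char_poly_matrix_def
  by (rule arg_cong[of _ _ Determinant.det], rule eq_matI) (auto simp: jmat_def)

lemma charpoly_similar:
  assumes "mmul m P Q = idm m"
  shows "charpoly m (mmul m P (mmul m B Q)) = charpoly m B"
proof -
  have "jmat m P * jmat m Q = 1\<^sub>m m" "jmat m Q * jmat m P = 1\<^sub>m m"
    using assms mmul_left_right_inverse[OF assms] by (simp_all flip: jmat_mmul jmat_idm)
  then have "similar_mat (jmat m (mmul m P (mmul m B Q))) (jmat m B)"
    by (intro similar_matI[of _ _ "jmat m P" "jmat m Q" m])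
       (auto simp: jmat_mmul assoc_mult_mat[of _ m m _ m _ m] intro!: mult_carrier_mat[of _ m m])
  then show ?thesis by (simp add: charpoly_jmat char_poly_similar)
qed

lemma charpoly_diag:
  assumes "\<And>i j. i < m \<Longrightarrow> j < m \<Longrightarrow> i \<noteq> j \<Longrightarrow> A i j = 0"
  shows "charpoly m A = (\<Prod>i<m. [:- A i i, 1:])"
  unfolding charpoly_def by (subst detm_upper) (auto simp: assms)

section \<open>Matrices over the skew field: closure properties of \<open>Frep\<close>,
  \<open>UF\<close> and \<open>GLF\<close>\<close>

lemma msz_simps [simp]: "msz FR q = q" "msz FC q = q" "msz FH q = 2 * q"
  by (simp_all add: msz_def)

lemma cF_pos [simp]: "0 < cF F" by (cases F) auto

lemma sum_pairs: "(\<Sum>k<2 * q. f k) = (\<Sum>a<q. f (2 * a) + f (2 * a + 1))"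
  for f :: "nat \<Rightarrow> 'a::comm_monoid_add"
  by (induction q) (auto simp: algebra_simps)

lemma Frep_in_mat: "Frep F q A \<Longrightarrow> in_mat (msz F q) A"
  by (simp add: Frep_def)

lemma Frep_idm [simp]: "Frep F q (idm (msz F q))"
  proof (cases F)
  case FH
  have "2 * i + 1 \<noteq> 2 * j" "2 * i \<noteq> 2 * j + 1" for i j :: nat by presburger+
  then show ?thesis using FH in_mat_idm[of "2 * q"] by (auto simp: Frep_def idm_def)
qed (use in_mat_idm[of q] in \<open>auto simp: Frep_def idm_def\<close>)

lemma Frep_ctr: "Frep F q A \<Longrightarrow> Frep F q (ctr (msz F q) A)"
  by (cases F) (auto simp: Frep_def ctr_def in_mat_def)

lemma Frep_mmul:
  assumes "Frep F q A" "Frep F q B" shows "Frep F q (mmul (msz F q) A B)"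
proof (cases F)
  case FR then show ?thesis using assms by (auto simp: Frep_def mmul_def in_mat_def)
next
  case FC then show ?thesis using assms by (auto simp: Frep_def)
next
  case FH
  have A: "A (2*i+1) (2*j+1) = cnj (A (2*i) (2*j))" "A (2*i+1) (2*j) = - cnj (A (2*i) (2*j+1))"
    "B (2*i+1) (2*j+1) = cnj (B (2*i) (2*j))" "B (2*i+1) (2*j) = - cnj (B (2*i) (2*j+1))"
    if "i < q" "j < q" for i j
    using assms that FH by (auto simp: Frep_def)
  \<comment> \<open>Summation over pairs of indices turns the entries into sums of products of 2 x 2
    quaternion blocks, and such a product keeps the block pattern.\<close>
  have "mmul (2*q) A B (2*i+1) (2*j+1) = cnj (mmul (2*q) A B (2*i) (2*j)) \<and>
        mmul (2*q) A B (2*i+1) (2*j) = - cnj (mmul (2*q) A B (2*i) (2*j+1))" if "i < q" "j < q" for i j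
    using that
    by (auto simp: mmul_def sum_pairs A[simplified] simp flip: sum_negf intro!: sum.cong)
  then show ?thesis using FH by (auto simp: Frep_def)
qed

lemma UF_Frep: "u \<in> UF F q \<Longrightarrow> Frep F q u" by (simp add: UF_def)

lemma UF_in_mat: "u \<in> UF F q \<Longrightarrow> in_mat (msz F q) u" by (simp add: UF_def Frep_in_mat)

lemma UF_ctr_left: "u \<in> UF F q \<Longrightarrow> mmul (msz F q) (ctr (msz F q) u) u = idm (msz F q)"
  by (simp add: UF_def)

lemma UF_ctr_right: "u \<in> UF F q \<Longrightarrow> mmul (msz F q) u (ctr (msz F q) u) = idm (msz F q)"
  by (rule mmul_left_right_inverse) (simp add: UF_def)

lemma UF_ctr: "u \<in> UF F q \<Longrightarrow> ctr (msz F q) u \<in> UF F q"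
  using UF_ctr_right[of u F q] by (simp add: UF_def Frep_ctr ctr_ctr Frep_in_mat)

lemma UF_cancel: "u \<in> UF F q \<Longrightarrow> in_mat (msz F q) A \<Longrightarrow>
    mmul (msz F q) u (mmul (msz F q) (ctr (msz F q) u) A) = A"
  "u \<in> UF F q \<Longrightarrow> in_mat (msz F q) A \<Longrightarrow>
    mmul (msz F q) (ctr (msz F q) u) (mmul (msz F q) u A) = A"
  by (simp_all add: UF_ctr_left UF_ctr_right mmul_idm_left flip: mmul_assoc)

lemma UF_idm [simp]: "idm (msz F q) \<in> UF F q"
  by (simp add: UF_def mmul_idm_left)

lemma UF_mmul: "u \<in> UF F q \<Longrightarrow> v \<in> UF F q \<Longrightarrow> mmul (msz F q) u v \<in> UF F q"
  by (auto simp: UF_def Frep_mmul ctr_mmul mmul_assoc)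
     (metis mmul_assoc mmul_idm_left Frep_in_mat)

lemma GLF_Frep: "g \<in> GLF F q \<Longrightarrow> Frep F q g" by (simp add: GLF_def)

lemma GLF_in_mat: "g \<in> GLF F q \<Longrightarrow> in_mat (msz F q) g" by (simp add: GLF_def Frep_in_mat)

lemma UF_GLF: "u \<in> UF F q \<Longrightarrow> u \<in> GLF F q"
  using UF_Frep[OF UF_ctr[of u F q]] UF_ctr_left[of u F q] UF_ctr_right[of u F q]
  by (auto simp: GLF_def UF_Frep)

lemma GLF_mmul:
  assumes "g \<in> GLF F q" "h \<in> GLF F q" shows "mmul (msz F q) g h \<in> GLF F q"
proof -
  let ?m = "msz F q"
  obtain g' h' where g': "Frep F q g'" "mmul ?m g g' = idm ?m" "mmul ?m g' g = idm ?m"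
    and h': "Frep F q h'" "mmul ?m h h' = idm ?m" "mmul ?m h' h = idm ?m"
    using assms by (auto simp: GLF_def)
  have im: "in_mat ?m g" "in_mat ?m h" "in_mat ?m g'" "in_mat ?m h'"
    using assms g' h' by (auto simp: GLF_in_mat Frep_in_mat)
  have "mmul ?m (mmul ?m g h) (mmul ?m h' g') = mmul ?m g (mmul ?m (mmul ?m h h') g')"
    "mmul ?m (mmul ?m h' g') (mmul ?m g h) = mmul ?m h' (mmul ?m (mmul ?m g' g) h)"
    by (simp_all only: mmul_assoc)
  then show ?thesis using assms g' h' im
    by (auto simp: GLF_def mmul_idm_left intro!: Frep_mmul exI[of _ "mmul ?m h' g'"])
qed

lemma GLF_ctr:
  assumes "g \<in> GLF F q" shows "ctr (msz F q) g \<in> GLF F q"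
proof -
  let ?m = "msz F q"
  obtain g' where g': "Frep F q g'" "mmul ?m g g' = idm ?m" "mmul ?m g' g = idm ?m"
    using assms by (auto simp: GLF_def)
  then show ?thesis using assms
    by (auto simp: GLF_def Frep_ctr simp flip: ctr_mmul intro!: exI[of _ "ctr ?m g'"])
qed

section \<open>Inner product, norm and matrix action on vectors with m coordinates\<close>

definition ip :: "nat \<Rightarrow> (nat \<Rightarrow> complex) \<Rightarrow> (nat \<Rightarrow> complex) \<Rightarrow> complex" where
  "ip m v w = (\<Sum>i<m. cnj (v i) * w i)"

definition nrm :: "nat \<Rightarrow> (nat \<Rightarrow> complex) \<Rightarrow> real" where
  "nrm m v = sqrt (\<Sum>i<m. (cmod (v i))\<^sup>2)"

definition mv :: "nat \<Rightarrow> cmat \<Rightarrow> (nat \<Rightarrow> complex) \<Rightarrow> nat \<Rightarrow> complex" where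
  "mv m A v = (\<lambda>i. if i < m then \<Sum>k<m. A i k * v k else 0)"

text \<open>Vectors are functions on all natural numbers of which only the values below m count, so
  two vectors are usually known to agree only there.\<close>

lemma ip_cong: "(\<And>i. i < m \<Longrightarrow> v i = v' i) \<Longrightarrow> (\<And>i. i < m \<Longrightarrow> w i = w' i) \<Longrightarrow> ip m v w = ip m v' w'"
  by (simp add: ip_def)

lemma nrm_cong: "(\<And>i. i < m \<Longrightarrow> v i = v' i) \<Longrightarrow> nrm m v = nrm m v'"
  by (simp add: nrm_def)

lemma ip_diff_right: "ip m v (\<lambda>i. w i - w' i) = ip m v w - ip m v w'"
  by (simp add: ip_def algebra_simps sum_subtractf)

lemma ip_add_right: "ip m v (\<lambda>i. w i + w' i) = ip m v w + ip m v w'"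
  by (simp add: ip_def algebra_simps sum.distrib)

lemma ip_sum_right: "ip m v (\<lambda>i. \<Sum>l\<in>S. w l i) = (\<Sum>l\<in>S. ip m v (w l))"
  by (simp add: ip_def sum_distrib_left) (rule sum.swap)

lemma ip_scale_right: "ip m v (\<lambda>i. c * w i) = c * ip m v w"
  by (simp add: ip_def sum_distrib_left algebra_simps)

lemma ip_scale_left: "ip m (\<lambda>i. c * v i) w = cnj c * ip m v w"
  by (simp add: ip_def sum_distrib_left algebra_simps)

lemma ip_commute: "ip m w v = cnj (ip m v w)"
  by (simp add: ip_def mult.commute)

lemma nrm_nonneg [simp]: "0 \<le> nrm m v"
  by (simp add: nrm_def sum_nonneg)

lemma nrm_square: "(nrm m v)\<^sup>2 = (\<Sum>i<m. (cmod (v i))\<^sup>2)"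
  by (simp add: nrm_def sum_nonneg)

lemma ip_self: "ip m v v = of_real ((nrm m v)\<^sup>2)"
  unfolding nrm_square ip_def of_real_sum
  by (rule sum.cong) (simp_all add: complex_norm_square mult.commute del: of_real_power)

lemma nrm_eq_0: "nrm m v = 0 \<longleftrightarrow> (\<forall>i<m. v i = 0)"
  by (auto simp: nrm_def sum_nonneg_eq_0_iff)

lemma nrm_scale: "nrm m (\<lambda>i. c * v i) = cmod c * nrm m v"
  by (simp add: nrm_def norm_mult power_mult_distrib real_sqrt_mult flip: sum_distrib_left)

lemma ip_mv: "ip m v (mv m A w) = ip m (mv m (ctr m A) v) w"
proof -
  have "ip m v (mv m A w) = (\<Sum>i<m. \<Sum>k<m. cnj (v i) * (A i k * w k))"
    by (simp add: ip_def mv_def sum_distrib_left)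
  also have "\<dots> = (\<Sum>k<m. \<Sum>i<m. cnj (v i) * (A i k * w k))" by (rule sum.swap)
  also have "\<dots> = ip m (mv m (ctr m A) v) w"
    by (simp add: ip_def mv_def ctr_def sum_distrib_left sum_distrib_right mult_ac)
  finally show ?thesis .
qed

lemma mv_mmul: "mv m (mmul m A B) v = mv m A (mv m B v)"
proof
  fix i
  have "(\<Sum>k<m. (\<Sum>l<m. A i l * B l k) * v k) = (\<Sum>k<m. \<Sum>l<m. A i l * B l k * v k)"
    by (simp add: sum_distrib_right)
  also have "\<dots> = (\<Sum>l<m. \<Sum>k<m. A i l * B l k * v k)" by (rule sum.swap)
  also have "\<dots> = (\<Sum>l<m. A i l * (\<Sum>k<m. B l k * v k))"
    by (simp add: sum_distrib_left mult.assoc)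
  finally show "mv m (mmul m A B) v i = mv m A (mv m B v) i"
    by (simp add: mv_def mmul_def)
qed

lemma mv_idm: "i < m \<Longrightarrow> mv m (idm m) v i = v i"
  by (simp add: mv_def idm_def if_distrib[of "\<lambda>x. x * _"] cong: if_cong)

lemma ip_unitary:
  assumes "mmul m (ctr m u) u = idm m" shows "ip m (mv m u v) (mv m u w) = ip m v w"
  by (simp add: ip_mv assms flip: mv_mmul) (auto intro: ip_cong simp: mv_idm)

lemma ip_columns: "i < m \<Longrightarrow> j < m \<Longrightarrow> mmul m (ctr m A) B i j = ip m (\<lambda>k. A k i) (\<lambda>k. B k j)"
  by (simp add: ip_def mmul_def ctr_def)

subsection \<open>Gram-Schmidt orthonormalisation\<close>

text \<open>An explicit recursion rather than a chosen orthonormal basis: it is measurable in the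
  matrix and commutes with unitary left factors. A vanishing residual yields the zero column, since
  division by 0 gives 0, so the recursion makes sense on singular matrices too.\<close>

function gsc :: "nat \<Rightarrow> cmat \<Rightarrow> nat \<Rightarrow> nat \<Rightarrow> complex" where
  "gsc m g j = (let v = (\<lambda>i. g i j - (\<Sum>l<j. ip m (gsc m g l) (\<lambda>i. g i j) * gsc m g l i))
     in (\<lambda>i. v i / of_real (nrm m v)))"
  by auto
termination by (relation "Wellfounded.measure (\<lambda>(m, g, j). j)") auto

declare gsc.simps [simp del]

definition gsr :: "nat \<Rightarrow> cmat \<Rightarrow> nat \<Rightarrow> nat \<Rightarrow> complex" where
  "gsr m g j = (\<lambda>i. g i j - (\<Sum>l<j. ip m (gsc m g l) (\<lambda>i. g i j) * gsc m g l i))"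

definition gs :: "nat \<Rightarrow> cmat \<Rightarrow> cmat" where
  "gs m g = (\<lambda>i j. if i < m \<and> j < m then gsc m g j i else 0)"

lemma gsc_eq: "gsc m g j i = gsr m g j i / of_real (nrm m (gsr m g j))"
  by (subst gsc.simps) (simp add: gsr_def Let_def)

text \<open>In the pivoting argument this keeps the first vectors unchanged when later columns are
  swapped.\<close>

lemma gsc_cong_columns:
  "(\<And>i k. k \<le> j \<Longrightarrow> g i k = g' i k) \<Longrightarrow> gsc m g j = gsc m g' j"
proof (induction j rule: less_induct)
  case (less j)
  then have "gsr m g j = gsr m g' j" unfolding gsr_def by (intro ext) (auto intro!: sum.cong)
  then show ?case by (intro ext) (simp only: gsc_eq)
qed

text \<open>Only multiples of orthonormal vectors built from strictly earlier columns are
  subtracted, so the coefficient of column j stays 1. This unitriangular form replaces any talk of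
  rank or linear independence.\<close>

lemma gsr_column_combination:
  "j < m \<Longrightarrow> \<exists>\<beta>. \<beta> j = 1 \<and> (\<forall>k>j. \<beta> k = 0) \<and> (\<forall>i. gsr m g j i = (\<Sum>k<m. g i k * \<beta> k))"
proof (induction j rule: less_induct)
  case (less j)
  have "\<exists>\<beta>. (\<forall>k\<ge>j. \<beta> k = 0) \<and> (\<forall>i. gsc m g l i = (\<Sum>k<m. g i k * \<beta> k))" if "l < j" for l
  proof -
    from less.IH[OF that] that less.prems obtain \<beta> where
      "\<beta> l = 1" "\<And>k. k > l \<Longrightarrow> \<beta> k = 0" "\<And>i. gsr m g l i = (\<Sum>k<m. g i k * \<beta> k)" by auto
    then show ?thesis using that
      by (intro exI[of _ "\<lambda>k. \<beta> k / of_real (nrm m (gsr m g l))"])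
         (auto simp: gsc_eq sum_divide_distrib)
  qed
  then obtain \<beta> where \<beta>: "\<And>l k. l < j \<Longrightarrow> j \<le> k \<Longrightarrow> \<beta> l k = 0"
    "\<And>l i. l < j \<Longrightarrow> gsc m g l i = (\<Sum>k<m. g i k * \<beta> l k)" by metis
  define c where "c l = ip m (gsc m g l) (\<lambda>i. g i j)" for l
  have "gsr m g j i = (\<Sum>k<m. g i k * ((if k = j then 1 else 0) - (\<Sum>l<j. c l * \<beta> l k)))" for i
  proof -
    have "(\<Sum>l<j. c l * gsc m g l i) = (\<Sum>l<j. \<Sum>k<m. c l * (g i k * \<beta> l k))"
      by (rule sum.cong) (simp_all add: \<beta>(2) sum_distrib_left)
    also have "\<dots> = (\<Sum>k<m. \<Sum>l<j. c l * (g i k * \<beta> l k))" by (rule sum.swap)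
    finally show ?thesis using less.prems
      by (simp add: gsr_def c_def right_diff_distrib sum_subtractf sum_distrib_left mult_ac
          if_distrib[of "\<lambda>x. _ * x"] cong: if_cong)
  qed
  then show ?case using \<beta>(1)
    by (intro exI[of _ "\<lambda>k. (if k = j then 1 else 0) - (\<Sum>l<j. c l * \<beta> l k)"]) auto
qed

text \<open>A vanishing residual would be g applied to a vector \<beta> with \<beta> j = 1, and the
  left inverse B would return \<beta> = 0 at j.\<close>

lemma gsr_nonzero:
  assumes "mmul m B g = idm m" "j < m" shows "nrm m (gsr m g j) \<noteq> 0"
proof
  assume "nrm m (gsr m g j) = 0"
  then have 0: "gsr m g j i = 0" if "i < m" for i using that by (simp add: nrm_eq_0)
  obtain \<beta> where \<beta>: "\<beta> j = 1" "\<And>i. gsr m g j i = (\<Sum>k<m. g i k * \<beta> k)"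
    using gsr_column_combination[OF assms(2), of g] by auto
  have "mv m g \<beta> = (\<lambda>_. 0)" by (auto simp: mv_def 0 simp flip: \<beta>(2))
  then have "mv m (idm m) \<beta> j = 0" using assms(1) mv_mmul[of m B g \<beta>] by (simp add: mv_def)
  then show False using assms(2) \<beta>(1) by (simp add: mv_idm)
qed

lemma gsc_orthonormal:
  assumes "\<And>j. j < m \<Longrightarrow> nrm m (gsr m g j) \<noteq> 0"
  shows "j < m \<Longrightarrow> l \<le> j \<Longrightarrow> ip m (gsc m g l) (gsc m g j) = (if l = j then 1 else 0)"
proof (induction j arbitrary: l rule: less_induct)
  case (less j)
  have e: "gsc m g j = (\<lambda>i. inverse (of_real (nrm m (gsr m g j))) * gsr m g j i)"
    by (auto simp: gsc_eq divide_inverse)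
  show ?case
  proof (cases "l = j")
    case True
    have "ip m (gsc m g j) (gsc m g j) = 1"
      unfolding e ip_scale_left ip_scale_right ip_self using assms[OF less.prems(1)]
      by (simp add: power2_eq_square field_simps)
    then show ?thesis using True by simp
  next
    case False
    then have lj: "l < j" using less.prems by simp
    have on: "ip m (gsc m g l) (gsc m g k) = (if k = l then 1 else 0)" if "k < j" for k
    proof (cases "l \<le> k")
      case True then show ?thesis using less.IH[of k l] that less.prems by auto
    next
      case False
      then have "ip m (gsc m g k) (gsc m g l) = 0" using less.IH[of l k] lj less.prems by auto
      then show ?thesis using False by (simp add: ip_commute[of m "gsc m g l"])
    qed
    have "ip m (gsc m g l) (gsr m g j) = ip m (gsc m g l) (\<lambda>i. g i j)
        - (\<Sum>k<j. ip m (gsc m g k) (\<lambda>i. g i j) * (if k = l then 1 else 0))"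
      unfolding gsr_def ip_diff_right ip_sum_right ip_scale_right using on by simp
    also have "\<dots> = 0" using lj by (simp add: if_distrib[of "\<lambda>x. _ * x"] cong: if_cong)
    finally show ?thesis unfolding e ip_scale_right using False by simp
  qed
qed

lemma gs_unitary:
  assumes "mmul m B g = idm m" shows "mmul m (ctr m (gs m g)) (gs m g) = idm m"
proof (rule in_mat_eqI[of m])
  fix i j assume ij: "i < m" "j < m"
  have *: "ip m (gsc m g i) (gsc m g j) = (if i = j then 1 else 0)"
  proof (cases "i \<le> j")
    case True then show ?thesis using gsc_orthonormal[OF gsr_nonzero[OF assms]] ij by auto
  next
    case False
    then have "ip m (gsc m g j) (gsc m g i) = 0"
      using gsc_orthonormal[OF gsr_nonzero[OF assms], of i j] ij by auto
    then show ?thesis using False by (simp add: ip_commute[of m "gsc m g i"])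
  qed
  have "mmul m (ctr m (gs m g)) (gs m g) i j = ip m (gsc m g i) (gsc m g j)"
    unfolding ip_columns[OF ij] using ij by (auto intro!: ip_cong simp: gs_def)
  then show "mmul m (ctr m (gs m g)) (gs m g) i j = idm m i j"
    using * ij by (simp add: idm_def)
qed auto

text \<open>Column j of g lies in the span of the orthonormal vectors 0, ..., j, to which vector i >
  j is orthogonal.\<close>

lemma gs_triangular:
  assumes "mmul m B g = idm m" "j < i"
  shows "mmul m (ctr m (gs m g)) g i j = 0"
proof (cases "i < m")
  case True
  note on = gsc_orthonormal[OF gsr_nonzero[OF assms(1)]]
  have nz: "nrm m (gsr m g j) \<noteq> 0" using gsr_nonzero[OF assms(1)] True assms(2) by simp
  have col: "g k j = of_real (nrm m (gsr m g j)) * gsc m g j k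
      + (\<Sum>l<j. ip m (gsc m g l) (\<lambda>i. g i j) * gsc m g l k)" for k
    using nz gsc_eq[of m g j k] by (simp add: gsr_def)
  have 0: "ip m (gsc m g i) (gsc m g l) = 0" if "l \<le> j" for l
    using on[of i l] that assms(2) True by (simp add: ip_commute[of m "gsc m g i"])
  have "ip m (gsc m g i) (\<lambda>k. g k j) = 0"
    by (subst col) (simp add: ip_add_right ip_sum_right ip_scale_right 0)
  moreover have "mmul m (ctr m (gs m g)) g i j = ip m (gsc m g i) (\<lambda>k. g k j)"
    using True assms(2) by (subst ip_columns) (auto intro!: ip_cong simp: gs_def)
  ultimately show ?thesis by simp
qed (auto simp: mmul_def)

text \<open>A unitary factor changes neither the coefficients nor the norms in the recursion. The
  identity holds for every g, so it can be used pointwise when laws are transported; it is the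
  source of the Haar measure below.\<close>

lemma gsc_equivariant:
  assumes u: "mmul m (ctr m u) u = idm m"
  shows "j < m \<Longrightarrow> i < m \<Longrightarrow> gsc m (mmul m u g) j i = mv m u (gsc m g j) i"
proof (induction j arbitrary: i rule: less_induct)
  case (less j)
  let ?g = "mmul m u g"
  have c: "ip m (gsc m ?g l) (\<lambda>i. ?g i j) = ip m (gsc m g l) (\<lambda>i. g i j)" if "l < j" for l
  proof -
    have "ip m (gsc m ?g l) (\<lambda>i. ?g i j) = ip m (mv m u (gsc m g l)) (mv m u (\<lambda>i. g i j))"
      using less that by (intro ip_cong) (auto simp: mmul_def mv_def)
    then show ?thesis by (simp add: ip_unitary[OF u])
  qed
  have r: "gsr m ?g j i = mv m u (gsr m g j) i" if "i < m" for i
  proof -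
    have "(\<Sum>l<j. ip m (gsc m ?g l) (\<lambda>i. ?g i j) * gsc m ?g l i)
       = (\<Sum>l<j. \<Sum>k<m. ip m (gsc m g l) (\<lambda>i. g i j) * (u i k * gsc m g l k))"
      using less that by (intro sum.cong) (auto simp: c mv_def sum_distrib_left)
    also have "\<dots> = (\<Sum>k<m. \<Sum>l<j. ip m (gsc m g l) (\<lambda>i. g i j) * (u i k * gsc m g l k))"
      by (rule sum.swap)
    finally show ?thesis using that less.prems
      by (simp add: gsr_def mv_def mmul_def algebra_simps sum_subtractf sum_distrib_left)
  qed
  have "(nrm m (gsr m ?g j))\<^sup>2 = (nrm m (gsr m g j))\<^sup>2"
  proof -
    have "ip m (gsr m ?g j) (gsr m ?g j) = ip m (gsr m g j) (gsr m g j)"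
      by (subst ip_unitary[OF u, symmetric]) (auto intro!: ip_cong simp: r)
    then show ?thesis unfolding ip_self of_real_eq_iff .
  qed
  then have "nrm m (gsr m ?g j) = nrm m (gsr m g j)" by simp
  then show ?case using less.prems
    by (simp add: gsc_eq r mv_def sum_divide_distrib)
qed

lemma gs_equivariant:
  assumes "mmul m (ctr m u) u = idm m" shows "gs m (mmul m u g) = mmul m u (gs m g)"
proof (rule in_mat_eqI[of m])
  fix i j assume ij: "i < m" "j < m"
  then have "gs m (mmul m u g) i j = mv m u (gsc m g j) i"
    by (simp add: gs_def gsc_equivariant[OF assms])
  also have "\<dots> = mmul m u (gs m g) i j" using ij by (simp add: mv_def mmul_def gs_def)
  finally show "gs m (mmul m u g) i j = mmul m u (gs m g) i j" .
qed (auto simp: gs_def in_mat_def mmul_def)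

text \<open>The antilinear map \<open>v \<mapsto> v j\<close> of the quaternionic space in its complex form.\<close>

definition qj :: "(nat \<Rightarrow> complex) \<Rightarrow> nat \<Rightarrow> complex" where
  "qj v k = (if even k then - cnj (v (k + 1)) else cnj (v (k - 1)))"

lemma qj_simps [simp]: "qj v (2 * a) = - cnj (v (2 * a + 1))" "qj v (2 * a + 1) = cnj (v (2 * a))"
  "qj v (Suc (2 * a)) = cnj (v (2 * a))"
  by (auto simp: qj_def)

lemma less_double_cases: "k < 2 * (q::nat) \<Longrightarrow> (\<And>a. a < q \<Longrightarrow> k = 2 * a \<Longrightarrow> P) \<Longrightarrow>
    (\<And>a. a < q \<Longrightarrow> k = 2 * a + 1 \<Longrightarrow> P) \<Longrightarrow> P"
  by (cases "even k") (auto elim!: evenE oddE)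

lemma qj_cong: "(\<And>k. k < 2 * q \<Longrightarrow> v k = w k) \<Longrightarrow> k < 2 * q \<Longrightarrow> qj v k = qj w k"
  by (erule less_double_cases[of k q]) auto

lemma qj_qj: "k < 2 * q \<Longrightarrow> qj (qj v) k = - v k"
  by (auto simp: qj_def)

lemma ip_qj_qj: "ip (2 * q) (qj v) (qj w) = cnj (ip (2 * q) v w)"
  by (simp only: ip_def sum_pairs qj_simps) (simp add: algebra_simps)

lemma ip_qj_self: "ip (2 * q) v (qj v) = 0"
  by (simp only: ip_def sum_pairs qj_simps) simp

lemma ip_qj_right: "ip (2 * q) v (qj w) = - cnj (ip (2 * q) (qj v) w)"
  by (simp only: ip_def sum_pairs qj_simps) (simp add: algebra_simps flip: sum_negf)

lemma nrm_qj: "nrm (2 * q) (qj v) = nrm (2 * q) v"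
  by (simp only: nrm_def sum_pairs qj_simps) (simp add: add.commute)

text \<open>The block pattern read column by column: each odd column is the image of the preceding
  even one under \<open>qj\<close>. Orthonormalisation and eigenvector bases produce matrices in
  exactly this form.\<close>

lemma Frep_FH_iff: "Frep FH q A \<longleftrightarrow> in_mat (2 * q) A \<and>
    (\<forall>a<q. \<forall>k<2 * q. A k (2 * a + 1) = qj (\<lambda>k. A k (2 * a)) k)" (is "?L \<longleftrightarrow> ?R")
proof
  assume L: ?L
  show ?R
  proof (intro conjI allI impI)
    show "in_mat (2 * q) A" using L by (simp add: Frep_def)
    fix a k assume a: "a < q" and k: "k < 2 * q"
    from k show "A k (2 * a + 1) = qj (\<lambda>k. A k (2 * a)) k"
      by (rule less_double_cases) (use L a in \<open>auto simp: Frep_def\<close>)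
  qed
next
  assume R: ?R
  have "A (2*i+1) (2*j+1) = cnj (A (2*i) (2*j)) \<and> A (2*i+1) (2*j) = - cnj (A (2*i) (2*j+1))"
    if "i < q" "j < q" for i j
    using R[THEN conjunct2, rule_format, of j "2*i"] R[THEN conjunct2, rule_format, of j "2*i+1"] that
    by auto
  then show ?L using R by (simp add: Frep_def)
qed

text \<open>By induction the earlier vectors come in pairs v, \<open>qj v\<close>, so their span is
  stable under \<open>qj\<close> and the projection away from it commutes with \<open>qj\<close>.
  Column 2a+1 has one further vector to subtract, number 2a, but its coefficient vanishes since v is
  orthogonal to \<open>qj v\<close>.\<close>

lemma gs_Frep_FH:
  assumes g: "Frep FH q g" and inv: "mmul (2 * q) B g = idm (2 * q)"
  shows "a < q \<Longrightarrow> k < 2 * q \<Longrightarrow> gsc (2 * q) g (2 * a + 1) k = qj (gsc (2 * q) g (2 * a)) k"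
proof (induction a arbitrary: k rule: less_induct)
  case (less a)
  let ?m = "2 * q" let ?e = "gsc (2 * q) g" and ?c = "\<lambda>i. g i (2 * a)"
  note on = gsc_orthonormal[OF gsr_nonzero[OF inv]]
  have nz: "nrm ?m (gsr ?m g (2 * a)) \<noteq> 0" using gsr_nonzero[OF inv] less.prems by simp
  have c': "g k (2 * a + 1) = qj ?c k" if "k < ?m" for k
    using g that less.prems by (auto simp: Frep_FH_iff)
  have coeff: "ip ?m (?e l) (\<lambda>i. g i (2 * a + 1)) = ip ?m (?e l) (qj ?c)" for l
    using c' by (intro ip_cong) auto
  define s where "s k = (\<Sum>l<2 * a. ip ?m (?e l) (qj ?c) * ?e l k)" for k
  have s: "qj (gsr ?m g (2 * a)) k = qj ?c k - s k" if k: "k < ?m" for k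
  proof -
    have "qj (gsr ?m g (2 * a)) k =
        qj ?c k - (\<Sum>l<2 * a. cnj (ip ?m (?e l) ?c) * qj (?e l) k)"
      by (auto simp: gsr_def qj_def sum_negf)
    \<comment> \<open>Within a pair the two summands trade places: \<open>qj\<close> sends the even
      vector to the odd one and the odd one to minus the even one.\<close>
    also have "(\<Sum>l<2 * a. cnj (ip ?m (?e l) ?c) * qj (?e l) k) = s k"
      unfolding s_def sum_pairs
    proof (rule sum.cong)
      fix b assume "b \<in> {..<a}"
      then have IH: "?e (2 * b + 1) k = qj (?e (2 * b)) k" if "k < ?m" for k
        using less that by auto
      have "ip ?m (?e (2 * b + 1)) w = ip ?m (qj (?e (2 * b))) w" for w
        using IH by (intro ip_cong) auto
      moreover have "qj (?e (2 * b + 1)) k = - ?e (2 * b) k"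
        using qj_cong[OF IH k] qj_qj[OF k] by simp
      moreover have "cnj (ip ?m (qj (?e (2 * b))) ?c) = - ip ?m (?e (2 * b)) (qj ?c)"
        by (simp add: ip_qj_right)
      ultimately show "cnj (ip ?m (?e (2 * b)) ?c) * qj (?e (2 * b)) k +
          cnj (ip ?m (?e (2 * b + 1)) ?c) * qj (?e (2 * b + 1)) k =
          ip ?m (?e (2 * b)) (qj ?c) * ?e (2 * b) k +
          ip ?m (?e (2 * b + 1)) (qj ?c) * ?e (2 * b + 1) k"
        using k by (simp add: IH[simplified] ip_qj_qj)
    qed simp
    finally show ?thesis .
  qed
  have "ip ?m (?e (2 * a)) s = 0"
    unfolding s_def ip_sum_right ip_scale_right
  proof (rule sum.neutral, safe)
    fix l assume "l < 2 * a"
    then have "ip ?m (?e l) (?e (2 * a)) = 0" using on[of "2 * a" l] less.prems by auto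
    then show "ip ?m (?e l) (qj ?c) * ip ?m (?e (2 * a)) (?e l) = 0"
      by (simp add: ip_commute[of ?m "?e (2 * a)"])
  qed
  \<comment> \<open>Vector 2a is a multiple of the residual, and every vector is orthogonal to its
    own image under \<open>qj\<close>.\<close>
  moreover have "ip ?m (?e (2 * a)) (qj (gsr ?m g (2 * a))) = 0"
  proof -
    have "?e (2 * a) = (\<lambda>i. inverse (of_real (nrm ?m (gsr ?m g (2 * a)))) * gsr ?m g (2 * a) i)"
      by (auto simp: gsc_eq divide_inverse)
    then show ?thesis by (simp add: ip_scale_left ip_qj_self)
  qed
  moreover have "ip ?m (?e (2 * a)) (qj (gsr ?m g (2 * a)))
      = ip ?m (?e (2 * a)) (qj ?c) - ip ?m (?e (2 * a)) s"
    by (subst ip_diff_right[symmetric]) (auto intro!: ip_cong simp: s)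
  ultimately have 0: "ip ?m (?e (2 * a)) (qj ?c) = 0" by simp
  have r: "gsr ?m g (2 * a + 1) k = qj (gsr ?m g (2 * a)) k" if "k < ?m" for k
    using that c'[OF that] s[OF that] 0
    by (simp add: gsr_def[of _ _ "Suc _"] coeff[simplified] s_def)
  have "nrm ?m (gsr ?m g (2 * a + 1)) = nrm ?m (gsr ?m g (2 * a))"
    using nrm_cong[of ?m "gsr ?m g (2 * a + 1)" "qj (gsr ?m g (2 * a))"] r nrm_qj by simp
  then show ?case using r[OF less.prems(2)] by (simp add: gsc_eq qj_def)
qed

lemma gs_UF:
  assumes "g \<in> GLF F q" shows "gs (msz F q) g \<in> UF F q"
proof -
  obtain B where B: "mmul (msz F q) B g = idm (msz F q)" and g: "Frep F q g"
    using assms by (auto simp: GLF_def)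
  have "Frep F q (gs (msz F q) g)"
  proof (cases F)
    case FR
    have "Im (gsc q g j i) = 0" for j i
    proof (induction j arbitrary: i rule: less_induct)
      case (less j)
      have "Im (ip q (gsc q g l) (\<lambda>i. g i j)) = 0" if "l < j" for l
        using less[OF that] g FR by (simp add: ip_def Frep_def)
      then have "Im (gsr q g j i) = 0" for i using less g FR by (simp add: gsr_def Frep_def)
      then show ?case by (simp add: gsc_eq)
    qed
    then show ?thesis using FR by (auto simp: Frep_def gs_def in_mat_def)
  next
    case FC then show ?thesis by (auto simp: Frep_def gs_def in_mat_def)
  next
    case FH
    have "gs (2*q) g k (2 * a + 1) = qj (\<lambda>k. gs (2*q) g k (2 * a)) k" if "a < q" "k < 2*q" for a k
    proof -
      have "gs (2*q) g k (2 * a + 1) = qj (gsc (2*q) g (2 * a)) k"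
        using gs_Frep_FH[of q g B a k] g B FH that by (simp add: gs_def)
      also have "\<dots> = qj (\<lambda>k. gs (2*q) g k (2 * a)) k"
        using that by (intro qj_cong) (auto simp: gs_def)
      finally show ?thesis .
    qed
    then show ?thesis using FH by (auto simp: Frep_FH_iff) (auto simp: gs_def in_mat_def)
  qed
  then show ?thesis using gs_unitary[OF B] by (simp add: UF_def)
qed

lemma QR_decomposition:
  assumes "g \<in> GLF F q"
  obtains R where "Frep F q R" "\<And>i j. j < i \<Longrightarrow> R i j = 0" "g = mmul (msz F q) (gs (msz F q) g) R"
    "R = mmul (msz F q) (ctr (msz F q) (gs (msz F q) g)) g"
proof
  let ?m = "msz F q" and ?u = "gs (msz F q) g"
  obtain B where B: "mmul ?m B g = idm ?m" using assms by (auto simp: GLF_def)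
  note u = gs_UF[OF assms]
  show "Frep F q (mmul ?m (ctr ?m ?u) g)"
    using u assms by (intro Frep_mmul Frep_ctr UF_Frep GLF_Frep)
  show "mmul ?m (ctr ?m ?u) g i j = 0" if "j < i" for i j using gs_triangular[OF B that] .
  show "g = mmul ?m ?u (mmul ?m (ctr ?m ?u) g)" using UF_cancel(1)[OF u] GLF_in_mat[OF assms] by simp
qed simp

subsection \<open>Spectral theorem\<close>

lemma ip_add_left: "ip m (\<lambda>i. v i + v' i) w = ip m v w + ip m v' w"
  by (simp add: ip_def algebra_simps sum.distrib)

lemma mv_add: "mv m A (\<lambda>i. v i + w i) = (\<lambda>i. mv m A v i + mv m A w i)"
  by (auto simp: mv_def algebra_simps sum.distrib)

lemma mv_scale: "mv m A (\<lambda>i. c * v i) = (\<lambda>i. c * mv m A v i)"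
  by (auto simp: mv_def algebra_simps sum_distrib_left)

definition rayleigh :: "nat \<Rightarrow> cmat \<Rightarrow> (nat \<Rightarrow> complex) \<Rightarrow> real" where
  "rayleigh m A v = Re (ip m v (mv m A v))"

lemma rayleigh_scale: "rayleigh m A (\<lambda>i. of_real c * v i) = c\<^sup>2 * rayleigh m A v"
  by (simp add: rayleigh_def mv_scale ip_scale_left ip_scale_right power2_eq_square)

lemma rayleigh_add_scaled:
  assumes "ctr m A = A"
  shows "rayleigh m A (\<lambda>i. v i + of_real t * w i) =
    rayleigh m A v + 2 * t * Re (ip m w (mv m A v)) + t\<^sup>2 * rayleigh m A w"
proof -
  have "ip m v (mv m A w) = cnj (ip m w (mv m A v))"
    by (subst ip_mv) (simp add: assms ip_commute[of m w])
  then show ?thesis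
    by (simp add: rayleigh_def mv_add mv_scale ip_add_left ip_add_right ip_scale_left ip_scale_right
        power2_eq_square algebra_simps)
qed

lemma nrm_add_scaled:
  "(nrm m (\<lambda>i. v i + of_real t * w i))\<^sup>2 = (nrm m v)\<^sup>2 + 2 * t * Re (ip m w v) + t\<^sup>2 * (nrm m w)\<^sup>2"
proof -
  have re: "(nrm m u)\<^sup>2 = Re (ip m u u)" for u by (simp add: ip_self)
  have "Re (ip m v w) = Re (ip m w v)" by (simp add: ip_commute[of m v])
  then show ?thesis unfolding re
    by (simp add: ip_add_left ip_add_right ip_scale_left ip_scale_right power2_eq_square algebra_simps)
qed

text \<open>First variation of the Rayleigh quotient within a real subspace stable under the matrix.\<close>

lemma rayleigh_maximizer_eigenvector:
  assumes herm: "ctr m A = A"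
    and S: "\<And>v w. v \<in> S \<Longrightarrow> w \<in> S \<Longrightarrow> (\<lambda>i. v i + w i) \<in> S"
      "\<And>v c. v \<in> S \<Longrightarrow> (\<lambda>i. complex_of_real c * v i) \<in> S"
      "\<And>v. v \<in> S \<Longrightarrow> mv m A v \<in> S"
    and v: "v \<in> S" "nrm m v = 1" "\<And>i. m \<le> i \<Longrightarrow> v i = 0"
    and max: "\<And>w. w \<in> S \<Longrightarrow> nrm m w = 1 \<Longrightarrow> rayleigh m A w \<le> rayleigh m A v"
  shows "mv m A v = (\<lambda>i. of_real (rayleigh m A v) * v i)"
proof -
  define M where "M = rayleigh m A v"
  \<comment> \<open>A quadratic form that vanishes at v and is nonnegative on S; by homogeneity of
    degree 2 the latter is the maximality on unit vectors.\<close>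
  define Q where "Q w = M * (nrm m w)\<^sup>2 - rayleigh m A w" for w
  have Q: "0 \<le> Q w" if w: "w \<in> S" for w
  proof (cases "nrm m w = 0")
    case True
    then have "rayleigh m A w = 0" by (simp add: rayleigh_def ip_def nrm_eq_0)
    then show ?thesis using True by (simp add: Q_def)
  next
    case False
    let ?w = "\<lambda>i. complex_of_real (1 / nrm m w) * w i"
    have "nrm m ?w = 1" unfolding nrm_scale using False by (simp add: norm_divide)
    then have "rayleigh m A ?w \<le> M" using max[OF S(2)[OF w]] unfolding M_def by blast
    then have "(1 / nrm m w)\<^sup>2 * rayleigh m A w \<le> M" unfolding rayleigh_scale .
    moreover have "nrm m w > 0" using False nrm_nonneg[of m w] by linarith
    ultimately show ?thesis by (simp add: Q_def field_simps)
  qed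
  \<comment> \<open>The defect M v - A v of the eigenvalue equation. Along it the linear term of Q
    is 2 t times its own squared norm, so Q could become negative unless the defect is 0.\<close>
  define w where "w = (\<lambda>i. of_real M * v i + of_real (- 1) * mv m A v i)"
  have w: "w \<in> S" unfolding w_def by (intro S v)
  have var: "Q (\<lambda>i. v i + of_real t * w i) = 2 * t * (nrm m w)\<^sup>2 + t\<^sup>2 * Q w" for t
  proof -
    have "M * Re (ip m w v) - Re (ip m w (mv m A v)) = Re (ip m w w)"
      by (subst (3) w_def) (simp add: ip_diff_right ip_scale_right)
    then have "M * Re (ip m w v) - Re (ip m w (mv m A v)) = (nrm m w)\<^sup>2" by (simp add: ip_self)
    then have 2: "2 * t * (M * Re (ip m w v) - Re (ip m w (mv m A v))) = 2 * t * (nrm m w)\<^sup>2" by simp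
    show ?thesis unfolding Q_def rayleigh_add_scaled[OF herm] nrm_add_scaled 2[symmetric]
      using v(2) by (simp add: M_def algebra_simps)
  qed
  have "(nrm m w)\<^sup>2 = 0"
  proof (rule ccontr)
    assume "(nrm m w)\<^sup>2 \<noteq> 0"
    define a where "a = (nrm m w)\<^sup>2"
    have a: "a > 0" using \<open>(nrm m w)\<^sup>2 \<noteq> 0\<close> by (simp add: a_def)
    define b where "b = Q w"
    have b: "b \<ge> 0" using Q[OF w] by (simp add: b_def)
    \<comment> \<open>This step makes 2ta + t^2 b equal to -a^2 (b+2)/(b+1)^2; the 1 in the
      denominator covers b = 0.\<close>
    define t where "t = - a / (b + 1)"
    have "0 \<le> 2 * t * a + t\<^sup>2 * b"
      using Q[OF S(1)[OF v(1) S(2)[OF w]], of t] unfolding var a_def b_def .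
    also have "\<dots> = - (a\<^sup>2 * (b + 2)) / (b + 1)\<^sup>2"
      using b by (simp add: t_def power2_eq_square divide_simps) (simp add: algebra_simps)
    also have "\<dots> < 0" using a b by (simp add: divide_neg_pos)
    finally show False by simp
  qed
  then have w0: "w i = 0" if "i < m" for i using that by (simp add: nrm_eq_0)
  show ?thesis
  proof
    fix i show "mv m A v i = of_real (rayleigh m A v) * v i"
      using w0[of i] v(3)[of i] by (cases "i < m") (auto simp: w_def M_def mv_def)
  qed
qed

lemma continuous_on_coordinate [continuous_intros]:
  "continuous_on S (\<lambda>v::nat \<Rightarrow> 'b::topological_space. v i)"
  by (rule continuous_on_product_then_coordinatewise) (rule continuous_on_id)

lemma continuous_on_rayleigh: "continuous_on S (rayleigh m A)"
proof -
  have "rayleigh m A = (\<lambda>v. Re (\<Sum>i<m. cnj (v i) * (\<Sum>k<m. A i k * v k)))"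
    by (simp add: fun_eq_iff rayleigh_def ip_def mv_def)
  then show ?thesis by (auto intro!: continuous_intros)
qed

lemma continuous_on_nrm: "continuous_on S (nrm m)"
  unfolding nrm_def by (intro continuous_intros)

lemma continuous_on_ip: "continuous_on S (ip m v)"
  unfolding ip_def by (intro continuous_intros)

text \<open>In the product topology on functions the set is a closed part of a product of discs and,
  from index m on, of points {0}, which is compact by Tychonoff.\<close>

lemma compact_unit_sphere:
  assumes "closed C" shows "compact {v\<in>C. nrm m v = 1 \<and> (\<forall>i\<ge>m. v i = 0)}"
proof -
  let ?B = "PiE UNIV (\<lambda>i. if i < m then cball 0 1 else {0}) :: (nat \<Rightarrow> complex) set"
  have "compactin (product_topology (\<lambda>_. euclidean) UNIV) ?B"
    by (subst compactin_PiE) auto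
  then have B: "compact ?B" by (simp add: euclidean_product_topology)
  have cl: "closed ({v. nrm m v = 1} \<inter> {v. \<forall>i\<ge>m. v i = 0})"
  proof (intro closed_Int)
    show "closed {v. nrm m v = 1}"
      by (intro closed_Collect_eq continuous_on_nrm continuous_on_const)
    have "closed {v. v i = (0::complex)}" for i :: nat
      by (intro closed_Collect_eq continuous_intros)
    moreover have "{v. \<forall>i\<ge>m. v i = (0::complex)} = (\<Inter>i\<in>{m..}. {v. v i = 0})" by auto
    ultimately show "closed {v. \<forall>i\<ge>m. v i = (0::complex)}" by (simp add: closed_INT)
  qed
  have "cmod (v i) \<le> 1" if "nrm m v = 1" "i < m" for v i
  proof -
    have "(cmod (v i))\<^sup>2 \<le> (nrm m v)\<^sup>2"
      unfolding nrm_square using that(2) by (intro member_le_sum) auto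
    then show ?thesis using that(1) by (simp add: abs_square_le_1)
  qed
  then have "{v\<in>C. nrm m v = 1 \<and> (\<forall>i\<ge>m. v i = 0)} = ?B \<inter> (C \<inter> ({v. nrm m v = 1} \<inter> {v. \<forall>i\<ge>m. v i = 0}))"
    by (auto simp: PiE_def Pi_def)
  then show ?thesis using B cl assms by (auto intro!: compact_Int_closed closed_Int)
qed

text \<open>In the quaternionic case this is all of complex 2q-space, on which the structure acts
  through \<open>qj\<close>; only the real field restricts the values.\<close>

definition Fvec :: "fld \<Rightarrow> nat \<Rightarrow> (nat \<Rightarrow> complex) set" where
  "Fvec F q = {v. (\<forall>i\<ge>msz F q. v i = 0) \<and> (F = FR \<longrightarrow> (\<forall>i. Im (v i) = 0))}"

text \<open>Quaternionic matrices commute with right multiplication by j, so for a real eigenvalue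
  an eigenvector v brings \<open>qj v\<close> along.\<close>

lemma mv_qj:
  assumes "Frep FH q A" shows "mv (2 * q) A (qj v) = qj (mv (2 * q) A v)"
proof
  fix k
  have A: "A (2*i+1) (2*j+1) = cnj (A (2*i) (2*j))" "A (2*i+1) (2*j) = - cnj (A (2*i) (2*j+1))"
    if "i < q" "j < q" for i j
    using assms that by (auto simp: Frep_def)
  show "mv (2 * q) A (qj v) k = qj (mv (2 * q) A v) k"
  proof (cases "k < 2 * q")
    case True
    then show ?thesis
    proof (rule less_double_cases)
      fix a assume a: "a < q" "k = 2 * a"
      show ?thesis unfolding a(2) qj_simps using a(1)
        by (simp only: mv_def sum_pairs qj_simps)
           (use a(1) A[OF a(1)] in \<open>auto simp: algebra_simps simp flip: sum_negf intro!: sum.cong\<close>)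
    next
      fix a assume a: "a < q" "k = 2 * a + 1"
      show ?thesis unfolding a(2) qj_simps using a(1)
        by (simp only: mv_def sum_pairs qj_simps)
           (use a(1) A[OF a(1)] in \<open>auto simp: algebra_simps simp flip: sum_negf intro!: sum.cong\<close>)
    qed
  next
    case False
    then show ?thesis by (cases "even k") (auto simp: qj_def mv_def elim!: oddE)
  qed
qed

text \<open>If all standard basis vectors lay in the span of the family, the diagonal of the
  projection onto that span would consist of ones; its trace would be m, but it is s. The normalised
  residual of a basis vector outside the span stays real when the family is real.\<close>

lemma orthonormal_family_extends:
  assumes "s < msz F q" "\<And>l. l < s \<Longrightarrow> e l \<in> Fvec F q" 
    and on: "\<And>l l'. l < s \<Longrightarrow> l' < s \<Longrightarrow> ip (msz F q) (e l) (e l') = (if l = l' then 1 else 0)"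
  shows "\<exists>v\<in>Fvec F q. nrm (msz F q) v = 1 \<and> (\<forall>l<s. ip (msz F q) (e l) v = 0)"
proof -
  let ?m = "msz F q"
  define r where "r i = (\<lambda>k. (if k = i then 1 else 0) - (\<Sum>l<s. cnj (e l i) * e l k))" for i
  have "\<exists>i<?m. nrm ?m (r i) \<noteq> 0"
  proof (rule ccontr)
    assume "\<not> (\<exists>i<?m. nrm ?m (r i) \<noteq> 0)"
    then have "r i i = 0" if "i < ?m" for i using that by (auto simp: nrm_eq_0)
    then have 1: "(\<Sum>l<s. cnj (e l i) * e l i) = 1" if "i < ?m" for i using that by (simp add: r_def)
    have "of_nat ?m = (\<Sum>i<?m. \<Sum>l<s. cnj (e l i) * e l i)" by (simp add: 1)
    also have "\<dots> = (\<Sum>l<s. ip ?m (e l) (e l))" unfolding ip_def by (rule sum.swap)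
    also have "\<dots> = of_nat s" by (simp add: on)
    finally show False using assms(1) by simp
  qed
  then obtain i where i: "i < ?m" "nrm ?m (r i) \<noteq> 0" by blast
  let ?v = "\<lambda>k. of_real (1 / nrm ?m (r i)) * r i k"
  have "r i \<in> Fvec F q" using assms(2) i(1) by (auto simp: Fvec_def r_def)
  then have "?v \<in> Fvec F q" by (auto simp: Fvec_def)
  moreover have "nrm ?m ?v = 1" unfolding nrm_scale using i(2) by (simp add: norm_divide)
  moreover have "ip ?m (e l) ?v = 0" if "l < s" for l
  proof -
    have "ip ?m (e l) (\<lambda>k. if k = i then 1 else 0) = cnj (e l i)"
      using i(1) by (simp add: ip_def if_distrib[of "\<lambda>x. _ * x"] cong: if_cong)
    then have "ip ?m (e l) (r i) = 0"
      unfolding r_def ip_diff_right ip_sum_right ip_scale_right using on that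
      by (simp add: if_distrib[of "\<lambda>x. _ * x"] cong: if_cong)
    then show ?thesis unfolding ip_scale_right by simp
  qed
  ultimately show ?thesis by blast
qed

text \<open>Invariant of the deflation. Eigenvectors are counted in blocks of \<open>cF F\<close>
  with a common eigenvalue \<open>lam (l div cF F)\<close>. The last clause bounds the quadratic
  form on the orthogonal complement, which makes every later eigenvalue at most the earlier
  ones.\<close>

definition eigen_system :: "fld \<Rightarrow> nat \<Rightarrow> cmat \<Rightarrow> nat \<Rightarrow> (nat \<Rightarrow> nat \<Rightarrow> complex) \<Rightarrow> (nat \<Rightarrow> real) \<Rightarrow> bool" where
  "eigen_system F q A k e lam \<longleftrightarrow>
    (\<forall>l<cF F * k. e l \<in> Fvec F q \<and> mv (msz F q) A (e l) = (\<lambda>i. of_real (lam (l div cF F)) * e l i)) \<and>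
    (\<forall>l<cF F * k. \<forall>l'<cF F * k. ip (msz F q) (e l) (e l') = (if l = l' then 1 else 0)) \<and>
    (F = FH \<longrightarrow> (\<forall>a<k. e (2 * a + 1) = qj (e (2 * a)))) \<and>
    (\<forall>i j. i \<le> j \<longrightarrow> j < k \<longrightarrow> lam j \<le> lam i) \<and>
    (\<forall>v\<in>Fvec F q. nrm (msz F q) v = 1 \<longrightarrow> (\<forall>l<cF F * k. ip (msz F q) (e l) v = 0) \<longrightarrow>
       (\<forall>l<k. rayleigh (msz F q) A v \<le> lam l))"

lemma eigen_system_step:
  assumes A: "Frep F q A" "ctr (msz F q) A = A" and k: "k < q" and es: "eigen_system F q A k e lam"
  shows "\<exists>e' lam'. eigen_system F q A (Suc k) e' lam'"
proof -
  let ?m = "msz F q" let ?s = "cF F * k"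
  have s: "?s < ?m" using k by (simp add: msz_def)
  note es = es[unfolded eigen_system_def]
  have eF: "e l \<in> Fvec F q" and eA: "mv ?m A (e l) = (\<lambda>i. of_real (lam (l div cF F)) * e l i)"
    if "l < ?s" for l using es that by auto
  have eon: "ip ?m (e l) (e l') = (if l = l' then 1 else 0)" if "l < ?s" "l' < ?s" for l l'
    using es that by auto
  have eq: "e (2 * a + 1) = qj (e (2 * a))" if "F = FH" "a < k" for a
    using es that by auto
  have anti: "lam j \<le> lam i" if "i \<le> j" "j < k" for i j using es that by auto
  have bound: "rayleigh ?m A v \<le> lam l"
    if "v \<in> Fvec F q" "nrm ?m v = 1" "\<And>l. l < ?s \<Longrightarrow> ip ?m (e l) v = 0" "l < k" for v l
    using es that by auto
  define S where "S = {v \<in> Fvec F q. \<forall>l<?s. ip ?m (e l) v = 0}"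
  \<comment> \<open>C omits the requirement that vectors vanish from index m on; the compactness
    lemma adds it, and then C and S have the same unit vectors.\<close>
  define C where "C = {v. (F = FR \<longrightarrow> (\<forall>i. Im (v i) = 0)) \<and> (\<forall>l<?s. ip ?m (e l) v = 0)}"
  have "closed C"
  proof -
    have "closed {v. Im (v i) = 0}" for i :: nat
      by (intro closed_Collect_eq continuous_intros)
    moreover have "closed {v. ip ?m (e l) v = 0}" for l
      by (intro closed_Collect_eq continuous_on_ip continuous_on_const)
    moreover have "C = (if F = FR then \<Inter>i. {v. Im (v i) = 0} else UNIV) \<inter> (\<Inter>l\<in>{..<?s}. {v. ip ?m (e l) v = 0})"
      by (auto simp: C_def)
    ultimately show ?thesis by (auto intro!: closed_Int closed_INT)
  qed
  then have cpt: "compact {v\<in>C. nrm ?m v = 1 \<and> (\<forall>i\<ge>?m. v i = 0)}" by (rule compact_unit_sphere)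
  have SC: "{v\<in>C. nrm ?m v = 1 \<and> (\<forall>i\<ge>?m. v i = 0)} = {v\<in>S. nrm ?m v = 1}"
    by (auto simp: S_def C_def Fvec_def)
  have "{v\<in>S. nrm ?m v = 1} \<noteq> {}"
    using orthonormal_family_extends[OF s eF eon] by (auto simp: S_def)
  with cpt obtain v where v: "v \<in> S" "nrm ?m v = 1"
    and vmax: "\<And>w. w \<in> S \<Longrightarrow> nrm ?m w = 1 \<Longrightarrow> rayleigh ?m A w \<le> rayleigh ?m A v"
    unfolding SC using continuous_attains_sup[OF _ _ continuous_on_rayleigh, of "{v\<in>S. nrm ?m v = 1}" ?m A]
    by auto
  define M where "M = rayleigh ?m A v"
  have vo: "ip ?m (e l) v = 0" if "l < ?s" for l
    using v(1) that by (auto simp: S_def)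
  have vF: "v \<in> Fvec F q" using v(1) by (auto simp: S_def)
  have vo': "ip ?m v (e l) = 0" if "l < ?s" for l using vo[OF that] by (simp add: ip_commute[of ?m v])
  have vA: "mv ?m A v = (\<lambda>i. of_real M * v i)"
    unfolding M_def
  proof (rule rayleigh_maximizer_eigenvector[OF A(2), of S])
    fix w c assume w: "w \<in> S"
    show "(\<lambda>i. complex_of_real c * w i) \<in> S"
      using w by (auto simp: S_def Fvec_def ip_scale_right)
    \<comment> \<open>A is its own adjoint and e l an eigenvector, so A maps the complement of the
      family into itself.\<close>
    have "ip ?m (e l) (mv ?m A w) = 0" if l: "l < ?s" for l
      using w l by (subst ip_mv) (simp add: A(2) eA ip_scale_left S_def)
    moreover have "mv ?m A w \<in> Fvec F q"
      using w A(1) by (cases F) (auto simp: S_def Fvec_def mv_def Frep_def)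
    ultimately show "mv ?m A w \<in> S" by (simp add: S_def)
  next
    fix w w' assume "w \<in> S" "w' \<in> S"
    then show "(\<lambda>i. w i + w' i) \<in> S" by (auto simp: S_def Fvec_def ip_add_right)
  qed (use v vmax vF in \<open>auto simp: Fvec_def\<close>)
  have vv: "ip ?m v v = 1" using v(2) by (simp add: ip_self)
  \<comment> \<open>For quaternions v and \<open>qj v\<close> enter together with the same
    eigenvalue; for the other fields the last branch lies beyond the new length.\<close>
  define e' where "e' l = (if l < ?s then e l else if l = ?s then v else qj v)" for l
  define lam' where "lam' j = (if j < k then lam j else M)" for j
  have lam'_div: "lam' (l div cF F) = lam (l div cF F)" if "l < ?s" for l
    using that by (auto simp: lam'_def less_mult_imp_div_less mult.commute)
  have index: "l < ?s \<or> l = ?s \<or> F = FH \<and> l = 2 * k + 1" if "l < cF F * Suc k" for l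
    using that by (cases F) auto
  have new: "lam' (l div cF F) = M" if "l = ?s \<or> F = FH \<and> l = 2 * k + 1" for l
    using that by (auto simp: lam'_def)
  have q: "qj v \<in> Fvec F q" "mv ?m A (qj v) = (\<lambda>i. of_real M * qj v i)"
    "ip ?m (qj v) (qj v) = 1" "ip ?m v (qj v) = 0" "ip ?m (qj v) v = 0"
    "\<And>l. l < ?s \<Longrightarrow> ip ?m (e l) (qj v) = 0" "\<And>l. l < ?s \<Longrightarrow> ip ?m (qj v) (e l) = 0" if F: "F = FH"
  proof -
    show "qj v \<in> Fvec F q"
      using vF F by (auto simp: Fvec_def qj_def elim!: oddE)
    show "mv ?m A (qj v) = (\<lambda>i. of_real M * qj v i)"
      using A(1) vA F by (auto simp: mv_qj qj_def)
    show "ip ?m (qj v) (qj v) = 1" "ip ?m v (qj v) = 0" using F vv by (simp_all add: ip_qj_qj ip_qj_self)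
    then show "ip ?m (qj v) v = 0" by (simp add: ip_commute[of ?m "qj v" v])
    show 1: "ip ?m (e l) (qj v) = 0" if "l < ?s" for l
    proof -
      have "l < 2 * k" using that F by simp
      then show ?thesis
      proof (rule less_double_cases)
        fix a assume a: "a < k" "l = 2 * a"
        then have "ip ?m (e (2 * a + 1)) v = 0" using F by (intro vo) auto
        then show ?thesis using F a eq[OF F a(1)] by (simp add: ip_qj_right)
      next
        fix a assume a: "a < k" "l = 2 * a + 1"
        then have "ip ?m (e (2 * a)) v = 0" using F by (intro vo) auto
        then show ?thesis using F a eq[OF F a(1)] by (simp add: ip_qj_qj)
      qed
    qed
    show "ip ?m (qj v) (e l) = 0" if "l < ?s" for l
      using 1[OF that] by (simp add: ip_commute[of ?m "qj v" "e l"])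
  qed
  have "eigen_system F q A (Suc k) e' lam'"
    unfolding eigen_system_def
  proof (intro conjI allI impI ballI)
    fix l assume l: "l < cF F * Suc k"
    show "e' l \<in> Fvec F q" using index[OF l] eF vF q by (auto simp: e'_def)
    show "mv ?m A (e' l) = (\<lambda>i. of_real (lam' (l div cF F)) * e' l i)"
    proof (cases "l < ?s")
      case True then show ?thesis using eA[OF True] by (simp add: e'_def lam'_div)
    next
      case False
      then have "l = ?s \<or> F = FH \<and> l = 2 * k + 1" using index[OF l] by auto
      then show ?thesis using new[of l] False vA q by (auto simp: e'_def)
    qed
    fix l' assume l': "l' < cF F * Suc k"
    show "ip ?m (e' l) (e' l') = (if l = l' then 1 else 0)"
      using index[OF l] index[OF l'] eon vo vo' vv q by (elim disjE conjE) (simp_all add: e'_def)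
  next
    fix a assume F: "F = FH" and a: "a < Suc k"
    show "e' (2 * a + 1) = qj (e' (2 * a))"
      using a F eq[OF F, of a] by (cases "a < k") (auto simp: e'_def)
  next
    fix i j assume ij: "i \<le> j" "j < Suc k"
    \<comment> \<open>The new vector is admissible in the bounding clause of the old system, hence
      the decreasing order.\<close>
    have "M \<le> lam i" if "i < k" unfolding M_def using bound[OF vF v(2) vo that] .
    then show "lam' j \<le> lam' i" using ij anti by (auto simp: lam'_def)
  next
    fix w l assume w: "w \<in> Fvec F q" "nrm ?m w = 1" "\<forall>l<cF F * Suc k. ip ?m (e' l) w = 0" and l: "l < Suc k"
    have wo: "ip ?m (e l) w = 0" if "l < ?s" for l
      using w(3)[rule_format, of l] that by (simp add: e'_def)
    show "rayleigh ?m A w \<le> lam' l"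
    proof (cases "l < k")
      case True then show ?thesis using bound[OF w(1,2) wo True] by (simp add: lam'_def)
    next
      case False
      then show ?thesis using vmax[of w] w wo by (simp add: lam'_def M_def S_def)
    qed
  qed
  then show ?thesis by blast
qed

definition diagF :: "fld \<Rightarrow> nat \<Rightarrow> (nat \<Rightarrow> real) \<Rightarrow> cmat" where
  "diagF F q d = (\<lambda>i j. if i < msz F q \<and> j = i then of_real (d (i div cF F)) else 0)"

lemma in_mat_diagF [simp]: "in_mat (msz F q) (diagF F q d)"
  by (auto simp: in_mat_def diagF_def)

text \<open>The eigenvectors of a complete \<open>eigen_system\<close> are the columns of V.
  Realness or the pairing by \<open>qj\<close> puts V into \<open>UF F q\<close>, not merely into
  the complex unitary group, and \<open>diagF\<close> repeats each eigenvalue \<open>cF F\<close>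
  times.\<close>

theorem spectral_theorem:
  assumes A: "Frep F q A" "ctr (msz F q) A = A"
  obtains V lam where "V \<in> UF F q" "\<And>i j. i \<le> j \<Longrightarrow> j < q \<Longrightarrow> lam j \<le> lam i"
    "A = mmul (msz F q) V (mmul (msz F q) (diagF F q lam) (ctr (msz F q) V))"
proof -
  let ?m = "msz F q"
  have "k \<le> q \<Longrightarrow> \<exists>e lam. eigen_system F q A k e lam" for k
  proof (induction k)
    case 0 show ?case by (auto simp: eigen_system_def)
  next
    case (Suc k) then show ?case using eigen_system_step[OF A] by (meson Suc_le_lessD Suc_leD)
  qed
  from this[OF order_refl] obtain e lam where es: "eigen_system F q A q e lam" by blast
  note es = es[unfolded eigen_system_def, folded msz_def]
  define V where "V i l = (if i < ?m \<and> l < ?m then e l i else 0)" for i l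
  have V_in: "in_mat ?m V" by (auto simp: in_mat_def V_def)
  have unit: "mmul ?m (ctr ?m V) V = idm ?m"
  proof (rule in_mat_eqI[of ?m])
    fix i j assume ij: "i < ?m" "j < ?m"
    have "mmul ?m (ctr ?m V) V i j = ip ?m (e i) (e j)"
      unfolding ip_columns[OF ij] using ij by (intro ip_cong) (auto simp: V_def)
    then show "mmul ?m (ctr ?m V) V i j = idm ?m i j" using es ij by (auto simp: idm_def)
  qed auto
  have "Frep F q V"
  proof (cases F)
    case FR
    then show ?thesis using es V_in by (auto simp: Frep_def V_def Fvec_def)
  next
    case FC then show ?thesis using V_in by (simp add: Frep_def)
  next
    case FH
    have "V k (2 * a + 1) = qj (\<lambda>k. V k (2 * a)) k" if "a < q" "k < 2 * q" for a k
    proof -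
      have "V k (2 * a + 1) = qj (e (2 * a)) k" using es FH that by (simp add: V_def)
      also have "\<dots> = qj (\<lambda>k. V k (2 * a)) k" using FH that by (intro qj_cong) (auto simp: V_def)
      finally show ?thesis .
    qed
    then show ?thesis using V_in FH by (auto simp: Frep_FH_iff)
  qed
  then have V: "V \<in> UF F q" using unit by (simp add: UF_def)
  have AV: "mmul ?m A V = mmul ?m V (diagF F q lam)"
  proof (rule in_mat_eqI[of ?m])
    fix i j assume ij: "i < ?m" "j < ?m"
    have "mmul ?m A V i j = mv ?m A (e j) i" using ij by (simp add: mmul_def mv_def V_def)
    also have "\<dots> = of_real (lam (j div cF F)) * e j i" using es ij by simp
    also have "\<dots> = mmul ?m V (diagF F q lam) i j"
      using ij by (simp add: mmul_def diagF_def V_def if_distrib[of "\<lambda>x. _ * x"] cong: if_cong)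
    finally show "mmul ?m A V i j = mmul ?m V (diagF F q lam) i j" .
  qed auto
  have "A = mmul ?m (mmul ?m A V) (ctr ?m V)"
    using UF_ctr_right[OF V] Frep_in_mat[OF A(1)] by (simp add: mmul_assoc mmul_idm_right)
  then have "A = mmul ?m V (mmul ?m (diagF F q lam) (ctr ?m V))" by (simp add: AV mmul_assoc)
  with V es show ?thesis by (intro that[of V lam]) auto
qed

subsection \<open>Eigenvalue lists\<close>

lemma order_linear: "order a [:- b, 1:] = (if a = b then 1 else 0)" for a :: "'a::idom"
proof (cases "a = b")
  case True then show ?thesis using order_power_n_n[of a 1] by simp
next
  case False then show ?thesis by (simp add: order_0I)
qed

lemma order_prod_linear:
  "order (complex_of_real x) (\<Prod>i<m. [:- complex_of_real (d i), 1:]) = count (mset (map d [0..<m])) x"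
proof (induction m)
  case (Suc m)
  have "(\<Prod>i<m. [:- complex_of_real (d i), 1:]) \<noteq> 0" by (simp add: prod_zero_iff)
  then have nz: "(\<Prod>i<m. [:- complex_of_real (d i), 1:]) * [:- complex_of_real (d m), 1:] \<noteq> 0"
    by (metis mult_eq_0_iff one_neq_zero pCons_eq_0_iff)
  show ?case unfolding prod.lessThan_Suc order_mult[OF nz] Suc order_linear by simp
qed simp

text \<open>The orders of the roots fix the multiset of eigenvalues and the sorting fixes the list,
  so the definite description has a unique witness once the polynomial splits over the
  reals.\<close>

lemma eigs_eq:
  assumes "charpoly m A = (\<Prod>i<m. [:- complex_of_real (d i), 1:])"
    and anti: "\<And>i j. i \<le> j \<Longrightarrow> j < m \<Longrightarrow> d j \<le> d i"
  shows "eigs m A = map d [0..<m]"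
  unfolding eigs_def
proof (rule the_equality)
  have sorted: "sorted_wrt (\<ge>) (map d [0..<m])"
    using anti by (auto simp: sorted_wrt_iff_nth_less)
  show P: "length (map d [0..<m]) = m \<and> sorted_wrt (\<ge>) (map d [0..<m]) \<and>
      (\<forall>x. count (mset (map d [0..<m])) x = order (complex_of_real x) (charpoly m A))"
    using sorted by (simp only: assms(1) order_prod_linear) simp
  fix xs assume xs: "length xs = m \<and> sorted_wrt (\<ge>) xs \<and>
      (\<forall>x. count (mset xs) x = order (complex_of_real x) (charpoly m A))"
  with P have "mset xs = mset (map d [0..<m])" by (intro multiset_eqI) metis
  moreover have "sorted (rev xs)" "sorted (rev (map d [0..<m]))"
    using xs sorted by (simp_all only: sorted_wrt_rev)
  ultimately have "rev xs = rev (map d [0..<m])"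
    by (metis mset_rev properties_for_sort)
  then show "xs = map d [0..<m]" by simp
qed

lemma charpoly_diagonalized:
  assumes "V \<in> UF F q" "A = mmul (msz F q) V (mmul (msz F q) (diagF F q d) (ctr (msz F q) V))"
  shows "charpoly (msz F q) A = (\<Prod>i<msz F q. [:- complex_of_real (d (i div cF F)), 1:])"
  unfolding assms(2) charpoly_similar[OF UF_ctr_right[OF assms(1)]]
  by (subst charpoly_diag) (auto simp: diagF_def)

lemma eigs_diagonalized:
  assumes "V \<in> UF F q" "A = mmul (msz F q) V (mmul (msz F q) (diagF F q d) (ctr (msz F q) V))"
    "\<And>i j. i \<le> j \<Longrightarrow> j < q \<Longrightarrow> d j \<le> d i"
  shows "eigs (msz F q) A = map (\<lambda>i. d (i div cF F)) [0..<msz F q]"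
proof (rule eigs_eq[OF charpoly_diagonalized[OF assms(1,2)]])
  fix i j assume "i \<le> j" "j < msz F q"
  then show "d (j div cF F) \<le> d (i div cF F)"
    by (intro assms(3) div_le_mono) (auto simp: msz_def less_mult_imp_div_less mult.commute)
qed

subsection \<open>Singular values and leading minors\<close>

text \<open>The order of the factors is opposite to that in \<open>sing_vals\<close>: left factors
  of g then act by congruence. For invertible g both products have the same characteristic
  polynomial, see \<open>charpoly_gram_ctr\<close>.\<close>

definition gram :: "nat \<Rightarrow> cmat \<Rightarrow> cmat" where
  "gram m g = mmul m g (ctr m g)"

text \<open>On Gram matrices these are the logarithms of the diagonal entries in the Iwasawa
  decomposition, see \<open>iwa_gram_eq\<close>.\<close>

definition iwa :: "fld \<Rightarrow> nat \<Rightarrow> cmat \<Rightarrow> real" where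
  "iwa F j x = ln (Delta F (Suc j) x / Delta F j x) / 2"

lemma exp2diag_diagF: "exp2diag F q t = diagF F q (\<lambda>i. exp (2 * t i))"
  by (simp add: exp2diag_def diagF_def)

lemma mmul_ctr_diag: "i < m \<Longrightarrow> mmul m h (ctr m h) i i = of_real (\<Sum>k<m. (cmod (h i k))\<^sup>2)"
  by (simp add: mmul_def ctr_def complex_norm_square[symmetric] del: of_real_power)

lemma in_mat_gram [simp]: "in_mat m (gram m g)" by (simp add: gram_def)

lemma Frep_gram: "Frep F q g \<Longrightarrow> Frep F q (gram (msz F q) g)"
  by (simp add: gram_def Frep_mmul Frep_ctr)

lemma ctr_gram: "in_mat m g \<Longrightarrow> ctr m (gram m g) = gram m g"
  by (simp add: gram_def ctr_mmul ctr_ctr)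

lemma gram_mmul: "gram m (mmul m h g) = mmul m h (mmul m (gram m g) (ctr m h))"
  by (simp add: gram_def ctr_mmul mmul_assoc)

lemma GLF_inverse:
  assumes "g \<in> GLF F q"
  obtains g' where "g' \<in> GLF F q" "mmul (msz F q) g g' = idm (msz F q)" "mmul (msz F q) g' g = idm (msz F q)"
  using assms by (auto simp: GLF_def)

text \<open>Positivity: the diagonalised matrix is again a Gram matrix, so its diagonal consists of
  sums of squares, and its invertibility excludes 0.\<close>

lemma gram_spectral:
  assumes g: "g \<in> GLF F q"
  obtains V lam where "V \<in> UF F q" "\<And>i j. i \<le> j \<Longrightarrow> j < q \<Longrightarrow> lam j \<le> lam i" "\<And>i. i < q \<Longrightarrow> lam i > 0"
    "gram (msz F q) g = mmul (msz F q) V (mmul (msz F q) (diagF F q lam) (ctr (msz F q) V))"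
proof -
  let ?m = "msz F q"
  obtain V lam where V: "V \<in> UF F q" and anti: "\<And>i j. i \<le> j \<Longrightarrow> j < q \<Longrightarrow> lam j \<le> lam i"
    and eq: "gram ?m g = mmul ?m V (mmul ?m (diagF F q lam) (ctr ?m V))"
    using spectral_theorem[OF Frep_gram[OF GLF_Frep[OF g]] ctr_gram[OF GLF_in_mat[OF g]]] by blast
  define h where "h = mmul ?m (ctr ?m V) g"
  have "gram ?m h = mmul ?m (ctr ?m V) (mmul ?m (gram ?m g) V)"
    by (simp add: h_def gram_mmul ctr_ctr UF_in_mat[OF V])
  also have "\<dots> = diagF F q lam"
    by (simp add: eq mmul_assoc UF_cancel(2)[OF V] UF_ctr_left[OF V] mmul_idm_right)
  finally have D: "gram ?m h = diagF F q lam" .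
  have h: "h \<in> GLF F q" unfolding h_def by (intro GLF_mmul UF_GLF UF_ctr V g)
  then have hh: "gram ?m h \<in> GLF F q" unfolding gram_def by (intro GLF_mmul GLF_ctr)
  then obtain E where E: "mmul ?m (diagF F q lam) E = idm ?m" unfolding D by (rule GLF_inverse)
  have "lam i > 0" if i: "i < q" for i
  proof -
    let ?k = "cF F * i"
    have k: "?k < ?m" using i by (simp add: msz_def)
    have "mmul ?m (diagF F q lam) E ?k ?k = of_real (lam i) * E ?k ?k"
      using k by (simp add: mmul_def diagF_def if_distrib[of "\<lambda>x. x * _"] cong: if_cong)
    then have "lam i \<noteq> 0" using E k by (auto simp: idm_def)
    moreover have "complex_of_real (lam i) = of_real (\<Sum>l<?m. (cmod (h ?k l))\<^sup>2)"
      using mmul_ctr_diag[OF k, of h] k unfolding gram_def[symmetric] D by (simp add: diagF_def)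
    then have "lam i \<ge> 0" unfolding of_real_eq_iff by (simp add: sum_nonneg)
    ultimately show ?thesis by simp
  qed
  with V anti eq show ?thesis using that by blast
qed

text \<open>\<open>eigs\<close> sees only the characteristic polynomial, so any diagonalised A with
  the right polynomial displays the singular values of g. It is applied to both orders of the
  product of g with its adjoint.\<close>

lemma ln_sing_eq:
  assumes V: "V \<in> UF F q" and anti: "\<And>i j. i \<le> j \<Longrightarrow> j < q \<Longrightarrow> lam j \<le> lam i"
    and pos: "\<And>i. i < q \<Longrightarrow> lam i > 0"
    and A: "A = mmul (msz F q) V (mmul (msz F q) (diagF F q lam) (ctr (msz F q) V))"
    and cp: "charpoly (msz F q) A = charpoly (msz F q) (mmul (msz F q) (ctr (msz F q) g) g)"
  shows "A = mmul (msz F q) V (mmul (msz F q) (exp2diag F q (ln_sing F q g)) (ctr (msz F q) V))"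
    and "\<And>i j. i \<le> j \<Longrightarrow> j < q \<Longrightarrow> ln_sing F q g j \<le> ln_sing F q g i"
proof -
  let ?m = "msz F q"
  have eigs: "eigs ?m (mmul ?m (ctr ?m g) g) = map (\<lambda>i. lam (i div cF F)) [0..<?m]"
    using eigs_diagonalized[OF V A anti] unfolding eigs_def cp by simp
  have ln_sing: "ln_sing F q g i = ln (sqrt (lam i))" if "i < q" for i
  proof -
    have "cF F * i < ?m" using that by (simp add: msz_def)
    then show ?thesis using that by (simp add: ln_sing_def sing_vals_def eigs)
  qed
  then have "exp (2 * ln_sing F q g i) = lam i" if "i < q" for i
    using pos[OF that] that by (simp add: ln_sqrt)
  then have "exp2diag F q (ln_sing F q g) = diagF F q lam"
    by (auto simp: exp2diag_diagF diagF_def fun_eq_iff msz_def less_mult_imp_div_less mult.commute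
        simp flip: of_real_exp)
  with A show "A = mmul ?m V (mmul ?m (exp2diag F q (ln_sing F q g)) (ctr ?m V))" by simp
  show "ln_sing F q g j \<le> ln_sing F q g i" if "i \<le> j" "j < q" for i j
    using anti[OF that] pos[OF that(2)] that by (simp add: ln_sing)
qed

text \<open>Conjugation by g carries one product into the other.\<close>

lemma charpoly_gram_ctr:
  assumes "g \<in> GLF F q"
  shows "charpoly (msz F q) (gram (msz F q) g) = charpoly (msz F q) (gram (msz F q) (ctr (msz F q) g))"
proof -
  let ?m = "msz F q"
  obtain g' where g': "mmul ?m g' g = idm ?m" using GLF_inverse[OF assms] by blast
  have "gram ?m (ctr ?m g) = mmul ?m (ctr ?m g) g"
    by (simp add: gram_def ctr_ctr GLF_in_mat[OF assms])
  also have "\<dots> = mmul ?m g' (mmul ?m (gram ?m g) g)"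
  proof -
    have "mmul ?m g' (mmul ?m (gram ?m g) g) = mmul ?m (mmul ?m g' g) (mmul ?m (ctr ?m g) g)"
      by (simp only: gram_def mmul_assoc)
    then show ?thesis by (simp add: g' mmul_idm_left)
  qed
  finally show ?thesis by (simp add: charpoly_similar[OF g'])
qed

lemma gram_ln_sing:
  assumes g: "g \<in> GLF F q"
  obtains V where "V \<in> UF F q"
    "gram (msz F q) g = mmul (msz F q) V (mmul (msz F q) (exp2diag F q (ln_sing F q g)) (ctr (msz F q) V))"
proof -
  obtain V lam where V: "V \<in> UF F q" "\<And>i j. i \<le> j \<Longrightarrow> j < q \<Longrightarrow> lam j \<le> lam i" "\<And>i. i < q \<Longrightarrow> lam i > 0"
    "gram (msz F q) g = mmul (msz F q) V (mmul (msz F q) (diagF F q lam) (ctr (msz F q) V))"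
    using gram_spectral[OF g] by blast
  have "charpoly (msz F q) (gram (msz F q) g) = charpoly (msz F q) (mmul (msz F q) (ctr (msz F q) g) g)"
    using charpoly_gram_ctr[OF g] by (simp add: gram_def ctr_ctr GLF_in_mat[OF g])
  from ln_sing_eq(1)[OF V this] V(1) show ?thesis using that by blast
qed

lemma gram_ctr_ln_sing:
  assumes g: "g \<in> GLF F q"
  obtains V where "V \<in> UF F q"
    "gram (msz F q) (ctr (msz F q) g) =
      mmul (msz F q) V (mmul (msz F q) (exp2diag F q (ln_sing F q g)) (ctr (msz F q) V))"
    "\<And>i j. i \<le> j \<Longrightarrow> j < q \<Longrightarrow> ln_sing F q g j \<le> ln_sing F q g i"
proof -
  let ?A = "gram (msz F q) (ctr (msz F q) g)"
  obtain V lam where V: "V \<in> UF F q" "\<And>i j. i \<le> j \<Longrightarrow> j < q \<Longrightarrow> lam j \<le> lam i" "\<And>i. i < q \<Longrightarrow> lam i > 0"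
    "?A = mmul (msz F q) V (mmul (msz F q) (diagF F q lam) (ctr (msz F q) V))"
    using gram_spectral[OF GLF_ctr[OF g]] by blast
  have "charpoly (msz F q) ?A = charpoly (msz F q) (mmul (msz F q) (ctr (msz F q) g) g)"
    by (simp add: gram_def ctr_ctr GLF_in_mat[OF g])
  from ln_sing_eq[OF V this] V(1) show ?thesis using that by blast
qed

section \<open>Leading minors under triangular congruence and the Iwasawa decomposition\<close>

definition utri :: "cmat \<Rightarrow> bool" where
  "utri R \<longleftrightarrow> (\<forall>i j. j < i \<longrightarrow> R i j = 0)"

lemma utriD: "utri R \<Longrightarrow> j < i \<Longrightarrow> R i j = 0"
  by (simp add: utri_def)

lemma detm_0 [simp]: "detm 0 A = 1" by (simp add: detm_def)

text \<open>For upper triangular R the leading block of order s of the congruent matrix involves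
  only the leading blocks of R and B, so the determinant of the block is multiplicative.\<close>

lemma detm_triangular_congruence:
  assumes R: "utri R" and s: "s \<le> m"
  shows "detm s (mmul m (ctr m R) (mmul m B R)) = of_real ((cmod (detm s R))\<^sup>2) * detm s B"
proof -
  let ?L = "\<lambda>i j. cnj (R j i)"
  have trunc: "(\<Sum>l<m. f l * R l j) = (\<Sum>l<s. f l * R l j)" if "j < s" for f j
    using utriD[OF R] that s by (intro sum.mono_neutral_right) auto
  have "detm s (mmul m (ctr m R) (mmul m B R)) = detm s (\<lambda>i j. \<Sum>k<s. ?L i k * (\<Sum>l<s. B k l * R l j))"
  proof (rule detm_cong)
    fix i j assume ij: "i < s" "j < s"
    have "(\<Sum>k<m. cnj (R k i) * (\<Sum>l<m. B k l * R l j)) = (\<Sum>k<s. cnj (R k i) * (\<Sum>l<m. B k l * R l j))"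
      using utriD[OF R] ij s by (intro sum.mono_neutral_right) auto
    then show "mmul m (ctr m R) (mmul m B R) i j = (\<Sum>k<s. ?L i k * (\<Sum>l<s. B k l * R l j))"
      using ij s by (simp add: mmul_def ctr_def trunc)
  qed
  also have "\<dots> = detm s ?L * (detm s B * detm s R)"
    by (simp only: detm_mult[of s ?L] detm_mult[of s B])
  also have "detm s ?L = cnj (detm s R)"
    by (subst detm_lower, simp add: utriD[OF R], subst detm_upper) (auto simp: utriD[OF R])
  finally show ?thesis by (simp add: complex_norm_square mult_ac del: of_real_power)
qed

text \<open>The factor coming from R is a nonnegative real number, hence passes through the real
  part and, for quaternions, through the square root in \<open>Delta\<close>. It is itself a minor,
  namely of the Gram matrix of the group element to which R belongs.\<close>

lemma Delta_triangular_congruence: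
  assumes R: "utri R" and r: "r \<le> q"
  shows "Delta F r (mmul (msz F q) (ctr (msz F q) R) (mmul (msz F q) B R)) =
    Delta F r (mmul (msz F q) (ctr (msz F q) R) R) * Delta F r B"
proof -
  have s: "cF F * r \<le> msz F q" using r by (simp add: msz_def)
  have 1: "detm (cF F * r) (mmul (msz F q) (ctr (msz F q) R) R) = of_real ((cmod (detm (cF F * r) R))\<^sup>2)"
  proof -
    have "mmul (msz F q) (ctr (msz F q) R) (mmul (msz F q) (idm (msz F q)) R)
        = mmul (msz F q) (ctr (msz F q) R) R"
      by (simp flip: mmul_assoc add: mmul_idm_right)
    moreover have "detm (cF F * r) (idm (msz F q)) = 1"
      using s by (subst detm_upper) (auto simp: idm_def)
    ultimately show ?thesis
      using detm_triangular_congruence[where R = R and B = "idm (msz F q)", OF R s] by simp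
  qed
  define c where "c = (cmod (detm (cF F * r) R))\<^sup>2"
  have "detm (cF F * r) (mmul (msz F q) (ctr (msz F q) R) (mmul (msz F q) B R)) =
      of_real c * detm (cF F * r) B"
    unfolding c_def by (rule detm_triangular_congruence[OF R s])
  then have "Re (detm (cF F * r) (mmul (msz F q) (ctr (msz F q) R) (mmul (msz F q) B R))) =
      c * Re (detm (cF F * r) B)" by simp
  moreover have "Re (detm (cF F * r) (mmul (msz F q) (ctr (msz F q) R) R)) = c"
    using 1 unfolding c_def[symmetric] by simp
  ultimately show ?thesis by (cases F) (auto simp: Delta_def real_sqrt_mult)
qed

lemma QR_diag_nonzero:
  assumes g: "g \<in> GLF F q" and R: "utri R"
    "R = mmul (msz F q) (ctr (msz F q) (gs (msz F q) g)) g" and i: "i < msz F q"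
  shows "R i i \<noteq> 0"
proof -
  have "R \<in> GLF F q" unfolding R(2) by (intro GLF_mmul UF_GLF UF_ctr gs_UF g)
  then obtain R' where "mmul (msz F q) R R' = idm (msz F q)" by (rule GLF_inverse)
  then have "detm (msz F q) R * detm (msz F q) R' = 1" by (metis detm_mmul detm_idm)
  then have "detm (msz F q) R \<noteq> 0" by auto
  then show ?thesis using i by (subst (asm) detm_upper) (auto simp: utriD[OF R(1)])
qed

text \<open>QR decomposition of the adjoint of h, so that the triangular factor of h, now lower
  triangular, stands on the left. Both factors are given explicitly as functions of h.\<close>

lemma Iwasawa_decomposition:
  assumes h: "h \<in> GLF F q"
  obtains u R where "u \<in> UF F q" "Frep F q R" "utri R"
    "\<And>i. i < msz F q \<Longrightarrow> R i i \<noteq> 0" "h = mmul (msz F q) (ctr (msz F q) R) (ctr (msz F q) u)"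
    "u = gs (msz F q) (ctr (msz F q) h)" "R = mmul (msz F q) (ctr (msz F q) u) (ctr (msz F q) h)"
proof -
  let ?m = "msz F q"
  note ch = GLF_ctr[OF h]
  obtain R where R: "Frep F q R" "\<And>i j. j < i \<Longrightarrow> R i j = 0"
    "ctr ?m h = mmul ?m (gs ?m (ctr ?m h)) R" "R = mmul ?m (ctr ?m (gs ?m (ctr ?m h))) (ctr ?m h)"
    using QR_decomposition[OF ch] by metis
  have "h = ctr ?m (ctr ?m h)" by (simp add: ctr_ctr GLF_in_mat[OF h])
  also have "\<dots> = mmul ?m (ctr ?m R) (ctr ?m (gs ?m (ctr ?m h)))" by (subst R(3)) (rule ctr_mmul)
  finally have eq: "h = mmul ?m (ctr ?m R) (ctr ?m (gs ?m (ctr ?m h)))" .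
  have tri: "utri R" using R(2) by (simp add: utri_def)
  show ?thesis
    by (rule that[OF gs_UF[OF ch] R(1) tri QR_diag_nonzero[OF ch tri R(4)] eq refl R(4)])
qed

lemma gram_Iwasawa:
  assumes "u \<in> UF F q" "in_mat (msz F q) R" "h = mmul (msz F q) (ctr (msz F q) R) (ctr (msz F q) u)"
  shows "gram (msz F q) (mmul (msz F q) h g) =
      mmul (msz F q) (ctr (msz F q) R) (mmul (msz F q) (gram (msz F q) (mmul (msz F q) (ctr (msz F q) u) g)) R)"
    "gram (msz F q) h = mmul (msz F q) (ctr (msz F q) R) R"
proof -
  let ?m = "msz F q"
  have "mmul ?m h g = mmul ?m (ctr ?m R) (mmul ?m (ctr ?m u) g)" by (simp add: assms(3) mmul_assoc)
  then show "gram ?m (mmul ?m h g) = mmul ?m (ctr ?m R) (mmul ?m (gram ?m (mmul ?m (ctr ?m u) g)) R)"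
    by (simp add: gram_mmul ctr_ctr assms(2))
  show "gram ?m h = mmul ?m (ctr ?m R) R"
    using UF_cancel(2)[OF assms(1,2)]
    by (simp add: gram_def assms(3) ctr_mmul ctr_ctr assms(2) UF_in_mat[OF assms(1)] mmul_assoc)
qed

lemma Delta_gram_R:
  assumes R: "utri R" and r: "r \<le> q"
  shows "Delta F r (mmul (msz F q) (ctr (msz F q) R) R) =
    (if F = FH then \<Prod>i<2 * r. cmod (R i i) else \<Prod>i<r. (cmod (R i i))\<^sup>2)"
proof -
  have s: "cF F * r \<le> msz F q" using r by (simp add: msz_def)
  have "mmul (msz F q) (ctr (msz F q) R) (mmul (msz F q) (idm (msz F q)) R)
      = mmul (msz F q) (ctr (msz F q) R) R"
    by (simp flip: mmul_assoc add: mmul_idm_right)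
  moreover have "detm (cF F * r) (idm (msz F q)) = 1"
    using s by (subst detm_upper) (auto simp: idm_def)
  ultimately have "detm (cF F * r) (mmul (msz F q) (ctr (msz F q) R) R) = of_real ((cmod (detm (cF F * r) R))\<^sup>2)"
    using detm_triangular_congruence[where B = "idm (msz F q)", OF R s] by simp
  moreover have "detm (cF F * r) R = (\<Prod>i<cF F * r. R i i)" by (rule detm_upper) (use utriD[OF R] in auto)
  ultimately have sq: "Re (detm (cF F * r) (mmul (msz F q) (ctr (msz F q) R) R)) = (\<Prod>i<cF F * r. cmod (R i i))\<^sup>2"
    by (simp only: Re_complex_of_real prod_norm)
  show ?thesis
  proof (cases "F = FH")
    case True
    then show ?thesis using sq by (simp add: Delta_def prod_nonneg)
  next
    case False
    then have "cF F = 1" by (cases F) auto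
    then show ?thesis using sq False by (simp add: Delta_def prod_power_distrib)
  qed
qed

lemma Delta_gram_Iwasawa:
  assumes "u \<in> UF F q" "Frep F q R" "utri R" "h = mmul (msz F q) (ctr (msz F q) R) (ctr (msz F q) u)" "r \<le> q"
  shows "Delta F r (gram (msz F q) h) =
    (if F = FH then \<Prod>i<2 * r. cmod (R i i) else \<Prod>i<r. (cmod (R i i))\<^sup>2)"
  unfolding gram_Iwasawa(2)[OF assms(1) Frep_in_mat[OF assms(2)] assms(4)]
  by (rule Delta_gram_R[OF assms(3,5)])

lemma Delta_gram_pos:
  assumes h: "h \<in> GLF F q" and r: "r \<le> q"
  shows "Delta F r (gram (msz F q) h) > 0"
proof -
  obtain u R where u: "u \<in> UF F q" "Frep F q R" "utri R"
    "\<And>i. i < msz F q \<Longrightarrow> R i i \<noteq> 0" "h = mmul (msz F q) (ctr (msz F q) R) (ctr (msz F q) u)"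
    using Iwasawa_decomposition[OF h] by metis
  show ?thesis
    unfolding Delta_gram_Iwasawa[OF u(1-3,5) r]
    using u(4) r by (cases F) (auto intro!: prod_pos)
qed

text \<open>All minors of the Gram matrix of \<open>h g\<close> factor, and logarithms of their
  quotients add up. The unitary element is fixed by h before g is chosen; this is what lets the
  invariance of the step law absorb it.\<close>

lemma iwa_cocycle:
  assumes h: "h \<in> GLF F q" and j: "j < q"
  obtains u where "u \<in> UF F q" "\<And>g. g \<in> GLF F q \<Longrightarrow>
    iwa F j (gram (msz F q) (mmul (msz F q) h g)) =
    iwa F j (gram (msz F q) h) + iwa F j (gram (msz F q) (mmul (msz F q) u g))"
proof -
  let ?m = "msz F q"
  obtain u R where u: "u \<in> UF F q" "Frep F q R" "utri R"
    "\<And>i. i < ?m \<Longrightarrow> R i i \<noteq> 0" "h = mmul ?m (ctr ?m R) (ctr ?m u)"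
    using Iwasawa_decomposition[OF h] by metis
  have "iwa F j (gram ?m (mmul ?m h g)) =
    iwa F j (gram ?m h) + iwa F j (gram ?m (mmul ?m (ctr ?m u) g))" if g: "g \<in> GLF F q" for g
  proof -
    note gi = gram_Iwasawa[OF u(1) Frep_in_mat[OF u(2)] u(5)]
    have D: "Delta F r (gram ?m (mmul ?m h g)) = Delta F r (gram ?m h) * Delta F r (gram ?m (mmul ?m (ctr ?m u) g))"
      if "r \<le> q" for r
      unfolding gi using Delta_triangular_congruence[OF u(3) that] by blast
    have "mmul ?m (ctr ?m u) g \<in> GLF F q" by (intro GLF_mmul UF_GLF UF_ctr u g)
    then have pos: "Delta F r (gram ?m h) > 0" "Delta F r (gram ?m (mmul ?m (ctr ?m u) g)) > 0" if "r \<le> q" for r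
      using Delta_gram_pos h that by blast+
    show ?thesis unfolding iwa_def using j pos[of j] pos[of "Suc j"]
      by (simp add: D ln_mult ln_div field_simps)
  qed
  then show ?thesis using that[OF UF_ctr[OF u(1)]] by blast
qed

lemma iwa_gram_eq:
  assumes g: "g \<in> GLF F q" and j: "j < q"
    and R: "R = mmul (msz F q) (ctr (msz F q) (gs (msz F q) (ctr (msz F q) g))) (ctr (msz F q) g)"
  shows "iwa F j (gram (msz F q) g) = ln (cmod (R (cF F * j) (cF F * j)))"
    "R (cF F * j) (cF F * j) \<noteq> 0"
proof -
  let ?m = "msz F q"
  obtain u where u: "u \<in> UF F q" "Frep F q R" "utri R"
    "\<And>i. i < ?m \<Longrightarrow> R i i \<noteq> 0" "g = mmul ?m (ctr ?m R) (ctr ?m u)"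
    using Iwasawa_decomposition[OF g] R by metis
  have s: "cF F * j < ?m" using j by (simp add: msz_def)
  then show nz: "R (cF F * j) (cF F * j) \<noteq> 0" by (rule u(4))
  have pos: "Delta F j (gram ?m g) \<noteq> 0" using Delta_gram_pos[OF g, of j] j by simp
  note D = Delta_gram_Iwasawa[OF u(1-3,5)]
  have "Delta F (Suc j) (gram ?m g) / Delta F j (gram ?m g) = (cmod (R (cF F * j) (cF F * j)))\<^sup>2"
  proof (cases "F = FH")
    case True
    \<comment> \<open>The two diagonal entries of a quaternion block are conjugate, so the product
      of moduli grows by a square, just as over the other fields.\<close>
    have "R (2 * j + 1) (2 * j + 1) = cnj (R (2 * j) (2 * j))" using u(2) True j by (simp add: Frep_def)
    then have "Delta F (Suc j) (gram ?m g) = Delta F j (gram ?m g) * (cmod (R (2 * j) (2 * j)))\<^sup>2"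
      using j True D[of j] D[of "Suc j"] by (simp add: power2_eq_square)
    then show ?thesis using True pos by simp
  next
    case False
    then have c: "cF F = 1" by (cases F) auto
    have "Delta F (Suc j) (gram ?m g) = Delta F j (gram ?m g) * (cmod (R j j))\<^sup>2"
      using j False D[of j] D[of "Suc j"] by simp
    then show ?thesis using c pos by simp
  qed
  then show "iwa F j (gram ?m g) = ln (cmod (R (cF F * j) (cF F * j)))"
    using nz by (simp add: iwa_def ln_realpow)
qed

lemma Delta_q_gram:
  assumes g: "g \<in> GLF F q"
  shows "ln (Delta F q (gram (msz F q) g)) = 2 * (\<Sum>i<q. ln_sing F q g i)"
proof -
  let ?m = "msz F q" and ?t = "ln_sing F q g"
  obtain V where V: "V \<in> UF F q" "gram ?m g = mmul ?m V (mmul ?m (exp2diag F q ?t) (ctr ?m V))"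
    using gram_ln_sing[OF g] by blast
  have "detm ?m V * detm ?m (ctr ?m V) = 1" by (metis detm_mmul detm_idm UF_ctr_right[OF V(1)])
  then have "detm ?m (gram ?m g) = detm ?m (exp2diag F q ?t)"
    unfolding V(2) detm_mmul by (simp add: mult_ac)
  also have "\<dots> = (\<Prod>i<?m. of_real (exp (2 * ?t (i div cF F))))"
    by (subst detm_upper) (auto simp: exp2diag_def)
  also have "\<dots> = of_real (\<Prod>i<?m. exp (2 * ?t (i div cF F)))" by simp
  finally have det: "detm ?m (gram ?m g) = of_real (exp (\<Sum>i<?m. 2 * ?t (i div cF F)))"
    by (simp only: exp_sum finite_lessThan)
  have "(\<Sum>i<?m. 2 * ?t (i div cF F)) = real (cF F) * (2 * (\<Sum>i<q. ?t i))"
    by (cases F) (auto simp: sum_pairs sum_distrib_left)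
  then show ?thesis using det by (cases F) (auto simp: Delta_def ln_sqrt)
qed

text \<open>The logarithms of the minors telescope from \<open>Delta F 0\<close>, which is 1, to the
  full determinant, the product of the squared singular values.\<close>

lemma sum_iwa_gram:
  assumes g: "g \<in> GLF F q"
  shows "(\<Sum>j<q. iwa F j (gram (msz F q) g)) = (\<Sum>j<q. ln_sing F q g j)"
proof -
  let ?D = "\<lambda>j. ln (Delta F j (gram (msz F q) g))"
  have "(\<Sum>j<q. iwa F j (gram (msz F q) g)) = (\<Sum>j<q. (?D (Suc j) - ?D j) / 2)"
  proof (rule sum.cong)
    fix j assume j: "j \<in> {..<q}"
    then show "iwa F j (gram (msz F q) g) = (?D (Suc j) - ?D j) / 2"
      using Delta_gram_pos[OF g, of j] Delta_gram_pos[OF g, of "Suc j"] by (simp add: iwa_def ln_div)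
  qed simp
  also have "\<dots> = (\<Sum>j<q. ?D (Suc j) - ?D j) / 2" by (simp only: sum_divide_distrib)
  also have "(\<Sum>j<q. ?D (Suc j) - ?D j) = ?D q - ?D 0" by (rule sum_lessThan_telescope)
  also have "?D 0 = 0" by (simp add: Delta_def)
  finally show ?thesis by (simp add: Delta_q_gram[OF g])
qed

lemma UF_row_norm:
  assumes "u \<in> UF F q" "i < msz F q" shows "(\<Sum>k<msz F q. (cmod (u i k))\<^sup>2) = 1"
proof -
  have "complex_of_real (\<Sum>k<msz F q. (cmod (u i k))\<^sup>2) = 1"
    using mmul_ctr_diag[OF assms(2), of u] UF_ctr_right[OF assms(1)] assms(2) by (simp add: idm_def)
  then show ?thesis using of_real_eq_1_iff by blast
qed

lemma UF_column_norm:
  assumes "u \<in> UF F q" "i < msz F q" shows "(\<Sum>k<msz F q. (cmod (u k i))\<^sup>2) = 1"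
  using UF_row_norm[OF UF_ctr[OF assms(1)] assms(2)] assms(2) by (simp add: ctr_def)

lemma diagonalized_diag:
  assumes "i < msz F q"
  shows "mmul (msz F q) W (mmul (msz F q) (exp2diag F q t) (ctr (msz F q) W)) i i =
    of_real (\<Sum>k<msz F q. (cmod (W i k))\<^sup>2 * exp (2 * t (k div cF F)))"
proof -
  have "mmul (msz F q) (exp2diag F q t) (ctr (msz F q) W) k i = of_real (exp (2 * t (k div cF F))) * cnj (W i k)"
    if "k < msz F q" for k
    using assms that by (simp add: mmul_def exp2diag_def ctr_def if_distrib[of "\<lambda>x. x * _"] cong: if_cong)
  then show ?thesis using assms
    by (simp add: mmul_def[of _ W] complex_norm_square mult_ac del: of_real_power of_real_exp)
qed

lemma column_norm_ctr_UF:
  assumes u: "u \<in> UF F q" and i: "i < msz F q"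
  shows "(\<Sum>l<msz F q. (cmod (mmul (msz F q) (ctr (msz F q) u) T l i))\<^sup>2) = (\<Sum>l<msz F q. (cmod (T l i))\<^sup>2)"
proof -
  let ?m = "msz F q"
  have "mmul ?m (ctr ?m (ctr ?m u)) (ctr ?m u) = idm ?m"
    using UF_ctr[OF u] by (simp add: UF_def)
  from ip_unitary[OF this, of "\<lambda>l. T l i" "\<lambda>l. T l i"]
  have "(nrm ?m (mv ?m (ctr ?m u) (\<lambda>l. T l i)))\<^sup>2 = (nrm ?m (\<lambda>l. T l i))\<^sup>2"
    unfolding ip_self of_real_eq_iff .
  then show ?thesis unfolding nrm_square using i by (simp add: mv_def mmul_def)
qed

text \<open>The diagonal entry of R is at most the norm of its column, which is the norm of the
  corresponding row of g. The square of that norm is a diagonal entry of the Gram matrix, an average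
  of the exp(2 t_k) with weights from a row of a unitary matrix.\<close>

lemma iwa_gram_le:
  assumes g: "g \<in> GLF F q" and j: "j < q"
  shows "iwa F j (gram (msz F q) g) \<le> (\<Sum>i<q. \<bar>ln_sing F q g i\<bar>)"
proof -
  let ?m = "msz F q" and ?s = "cF F * j" and ?t = "ln_sing F q g"
  define T where "T = ctr ?m g"
  define R where "R = mmul ?m (ctr ?m (gs ?m T)) T"
  define B where "B = (\<Sum>i<q. \<bar>?t i\<bar>)"
  have s: "?s < ?m" using j by (simp add: msz_def)
  note iwa = iwa_gram_eq[OF g j, folded T_def, OF R_def]
  have "(cmod (R ?s ?s))\<^sup>2 \<le> (\<Sum>l<?m. (cmod (R l ?s))\<^sup>2)"
    using s by (intro member_le_sum) auto
  also have "\<dots> = (\<Sum>l<?m. (cmod (T l ?s))\<^sup>2)"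
    unfolding R_def using GLF_ctr[OF g] by (intro column_norm_ctr_UF[OF gs_UF] s) (simp add: T_def)
  also have "\<dots> = (\<Sum>l<?m. (cmod (g ?s l))\<^sup>2)" using s by (simp add: T_def ctr_def)
  also have "\<dots> \<le> exp (2 * B)"
  proof -
    obtain V where V: "V \<in> UF F q" "gram ?m g = mmul ?m V (mmul ?m (exp2diag F q ?t) (ctr ?m V))"
      using gram_ln_sing[OF g] by blast
    have "complex_of_real (\<Sum>l<?m. (cmod (g ?s l))\<^sup>2) = of_real (\<Sum>k<?m. (cmod (V ?s k))\<^sup>2 * exp (2 * ?t (k div cF F)))"
      using V(2) mmul_ctr_diag[OF s, of g] diagonalized_diag[OF s, of V ?t] by (simp add: gram_def)
    then have "(\<Sum>l<?m. (cmod (g ?s l))\<^sup>2) = (\<Sum>k<?m. (cmod (V ?s k))\<^sup>2 * exp (2 * ?t (k div cF F)))"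
      unfolding of_real_eq_iff .
    also have "\<dots> \<le> (\<Sum>k<?m. (cmod (V ?s k))\<^sup>2 * exp (2 * B))"
    proof (intro sum_mono mult_left_mono)
      fix k assume "k \<in> {..<?m}"
      then have "k div cF F < q" by (simp add: msz_def less_mult_imp_div_less mult.commute)
      then have "\<bar>?t (k div cF F)\<bar> \<le> B" unfolding B_def by (intro member_le_sum) auto
      then show "exp (2 * ?t (k div cF F)) \<le> exp (2 * B)" by simp
    qed auto
    also have "\<dots> = exp (2 * B)" using UF_row_norm[OF V(1) s] by (simp flip: sum_distrib_right)
    finally show ?thesis .
  qed
  finally have "(cmod (R ?s ?s))\<^sup>2 \<le> (exp B)\<^sup>2" by (simp add: exp_double)
  then have "cmod (R ?s ?s) \<le> exp B" by (rule power2_le_imp_le) simp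
  then have "ln (cmod (R ?s ?s)) \<le> ln (exp B)" using iwa(2) by (subst ln_le_cancel_iff) auto
  then show ?thesis by (simp add: iwa B_def)
qed

text \<open>For the lower bound, one term is the common sum minus q - 1 terms with the upper bound
  just proved. Moments of the walk increments are dominated in this way by moments of the
  logarithmic singular values.\<close>

lemma abs_iwa_gram_le:
  assumes g: "g \<in> GLF F q" and j: "j < q"
  shows "\<bar>iwa F j (gram (msz F q) g)\<bar> \<le> real q * (\<Sum>i<q. \<bar>ln_sing F q g i\<bar>)"
proof -
  let ?a = "\<lambda>i. iwa F i (gram (msz F q) g)" and ?B = "\<Sum>i<q. \<bar>ln_sing F q g i\<bar>"
  have B: "?B \<ge> 0" by (simp add: sum_nonneg)
  have "(\<Sum>i<q. ?a i) = ?a j + (\<Sum>i\<in>{..<q} - {j}. ?a i)" using j by (simp add: sum.remove)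
  moreover have "(\<Sum>i\<in>{..<q} - {j}. ?a i) \<le> (\<Sum>i\<in>{..<q} - {j}. ?B)"
    using iwa_gram_le[OF g] by (intro sum_mono) auto
  moreover have "(\<Sum>i\<in>{..<q} - {j}. ?B) = (real q - 1) * ?B" using j by (simp add: of_nat_diff)
  moreover have "\<bar>\<Sum>i<q. ?a i\<bar> \<le> ?B" unfolding sum_iwa_gram[OF g] by (rule sum_abs)
  ultimately have "- (real q * ?B) \<le> ?a j" by (simp add: algebra_simps)
  moreover have "?a j \<le> real q * ?B"
    using iwa_gram_le[OF g j] mult_right_mono[of 1 "real q" ?B] B j by linarith
  ultimately show ?thesis by linarith
qed

text \<open>A coordinate of the space over the skew field is a block of \<open>cF F\<close> complex coordinates.\<close>

definition swp :: "fld \<Rightarrow> nat \<Rightarrow> nat \<Rightarrow> nat \<Rightarrow> nat" where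
  "swp F j i l = cF F * Transposition.transpose j i (l div cF F) + l mod cF F"

definition swap_mat :: "fld \<Rightarrow> nat \<Rightarrow> nat \<Rightarrow> nat \<Rightarrow> cmat" where
  "swap_mat F q j i = (\<lambda>k l. if k < msz F q \<and> l < msz F q \<and> k = swp F j i l then 1 else 0)"

lemma swp_swp: "swp F j i (swp F j i l) = l"
  by (simp add: swp_def)

lemma swp_less:
  assumes "j < q" "i < q" "l < msz F q" shows "swp F j i l < msz F q"
proof -
  have "Transposition.transpose j i (l div cF F) < q"
    using assms by (auto simp: Transposition.transpose_def msz_def less_mult_imp_div_less mult.commute)
  moreover have "2 * x + l mod 2 < 2 * q" if "x < q" for x using that by presburger
  ultimately show ?thesis by (cases F) (simp_all add: swp_def)
qed

lemma mmul_swap_mat: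
  assumes "j < q" "i < q" "k < msz F q" "l < msz F q"
  shows "mmul (msz F q) T (swap_mat F q j i) k l = T k (swp F j i l)"
proof -
  have "swp F j i l < msz F q" using swp_less assms by blast
  then show ?thesis using assms
    by (simp add: mmul_def swap_mat_def if_distrib[of "\<lambda>x. _ * x"] cong: if_cong)
qed

lemma ctr_swap_mat: "ctr (msz F q) (swap_mat F q j i) = swap_mat F q j i"
  using swp_swp by (auto simp: ctr_def swap_mat_def fun_eq_iff)

lemma swap_mat_UF:
  assumes "j < q" "i < q" shows "swap_mat F q j i \<in> UF F q"
proof -
  have in_mat: "in_mat (msz F q) (swap_mat F q j i)" by (auto simp: in_mat_def swap_mat_def)
  have "mmul (msz F q) (swap_mat F q j i) (swap_mat F q j i) = idm (msz F q)"
  proof (rule in_mat_eqI[of "msz F q"])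
    fix k l assume kl: "k < msz F q" "l < msz F q"
    show "mmul (msz F q) (swap_mat F q j i) (swap_mat F q j i) k l = idm (msz F q) k l"
      unfolding mmul_swap_mat[OF assms kl] using kl swp_less[OF assms kl(2)]
      by (auto simp: swap_mat_def swp_swp idm_def)
  qed auto
  moreover have "Frep F q (swap_mat F q j i)"
  proof (cases F)
    case FH
    have "swp FH j i (2 * b) = 2 * Transposition.transpose j i b"
      "swp FH j i (2 * b + 1) = 2 * Transposition.transpose j i b + 1" for b
      by (auto simp: swp_def)
    moreover have "2 * x + 1 \<noteq> 2 * y" "2 * x \<noteq> 2 * y + 1" for x y :: nat by presburger+
    ultimately show ?thesis using FH in_mat by (auto simp: Frep_def swap_mat_def)
  qed (use in_mat in \<open>auto simp: Frep_def swap_mat_def\<close>)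
  ultimately show ?thesis by (simp add: UF_def ctr_swap_mat)
qed

text \<open>The trace of the compression of a positive matrix to a subspace of codimension \<open>s\<close>
  dominates the eigenvalue number \<open>s\<close>, since the weights are at most 1 and sum up to \<open>m - s\<close>.\<close>

lemma weighted_sum_ge:
  fixes p \<mu> :: "nat \<Rightarrow> real"
  assumes s: "s < m" and p: "\<And>i. i < m \<Longrightarrow> 0 \<le> p i" "\<And>i. i < m \<Longrightarrow> p i \<le> 1"
    and sum: "(\<Sum>i<m. p i) = real m - real s"
    and \<mu>: "\<And>i. i < m \<Longrightarrow> 0 \<le> \<mu> i" "\<And>i. i \<le> s \<Longrightarrow> \<mu> s \<le> \<mu> i"
  shows "\<mu> s \<le> (\<Sum>i<m. p i * \<mu> i)"
proof -
  have split: "{..<m} = {..s} \<union> {s<..<m}" "{..s} \<inter> {s<..<m} = {}" using s by auto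
  have "(\<Sum>i\<in>{s<..<m}. p i) \<le> (\<Sum>i\<in>{s<..<m}. 1)" using p by (intro sum_mono) auto
  also have "\<dots> = real m - real s - 1" using s by (simp add: of_nat_diff)
  \<comment> \<open>The m - s - 1 weights behind s are at most 1 each, so at least 1 of the total m
    - s remains for the indices up to s.\<close>
  finally have "1 \<le> (\<Sum>i\<le>s. p i)"
    using sum unfolding split(1) by (subst (asm) sum.union_disjoint) auto
  then have "\<mu> s \<le> (\<Sum>i\<le>s. p i) * \<mu> s"
    using mult_right_mono[of 1 "\<Sum>i\<le>s. p i" "\<mu> s"] \<mu>(1)[OF s] by simp
  also have "\<dots> = (\<Sum>i\<le>s. p i * \<mu> s)" by (simp add: sum_distrib_right)
  also have "\<dots> \<le> (\<Sum>i\<le>s. p i * \<mu> i)" using p \<mu> s by (intro sum_mono mult_left_mono) auto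
  also have "\<dots> \<le> (\<Sum>i<m. p i * \<mu> i)" using p \<mu> s by (intro sum_mono2) auto
  finally show ?thesis .
qed

lemma sum_pairs_from: "j \<le> q \<Longrightarrow> (\<Sum>k\<in>{2 * j..<2 * q}. f k) = (\<Sum>a\<in>{j..<q}. f (2 * a) + f (2 * a + 1))"
  for f :: "nat \<Rightarrow> real"
  by (induction q rule: dec_induct) (auto simp: algebra_simps)

text \<open>Write the adjoint of g as U R. The rows of R from s on describe the compression to the
  complement of the first s orthonormal vectors, and their total squared norm is at least exp(2
  t_j). One of the m columns carries an m-th part of it, whence the loss \<open>ln m / 2\<close>.
  Swapping the block of that column into position j turns the tail of the column into the new
  diagonal entry.\<close>

lemma iwa_pivot:
  assumes g: "g \<in> GLF F q" and j: "j < q"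
  shows "\<exists>i<q. ln_sing F q g j - ln (real (msz F q)) / 2 \<le>
      iwa F j (gram (msz F q) (mmul (msz F q) (swap_mat F q j i) g))"
proof -
  let ?m = "msz F q" and ?s = "cF F * j" and ?t = "ln_sing F q g"
  define T where "T = ctr ?m g"
  have T: "T \<in> GLF F q" unfolding T_def by (rule GLF_ctr[OF g])
  define U where "U = gs ?m T"
  define R where "R = mmul ?m (ctr ?m U) T"
  have U: "U \<in> UF F q" unfolding U_def by (rule gs_UF[OF T])
  have R_tri: "R k l = 0" if "l < k" for k l
    using GLF_inverse[OF T] gs_triangular that unfolding R_def U_def by metis
  have RF: "Frep F q R" unfolding R_def by (intro Frep_mmul Frep_ctr UF_Frep U GLF_Frep T)
  have s: "?s < ?m" using j by (simp add: msz_def)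
  obtain W where W: "W \<in> UF F q"
    "gram ?m T = mmul ?m W (mmul ?m (exp2diag F q ?t) (ctr ?m W))"
    and anti: "\<And>i j. i \<le> j \<Longrightarrow> j < q \<Longrightarrow> ?t j \<le> ?t i"
    using gram_ctr_ln_sing[OF g] unfolding T_def by blast
  define Q where "Q = mmul ?m (ctr ?m U) W"
  have Q: "Q \<in> UF F q" unfolding Q_def by (intro UF_mmul UF_ctr U W)
  have "gram ?m R = mmul ?m Q (mmul ?m (exp2diag F q ?t) (ctr ?m Q))"
    unfolding R_def gram_mmul W(2) Q_def ctr_mmul by (simp only: mmul_assoc)
  then have row: "(\<Sum>k<?m. (cmod (R l k))\<^sup>2) = (\<Sum>k<?m. (cmod (Q l k))\<^sup>2 * exp (2 * ?t (k div cF F)))"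
    if "l < ?m" for l
    using mmul_ctr_diag[OF that, of R] diagonalized_diag[OF that, of Q ?t]
    by (simp only: gram_def of_real_eq_iff)
  \<comment> \<open>Weights for \<open>weighted_sum_ge\<close>: the part of column k of the unitary
    Q from row s on. Unit columns give at most 1 each, the m - s unit rows give the total m -
    s.\<close>
  define p where "p k = (\<Sum>l\<in>{?s..<?m}. (cmod (Q l k))\<^sup>2)" for k
  have div: "k div cF F < q" if "k < ?m" for k
    using that by (simp add: msz_def less_mult_imp_div_less mult.commute)
  have "exp (2 * ?t j) \<le> (\<Sum>k<?m. p k * exp (2 * ?t (k div cF F)))"
  proof -
    have "exp (2 * ?t (?s div cF F)) \<le> (\<Sum>k<?m. p k * exp (2 * ?t (k div cF F)))"
    proof (rule weighted_sum_ge[OF s])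
      show "0 \<le> p i" for i by (simp add: p_def sum_nonneg)
      show "p i \<le> 1" if "i < ?m" for i
      proof -
        have "p i \<le> (\<Sum>l<?m. (cmod (Q l i))\<^sup>2)" unfolding p_def by (intro sum_mono2) auto
        then show ?thesis using UF_column_norm[OF Q that] by simp
      qed
      have "(\<Sum>i<?m. p i) = (\<Sum>l\<in>{?s..<?m}. \<Sum>i<?m. (cmod (Q l i))\<^sup>2)"
        unfolding p_def by (rule sum.swap)
      also have "\<dots> = (\<Sum>l\<in>{?s..<?m}. 1)" using UF_row_norm[OF Q] by (intro sum.cong) auto
      also have "\<dots> = real ?m - real ?s" using s by (simp add: of_nat_diff)
      finally show "(\<Sum>i<?m. p i) = real ?m - real ?s" .
      show "exp (2 * ?t (?s div cF F)) \<le> exp (2 * ?t (i div cF F))" if "i \<le> ?s" for i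
        using anti[of "i div cF F" j] div_le_mono[OF that, of "cF F"] j by simp
    qed auto
    then show ?thesis by simp
  qed
  also have "\<dots> = (\<Sum>l\<in>{?s..<?m}. \<Sum>k<?m. (cmod (Q l k))\<^sup>2 * exp (2 * ?t (k div cF F)))"
    unfolding p_def sum_distrib_right by (rule sum.swap)
  also have "\<dots> = (\<Sum>l\<in>{?s..<?m}. \<Sum>k<?m. (cmod (R l k))\<^sup>2)"
    by (rule sum.cong) (simp_all add: row)
  also have "\<dots> = (\<Sum>k<?m. \<Sum>l\<in>{?s..<?m}. (cmod (R l k))\<^sup>2)" by (rule sum.swap)
  finally have total: "exp (2 * ?t j) \<le> (\<Sum>k<?m. \<Sum>l\<in>{?s..<?m}. (cmod (R l k))\<^sup>2)" .
  define \<rho> where "\<rho> k = (\<Sum>l\<in>{?s..<?m}. (cmod (R l k))\<^sup>2)" for k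
  have m0: "real ?m > 0" using s by simp
  have "\<exists>k<?m. exp (2 * ?t j) / real ?m \<le> \<rho> k"
  proof (rule ccontr)
    assume "\<not> ?thesis"
    then have "(\<Sum>k<?m. \<rho> k) < (\<Sum>k<?m. exp (2 * ?t j) / real ?m)"
      using s by (intro sum_strict_mono) auto
    then show False using total m0 by (simp add: \<rho>_def)
  qed
  then obtain k where k: "k < ?m" "exp (2 * ?t j) / real ?m \<le> \<rho> k" by blast
  have "\<rho> k > 0" using k(2) m0 by (smt (verit) divide_pos_pos exp_gt_zero)
  \<comment> \<open>Columns before s have no entries from row s on, by triangularity; the pivot is
    therefore not among the columns already processed.\<close>
  have ks: "?s \<le> k"
  proof (rule ccontr)
    assume "\<not> ?s \<le> k"
    then have "\<rho> k = 0" by (auto simp: \<rho>_def R_tri)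
    then show False using \<open>\<rho> k > 0\<close> by simp
  qed
  define i where "i = k div cF F"
  have i: "i < q" "j \<le> i" using div[OF k(1)] div_le_mono[OF ks, of "cF F"] by (auto simp: i_def)
  have ci: "cF F * i < ?m" using i by (simp add: msz_def)
  \<comment> \<open>Over the quaternions the pigeonhole may select the odd column of block i, while
    the swap brings its even column to position s. The two columns are related by \<open>qj\<close>,
    so their tails have equal norm.\<close>
  have \<rho>_i: "\<rho> (cF F * i) = \<rho> k"
  proof (cases "F = FH \<and> k = 2 * i + 1")
    case True
    have "R x (2 * i + 1) = qj (\<lambda>x. R x (2 * i)) x" if "x < 2 * q" for x
      using RF True i(1) that by (auto simp: Frep_FH_iff)
    then have R1: "R (2 * a) (2 * i + 1) = - cnj (R (2 * a + 1) (2 * i))"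
      "R (2 * a + 1) (2 * i + 1) = cnj (R (2 * a) (2 * i))" if "a < q" for a
      using that by auto
    show ?thesis using True
      by (auto simp: \<rho>_def sum_pairs_from j[THEN less_imp_le] R1[simplified] intro!: sum.cong)
  next
    case False
    have "cF F * i = k"
    proof (cases F)
      case FH
      then have "k \<noteq> 2 * (k div 2) + 1" using False by (simp add: i_def)
      then have "2 * (k div 2) = k" by presburger
      then show ?thesis using FH by (simp add: i_def)
    qed (simp_all add: i_def)
    then show ?thesis by simp
  qed
  define P where "P = swap_mat F q j i"
  have P: "P \<in> UF F q" unfolding P_def by (rule swap_mat_UF[OF j i(1)])
  define g' where "g' = mmul ?m P g"
  have g': "g' \<in> GLF F q" unfolding g'_def by (intro GLF_mmul UF_GLF P g)
  define T' where "T' = ctr ?m g'"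
  have T'_eq: "T' = mmul ?m T P"
    by (simp add: T'_def g'_def ctr_mmul T_def) (simp add: P_def ctr_swap_mat)
  have T': "T' \<in> GLF F q" unfolding T'_def by (rule GLF_ctr[OF g'])
  define U' where "U' = gs ?m T'"
  define R' where "R' = mmul ?m (ctr ?m U') T'"
  have U': "U' \<in> UF F q" unfolding U'_def by (rule gs_UF[OF T'])
  have R'_tri: "R' k l = 0" if "l < k" for k l
    using GLF_inverse[OF T'] gs_triangular that unfolding R'_def U'_def by metis
  have T'_col: "T' x l = T x (swp F j i l)" if "x < ?m" "l < ?m" for x l
    unfolding T'_eq P_def using j i(1) that by (intro mmul_swap_mat)
  have swp_lt: "swp F j i l = l" if "l < ?s" for l
  proof -
    have "l div cF F < j" using that by (simp add: less_mult_imp_div_less mult.commute)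
    then show ?thesis using i(2) by (simp add: swp_def Transposition.transpose_def)
  qed
  have swp_s: "swp F j i ?s = cF F * i" by (simp add: swp_def)
  have T'_lt: "T' x l = T x l" if "l < ?s" for x l
    using T'_col[of x l] swp_lt[OF that] that s GLF_in_mat[OF T] GLF_in_mat[OF T']
    by (cases "x < ?m") (auto simp: in_mat_def)
  \<comment> \<open>As j \<le> i, the swap fixes all columns before s, and with them the first s
    orthonormal vectors.\<close>
  have U'_lt: "U' x l = U x l" if "l < ?s" for x l
    using gsc_cong_columns[of l T' T ?m] T'_lt that by (simp add: U'_def U_def gs_def)
  have R'_lt: "R' l ?s = R l (cF F * i)" if "l < ?s" for l
    using that s ci by (simp add: R'_def R_def mmul_def ctr_def U'_lt T'_col swp_s)
  have "(\<Sum>l<?m. (cmod (R' l ?s))\<^sup>2) = (\<Sum>l<?m. (cmod (T' l ?s))\<^sup>2)"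
    unfolding R'_def by (rule column_norm_ctr_UF[OF U' s])
  also have "\<dots> = (\<Sum>l<?m. (cmod (T l (cF F * i)))\<^sup>2)" using s by (simp add: T'_col swp_s)
  also have "\<dots> = (\<Sum>l<?m. (cmod (R l (cF F * i)))\<^sup>2)"
    unfolding R_def by (rule column_norm_ctr_UF[OF U ci, symmetric])
  finally have norms: "(\<Sum>l<?m. (cmod (R' l ?s))\<^sup>2) = (\<Sum>l<?m. (cmod (R l (cF F * i)))\<^sup>2)" .
  have split: "(\<Sum>l<?m. f l) = (\<Sum>l<?s. f l) + (\<Sum>l\<in>{?s..<?m}. f l)" for f :: "nat \<Rightarrow> real"
    using s by (simp add: lessThan_atLeast0 sum.atLeastLessThan_concat)
  \<comment> \<open>The full column norms agree and so do the entries above row s, hence so do the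
    tails; for the triangular R' the tail of column s is its diagonal entry alone.\<close>
  have "(\<Sum>l\<in>{?s..<?m}. (cmod (R' l ?s))\<^sup>2) = \<rho> (cF F * i)"
    using norms unfolding split \<rho>_def by (simp add: R'_lt)
  moreover have "(\<Sum>l\<in>{?s..<?m}. (cmod (R' l ?s))\<^sup>2) = (\<Sum>l\<in>{?s}. (cmod (R' l ?s))\<^sup>2)"
    using s by (intro sum.mono_neutral_right) (auto simp: R'_tri)
  ultimately have "exp (2 * ?t j) / real ?m \<le> (cmod (R' ?s ?s))\<^sup>2" using k(2) \<rho>_i by simp
  moreover note iwa' = iwa_gram_eq[OF g' j, folded T'_def, folded U'_def, OF R'_def]
  ultimately have "ln (exp (2 * ?t j) / real ?m) \<le> ln ((cmod (R' ?s ?s))\<^sup>2)"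
    using m0 by (subst ln_le_cancel_iff) auto
  then have "2 * ?t j - ln (real ?m) \<le> 2 * ln (cmod (R' ?s ?s))"
    using m0 iwa'(2) by (simp add: ln_div ln_realpow)
  then show ?thesis using i(1) iwa'(1) unfolding g'_def P_def by (intro exI[of _ i]) auto
qed

subsection \<open>Measurability\<close>

lemma measurable_entry:
  assumes "f \<in> borel_measurable M" shows "(\<lambda>x. (f x :: cmat) i j) \<in> borel_measurable M"
  by (rule measurable_product_then_coordinatewise[OF measurable_product_then_coordinatewise[OF assms]])

lemma measurable_cmatI:
  assumes "\<And>i j. (\<lambda>x. f x i j) \<in> borel_measurable M" shows "(f :: _ \<Rightarrow> cmat) \<in> borel_measurable M"
  by (intro measurable_coordinatewise_then_product assms)

lemma measurable_mmul [measurable (raw)]: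
  assumes [measurable]: "f \<in> borel_measurable M" "g \<in> borel_measurable M"
  shows "(\<lambda>x. mmul m (f x) (g x)) \<in> borel_measurable M"
proof -
  note [measurable] = measurable_entry[OF assms(1)] measurable_entry[OF assms(2)]
  show ?thesis unfolding mmul_def by (rule measurable_cmatI) measurable
qed

lemma measurable_cnj [measurable]: "cnj \<in> borel_measurable borel"
  by (intro borel_measurable_continuous_onI continuous_on_cnj continuous_on_id)

lemma measurable_ctr [measurable (raw)]:
  assumes [measurable]: "f \<in> borel_measurable M"
  shows "(\<lambda>x. ctr m (f x)) \<in> borel_measurable M"
proof -
  note [measurable] = measurable_entry[OF assms]
  show ?thesis unfolding ctr_def by (rule measurable_cmatI) measurable
qed

lemma measurable_gram [measurable (raw)]:
  assumes [measurable]: "f \<in> borel_measurable M"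
  shows "(\<lambda>x. gram m (f x)) \<in> borel_measurable M"
  unfolding gram_def by measurable

lemma measurable_detm:
  assumes "\<And>i j. (\<lambda>x. f x i j :: complex) \<in> borel_measurable M"
  shows "(\<lambda>x. detm s (f x)) \<in> borel_measurable M"
  unfolding detm_def by (intro borel_measurable_sum borel_measurable_times borel_measurable_prod assms) auto

lemma measurable_iwa [measurable (raw)]:
  assumes [measurable]: "f \<in> borel_measurable M"
  shows "(\<lambda>x. iwa F j (f x)) \<in> borel_measurable M"
proof -
  note [measurable] = measurable_detm[OF measurable_entry[OF assms]]
  show ?thesis unfolding iwa_def Delta_def by (cases "F = FH") (simp_all, measurable)
qed

lemma measurable_gsc:
  assumes [measurable]: "f \<in> borel_measurable M"
  shows "(\<lambda>x. gsc m (f x) j i) \<in> borel_measurable M"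
proof (induction j arbitrary: i rule: less_induct)
  case (less j)
  have ip [measurable]: "(\<lambda>x. ip m (gsc m (f x) l) (\<lambda>i. f x i j)) \<in> borel_measurable M" if "l < j" for l
    unfolding ip_def
    by (intro borel_measurable_sum borel_measurable_times measurable_entry assms less that
        measurable_compose[OF _ measurable_cnj])
  have r [measurable]: "(\<lambda>x. gsr m (f x) j i) \<in> borel_measurable M" for i
    unfolding gsr_def
  proof (intro borel_measurable_diff borel_measurable_sum borel_measurable_times)
    show "(\<lambda>x. f x i j) \<in> borel_measurable M" by (rule measurable_entry[OF assms])
    fix l assume "l \<in> {..<j}"
    then have l: "l < j" by simp
    show "(\<lambda>x. ip m (gsc m (f x) l) (\<lambda>i. f x i j)) \<in> borel_measurable M" by (rule ip[OF l])
    show "(\<lambda>x. gsc m (f x) l i) \<in> borel_measurable M" by (rule less[OF l])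
  qed
  show ?case unfolding gsc_eq nrm_def by measurable
qed

lemma measurable_gs [measurable (raw)]:
  assumes "f \<in> borel_measurable M" shows "(\<lambda>x. gs m (f x)) \<in> borel_measurable M"
  unfolding gs_def
proof (rule measurable_cmatI)
  show "(\<lambda>x. if i < m \<and> j < m then gsc m (f x) j i else 0) \<in> borel_measurable M" for i j
    by (cases "i < m"; cases "j < m") (simp_all add: measurable_gsc[OF assms])
qed

section \<open>Eigenvalues as measurable functions through traces of powers\<close>

definition mtrace :: "nat \<Rightarrow> cmat \<Rightarrow> complex" where
  "mtrace m A = (\<Sum>i<m. A i i)"

lemma mtrace_commute: "mtrace m (mmul m A B) = mtrace m (mmul m B A)"
  unfolding mtrace_def mmul_def by (simp, subst sum.swap) (simp add: mult.commute)

definition mpow :: "nat \<Rightarrow> cmat \<Rightarrow> nat \<Rightarrow> cmat" where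
  "mpow m A n = ((mmul m A) ^^ n) (idm m)"

lemma measurable_mtrace_mpow [measurable (raw)]:
  assumes [measurable]: "f \<in> borel_measurable M"
  shows "(\<lambda>x. mtrace m (mpow m (f x) n)) \<in> borel_measurable M"
proof -
  have [measurable]: "(\<lambda>x. mpow m (f x) n) \<in> borel_measurable M"
    by (induction n) (auto simp: mpow_def)
  note [measurable] = measurable_entry[OF this]
  show ?thesis unfolding mtrace_def by measurable
qed

lemma mtrace_mpow_diagonalized:
  assumes V: "V \<in> UF FC m" and A: "A = mmul m V (mmul m (diagF FC m d) (ctr m V))"
  shows "mtrace m (mpow m A n) = of_real (\<Sum>i<m. d i ^ n)"
proof -
  have c: "mmul m (ctr m V) V = idm m" using UF_ctr_left[OF V] by simp
  have step: "mmul m (diagF FC m d) (diagF FC m e) = diagF FC m (\<lambda>i. d i * e i)" for e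
    by (rule in_mat_eqI[of m])
       (auto simp: in_mat_def mmul_def diagF_def if_distrib[of "\<lambda>x. x * _"] cong: if_cong)
  have "mpow m A n = mmul m V (mmul m (diagF FC m (\<lambda>i. d i ^ n)) (ctr m V))"
  proof (induction n)
    case 0
    have "diagF FC m (\<lambda>i. 1) = idm m" by (auto simp: diagF_def idm_def fun_eq_iff)
    then show ?case using UF_ctr_right[OF V] by (simp add: mpow_def mmul_idm_left)
  next
    case (Suc n)
    have "mpow m A (Suc n) = mmul m A (mmul m V (mmul m (diagF FC m (\<lambda>i. d i ^ n)) (ctr m V)))"
      using Suc by (simp add: mpow_def)
    also have "\<dots> = mmul m V (mmul m (diagF FC m d) (mmul m (mmul m (ctr m V) V)
        (mmul m (diagF FC m (\<lambda>i. d i ^ n)) (ctr m V))))"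
      unfolding A by (simp only: mmul_assoc)
    also have "\<dots> = mmul m V (mmul m (mmul m (diagF FC m d) (diagF FC m (\<lambda>i. d i ^ n))) (ctr m V))"
      by (simp add: c mmul_idm_left mmul_assoc)
    finally show ?case by (simp add: step)
  qed
  then have "mtrace m (mpow m A n) = mtrace m (mmul m (diagF FC m (\<lambda>i. d i ^ n)) (mmul m (ctr m V) V))"
    by (simp add: mtrace_commute[of m V] mmul_assoc)
  also have "\<dots> = mtrace m (diagF FC m (\<lambda>i. d i ^ n))"
    using in_mat_diagF[of FC m] by (simp add: c mmul_idm_right)
  finally show ?thesis by (simp add: mtrace_def diagF_def)
qed

text \<open>Measurability concerns every matrix, so g is arbitrary and the product is diagonalised
  as a complex matrix whatever the field is.\<close>

lemma eigs_ctr_mmul: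
  obtains lam where "\<And>i j. i \<le> j \<Longrightarrow> j < m \<Longrightarrow> lam j \<le> lam i" "\<And>i. i < m \<Longrightarrow> 0 \<le> lam i"
    "eigs m (mmul m (ctr m g) g) = map lam [0..<m]"
    "\<And>n. mtrace m (mpow m (mmul m (ctr m g) g) n) = of_real (\<Sum>i<m. lam i ^ n)"
proof -
  let ?A = "mmul m (ctr m g) g"
  \<comment> \<open>g may have entries outside the index range, so the double adjoint returns g only
    inside it.\<close>
  have cc: "ctr m (ctr m g) i k = g i k" if "i < m" "k < m" for i k using that by (simp add: ctr_def)
  have "Frep FC m ?A" by (simp add: Frep_def)
  moreover have "ctr m ?A = ?A"
    unfolding ctr_mmul by (rule in_mat_eqI[of m]) (auto simp: in_mat_def mmul_def cc)
  ultimately obtain V lam where V: "V \<in> UF FC m" and anti: "\<And>i j. i \<le> j \<Longrightarrow> j < m \<Longrightarrow> lam j \<le> lam i"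
    and A: "?A = mmul m V (mmul m (diagF FC m lam) (ctr m V))"
    using spectral_theorem[of FC m ?A] by auto
  have Vc: "mmul m (ctr m V) V = idm m" using UF_ctr_left[OF V] by simp
  have nonneg: "0 \<le> lam i" if i: "i < m" for i
  proof -
    let ?h = "mmul m g V"
    have "mmul m (ctr m ?h) ?h = mmul m (ctr m V) (mmul m ?A V)" by (simp only: ctr_mmul mmul_assoc)
    also have "\<dots> = mmul m (mmul m (ctr m V) V) (mmul m (diagF FC m lam) (mmul m (ctr m V) V))"
      unfolding A by (simp only: mmul_assoc)
    also have "\<dots> = diagF FC m lam"
      using in_mat_diagF[of FC m] by (simp add: Vc mmul_idm_left mmul_idm_right)
    finally have "complex_of_real (lam i) = mmul m (ctr m ?h) ?h i i" using i by (simp add: diagF_def)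
    also have "\<dots> = of_real (\<Sum>k<m. (cmod (?h k i))\<^sup>2)"
      using ip_columns[OF i i, of ?h ?h] ip_self[of m "\<lambda>k. ?h k i"] nrm_square[of m "\<lambda>k. ?h k i"] by simp
    finally have "lam i = (\<Sum>k<m. (cmod (?h k i))\<^sup>2)" unfolding of_real_eq_iff .
    then show ?thesis by (simp add: sum_nonneg)
  qed
  show ?thesis
    using that[OF anti nonneg _ mtrace_mpow_diagonalized[OF V A]] eigs_diagonalized[of V FC m ?A lam] V A anti
    by simp
qed

text \<open>The power sum lies between \<open>d s ^ n\<close> and m times that, and the n-th root of
  m tends to 1.\<close>

lemma root_power_sum_tendsto:
  fixes d :: "nat \<Rightarrow> real"
  assumes "s < m" "\<And>i j. i \<le> j \<Longrightarrow> j < m \<Longrightarrow> d j \<le> d i" "\<And>i. i < m \<Longrightarrow> 0 \<le> d i"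
  shows "(\<lambda>n. root n (\<Sum>i\<in>{s..<m}. d i ^ n)) \<longlonglongrightarrow> d s"
proof (rule tendsto_sandwich)
  have m: "real m > 0" using assms(1) by simp
  show "(\<lambda>n. d s) \<longlonglongrightarrow> d s" by simp
  show "(\<lambda>n. root n (real m) * d s) \<longlonglongrightarrow> d s"
    using tendsto_mult[OF LIMSEQ_root_const[OF m] tendsto_const[of "d s"]] by simp
  show "\<forall>\<^sub>F n in sequentially. d s \<le> root n (\<Sum>i\<in>{s..<m}. d i ^ n)"
    using eventually_gt_at_top[of 0]
  proof eventually_elim
    case (elim n)
    have "d s ^ n \<le> (\<Sum>i\<in>{s..<m}. d i ^ n)"
      using assms by (intro member_le_sum) auto
    then have "root n (d s ^ n) \<le> root n (\<Sum>i\<in>{s..<m}. d i ^ n)" using elim by simp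
    then show ?case using elim assms by (simp add: real_root_power_cancel)
  qed
  show "\<forall>\<^sub>F n in sequentially. root n (\<Sum>i\<in>{s..<m}. d i ^ n) \<le> root n (real m) * d s"
    using eventually_gt_at_top[of 0]
  proof eventually_elim
    case (elim n)
    have "(\<Sum>i\<in>{s..<m}. d i ^ n) \<le> (\<Sum>i\<in>{s..<m}. d s ^ n)"
      using assms by (intro sum_mono power_mono) auto
    also have "\<dots> \<le> real m * d s ^ n" using assms by (auto intro!: mult_right_mono)
    finally have "root n (\<Sum>i\<in>{s..<m}. d i ^ n) \<le> root n (real m * d s ^ n)" using elim by simp
    then show ?case using elim assms by (simp add: real_root_mult real_root_power_cancel)
  qed
qed

text \<open>The eigenvalues are peeled off from the largest: number s is the limit of the n-th root
  of the trace of the n-th power after the n-th powers of the first s eigenvalues are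
  subtracted.\<close>

lemma measurable_eigs:
  assumes [measurable]: "f \<in> borel_measurable M"
  shows "s < m \<Longrightarrow> (\<lambda>x. eigs m (mmul m (ctr m (f x)) (f x)) ! s) \<in> borel_measurable M"
proof (induction s rule: less_induct)
  case (less s)
  let ?A = "\<lambda>x. mmul m (ctr m (f x)) (f x)"
  let ?e = "\<lambda>i x. eigs m (?A x) ! i"
  have [measurable]: "?e i \<in> borel_measurable M" if "i < s" for i using less that by auto
  have sum: "(\<lambda>x. \<Sum>i<s. ?e i x ^ n) \<in> borel_measurable M" for n
    by (rule borel_measurable_sum) (auto intro!: borel_measurable_power less)
  have root: "root n \<in> borel_measurable borel" for n
    by (intro borel_measurable_continuous_onI continuous_on_real_root continuous_on_id)
  have "(\<lambda>x. root n (Re (mtrace m (mpow m (?A x) n)) - (\<Sum>i<s. ?e i x ^ n))) \<in> borel_measurable M" for n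
  proof (rule measurable_compose[OF _ root])
    have [measurable]: "?A \<in> borel_measurable M" by measurable
    have "(\<lambda>x. Re (mtrace m (mpow m (?A x) n))) \<in> borel_measurable M" by measurable
    then show "(\<lambda>x. Re (mtrace m (mpow m (?A x) n)) - (\<Sum>i<s. ?e i x ^ n)) \<in> borel_measurable M"
      using sum by (rule borel_measurable_diff)
  qed
  moreover have "(\<lambda>n. root n (Re (mtrace m (mpow m (?A x) n)) - (\<Sum>i<s. ?e i x ^ n))) \<longlonglongrightarrow> ?e s x" for x
  proof -
    obtain lam where lam: "\<And>i j. i \<le> j \<Longrightarrow> j < m \<Longrightarrow> lam j \<le> lam i" "\<And>i. i < m \<Longrightarrow> 0 \<le> lam i"
      "eigs m (?A x) = map lam [0..<m]" "\<And>n. mtrace m (mpow m (?A x) n) = of_real (\<Sum>i<m. lam i ^ n)"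
      using eigs_ctr_mmul[of m "f x"] by blast
    have e: "?e i x = lam i" if "i < m" for i using that by (simp add: lam(3))
    have "Re (mtrace m (mpow m (?A x) n)) - (\<Sum>i<s. ?e i x ^ n) = (\<Sum>i\<in>{s..<m}. lam i ^ n)" for n
    proof -
      have "(\<Sum>i<m. lam i ^ n) = (\<Sum>i<s. lam i ^ n) + (\<Sum>i\<in>{s..<m}. lam i ^ n)"
        using less.prems by (simp add: lessThan_atLeast0 sum.atLeastLessThan_concat)
      moreover have "(\<Sum>i<s. ?e i x ^ n) = (\<Sum>i<s. lam i ^ n)"
        using less.prems by (intro sum.cong) (auto simp: e)
      ultimately show ?thesis unfolding lam(4) Re_complex_of_real by simp
    qed
    then show ?thesis using root_power_sum_tendsto[OF less.prems lam(1,2)] e[OF less.prems] by simp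
  qed
  ultimately show ?case by (intro borel_measurable_LIMSEQ_real[of M _ "?e s"])
qed

lemma measurable_ln_sing [measurable (raw)]:
  assumes [measurable]: "f \<in> borel_measurable M"
  shows "(\<lambda>x. ln_sing F q (f x)) \<in> borel_measurable M"
proof (rule measurable_coordinatewise_then_product)
  fix j
  show "(\<lambda>x. ln_sing F q (f x) j) \<in> borel_measurable M"
  proof (cases "j < q")
    case True
    then have "cF F * j < msz F q" by (simp add: msz_def)
    note [measurable] = measurable_eigs[OF assms this]
    show ?thesis using True by (simp add: ln_sing_def sing_vals_def)
  qed (simp add: ln_sing_def)
qed

text \<open>Measurability of \<open>minv\<close> on all matrices, through the adjugate; on singular matrices \<open>minv\<close>
  is the constant value of an unsatisfiable \<open>THE\<close>.\<close>

lemma minv_eq: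
  "minv m A = (if detm m A = 0 then (THE B. False) else
    (\<lambda>i j. if i < m \<and> j < m then (-1) ^ (j + i) *
      detm (m - 1) (\<lambda>i' j'. A (if i' < j then i' else Suc i') (if j' < i then j' else Suc j')) / detm m A else 0))"
proof (cases "detm m A = 0")
  case True
  have "\<not> mmul m A B = idm m" for B
  proof
    assume "mmul m A B = idm m"
    then have "detm m A * detm m B = 1" by (metis detm_mmul detm_idm)
    then show False using True by simp
  qed
  then have "(\<lambda>B. in_mat m B \<and> mmul m A B = idm m \<and> mmul m B A = idm m) = (\<lambda>B. False)" by auto
  then show ?thesis using True unfolding minv_def by simp
next
  case False
  define C where "C = (\<lambda>i j. if i < m \<and> j < m then (-1) ^ (j + i) *
      detm (m - 1) (\<lambda>i' j'. A (if i' < j then i' else Suc i') (if j' < i then j' else Suc j')) / detm m A else 0)"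
  have C_in: "in_mat m C" by (auto simp: in_mat_def C_def)
  have adj: "jmat m C = (1 / detm m A) \<cdot>\<^sub>m adj_mat (jmat m A)"
  proof (rule eq_matI)
    fix i j assume "i < dim_row ((1 / detm m A) \<cdot>\<^sub>m adj_mat (jmat m A))"
      "j < dim_col ((1 / detm m A) \<cdot>\<^sub>m adj_mat (jmat m A))"
    then have ij: "i < m" "j < m" by (simp_all add: adj_mat_def jmat_def)
    have "mat_delete (jmat m A) j i =
        jmat (m - 1) (\<lambda>i' j'. A (if i' < j then i' else Suc i') (if j' < i then j' else Suc j'))"
      by (rule eq_matI) (use ij in \<open>auto simp: mat_delete_def jmat_def\<close>)
    then show "jmat m C $$ (i, j) = ((1 / detm m A) \<cdot>\<^sub>m adj_mat (jmat m A)) $$ (i, j)"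
      using ij by (simp add: adj_mat_def jmat_def[of m] C_def cofactor_def detm_jmat[symmetric])
  qed (simp_all add: adj_mat_def jmat_def)
  have "jmat m A * jmat m C = 1\<^sub>m m"
    unfolding adj using adj_mat[of "jmat m A" m] False
    by (simp add: mult_smult_distrib[of _ m m _ m] detm_jmat[symmetric]) (rule eq_matI, auto)
  then have AC: "mmul m A C = idm m" by (intro jmat_eqD[of m]) (simp_all add: jmat_mmul jmat_idm)
  have CA: "mmul m C A = idm m" by (rule mmul_left_right_inverse[OF AC])
  have "minv m A = C" unfolding minv_def
  proof (rule the_equality)
    fix B assume B: "in_mat m B \<and> mmul m A B = idm m \<and> mmul m B A = idm m"
    then have "B = mmul m B (mmul m A C)" by (simp add: AC mmul_idm_right)
    also have "\<dots> = C" using B C_in by (simp add: mmul_idm_left flip: mmul_assoc)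
    finally show "B = C" .
  qed (use C_in AC CA in auto)
  then show ?thesis using False by (simp add: C_def)
qed

lemma measurable_minv [measurable (raw)]:
  assumes [measurable]: "f \<in> borel_measurable M"
  shows "(\<lambda>x. minv m (f x)) \<in> borel_measurable M"
proof -
  have 2 [measurable]: "(\<lambda>x. detm m (f x)) \<in> borel_measurable M" by (intro measurable_detm measurable_entry assms)
  have 3: "(\<lambda>x i j. if i < m \<and> j < m then (-1) ^ (j + i) *
      detm (m - 1) (\<lambda>i' j'. f x (if i' < j then i' else Suc i') (if j' < i then j' else Suc j')) / detm m (f x) else 0)
      \<in> borel_measurable M"
  proof (rule measurable_cmatI)
    fix i j
    have "(\<lambda>x. detm (m - 1) (\<lambda>i' j'. f x (if i' < j then i' else Suc i') (if j' < i then j' else Suc j')))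
        \<in> borel_measurable M"
      by (intro measurable_detm measurable_entry assms)
    then show "(\<lambda>x. if i < m \<and> j < m then (-1) ^ (j + i) *
      detm (m - 1) (\<lambda>i' j'. f x (if i' < j then i' else Suc i') (if j' < i then j' else Suc j')) / detm m (f x) else 0)
      \<in> borel_measurable M"
      using 2 by (cases "i < m"; cases "j < m") simp_all
  qed
  show ?thesis unfolding minv_eq
  proof (rule measurable_If[OF _ 3])
    show "{x \<in> space M. detm m (f x) = 0} \<in> sets M" by measurable
  qed simp
qed

lemma minv_UF: assumes u: "u \<in> UF F q" shows "minv (msz F q) u = ctr (msz F q) u"
  unfolding minv_def
proof (rule the_equality)
  let ?m = "msz F q"
  fix B assume B: "in_mat ?m B \<and> mmul ?m u B = idm ?m \<and> mmul ?m B u = idm ?m"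
  then have "B = mmul ?m (ctr ?m u) (mmul ?m u B)" by (metis UF_cancel(2)[OF u])
  also have "\<dots> = ctr ?m u" using B by (simp add: mmul_idm_right)
  finally show "B = ctr ?m u" .
qed (use UF_ctr_left[OF u] UF_ctr_right[OF u] in auto)

lemma closed_UF: "closed (UF F q)"
proof -
  let ?m = "msz F q"
  have entry: "continuous_on UNIV (\<lambda>u :: cmat. u i j)" for i j
    by (rule continuous_on_product_then_coordinatewise[OF continuous_on_product_then_coordinatewise[OF continuous_on_id]])
  have imp: "closed {u :: cmat. \<forall>i j. b i j \<longrightarrow> f i j u = g i j u}"
    if "\<And>i j. continuous_on UNIV (f i j)" "\<And>i j. continuous_on UNIV (g i j)"
    for b and f g :: "nat \<Rightarrow> nat \<Rightarrow> cmat \<Rightarrow> 'a::t2_space"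
  proof -
    have "closed {u. b i j \<longrightarrow> f i j u = g i j u}" for i j
      using closed_Collect_eq[OF that] by (cases "b i j") auto
    then show ?thesis by (intro closed_Collect_all)
  qed
  have im: "closed {u :: cmat. in_mat ?m u}"
    unfolding in_mat_def by (rule imp) (auto intro: entry continuous_intros)
  have "closed {u :: cmat. Frep F q u}"
  proof (cases F)
    case FR
    have "closed {u :: cmat. \<forall>i j. True \<longrightarrow> Im (u i j) = 0}"
      by (rule imp) (auto intro!: continuous_intros entry)
    then show ?thesis using closed_Collect_conj[OF im] FR by (simp add: Frep_def)
  next
    case FC then show ?thesis using im by (simp add: Frep_def)
  next
    case FH
    have "closed {u :: cmat. \<forall>i j. i < q \<and> j < q \<longrightarrow> u (2*i+1) (2*j+1) = cnj (u (2*i) (2*j))}"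
      by (rule imp) (auto intro!: continuous_intros entry)
    moreover have "closed {u :: cmat. \<forall>i j. i < q \<and> j < q \<longrightarrow> u (2*i+1) (2*j) = - cnj (u (2*i) (2*j+1))}"
      by (rule imp) (auto intro!: continuous_intros entry)
    ultimately have "closed ({u. in_mat ?m u} \<inter> ({u :: cmat. \<forall>i j. i < q \<and> j < q \<longrightarrow> u (2*i+1) (2*j+1) = cnj (u (2*i) (2*j))}
        \<inter> {u. \<forall>i j. i < q \<and> j < q \<longrightarrow> u (2*i+1) (2*j) = - cnj (u (2*i) (2*j+1))}))"
      using im by (intro closed_Int)
    moreover have "{u. in_mat ?m u} \<inter> ({u :: cmat. \<forall>i j. i < q \<and> j < q \<longrightarrow> u (2*i+1) (2*j+1) = cnj (u (2*i) (2*j))}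
        \<inter> {u. \<forall>i j. i < q \<and> j < q \<longrightarrow> u (2*i+1) (2*j) = - cnj (u (2*i) (2*j+1))}) = {u. Frep F q u}"
      using FH by (auto simp: Frep_def)
    ultimately show ?thesis by simp
  qed
  moreover have "closed {u. \<forall>i j. (i < ?m \<and> j < ?m) \<longrightarrow> (\<Sum>k<?m. cnj (u k i) * u k j) = idm ?m i j}"
    by (rule imp) (auto intro!: continuous_intros entry)
  ultimately have "closed ({u. Frep F q u} \<inter>
      {u. \<forall>i j. (i < ?m \<and> j < ?m) \<longrightarrow> (\<Sum>k<?m. cnj (u k i) * u k j) = idm ?m i j})"
    by (rule closed_Int)
  moreover have "{u. Frep F q u} \<inter>
      {u. \<forall>i j. (i < ?m \<and> j < ?m) \<longrightarrow> (\<Sum>k<?m. cnj (u k i) * u k j) = idm ?m i j} = UF F q"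
    by (auto simp: UF_def fun_eq_iff mmul_def ctr_def idm_def)
  ultimately show ?thesis by simp
qed

lemma UF_sets [measurable]: "UF F q \<in> sets borel"
  by (rule borel_closed[OF closed_UF])

subsection \<open>Haar measure and the moment function\<close>

definition is_haar :: "fld \<Rightarrow> nat \<Rightarrow> cmat measure \<Rightarrow> bool" where
  "is_haar F q \<mu> \<longleftrightarrow> sets \<mu> = sets borel \<and> prob_space \<mu> \<and> emeasure \<mu> (UF F q) = 1 \<and>
     (\<forall>u\<in>UF F q. distr \<mu> borel (mmul (msz F q) u) = \<mu>)"

text \<open>With \<open>x\<close>, \<open>y\<close> independent, \<open>x* y\<close> has the law of \<open>y\<close> and its adjoint \<open>y* x\<close> that of \<open>x\<close>.\<close>

lemma haar_inversion:
  assumes "is_haar F q \<mu>" "is_haar F q \<mu>'" and B: "B \<in> sets borel"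
  shows "emeasure \<mu> B = emeasure \<mu>' (ctr (msz F q) -` B)"
proof -
  let ?m = "msz F q"
  have s [measurable_cong]: "sets \<mu> = sets borel" "sets \<mu>' = sets borel" using assms by (auto simp: is_haar_def)
  interpret \<mu>: prob_space \<mu> using assms by (simp add: is_haar_def)
  interpret \<mu>': prob_space \<mu>' using assms by (simp add: is_haar_def)
  interpret pair_sigma_finite \<mu>' \<mu> ..
  have [measurable]: "B \<in> sets borel" by (rule B)
  have AE: "AE u in \<mu>. u \<in> UF F q" "AE u in \<mu>'. u \<in> UF F q"
    using assms by (auto simp: is_haar_def \<mu>.emeasure_eq_measure \<mu>'.emeasure_eq_measure intro!: \<mu>.AE_prob_1 \<mu>'.AE_prob_1)
  have inv: "(\<integral>\<^sup>+ y. f (mmul ?m u y) \<partial>\<mu>) = (\<integral>\<^sup>+ y. f y \<partial>\<mu>)"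
    "(\<integral>\<^sup>+ y. f (mmul ?m u y) \<partial>\<mu>') = (\<integral>\<^sup>+ y. f y \<partial>\<mu>')"
    if "u \<in> UF F q" and [measurable]: "f \<in> borel_measurable borel" for u and f :: "cmat \<Rightarrow> ennreal"
  proof -
    have d: "distr \<mu> borel (mmul ?m u) = \<mu>" "distr \<mu>' borel (mmul ?m u) = \<mu>'"
      using assms that by (auto simp: is_haar_def)
    show "(\<integral>\<^sup>+ y. f (mmul ?m u y) \<partial>\<mu>) = (\<integral>\<^sup>+ y. f y \<partial>\<mu>)"
      by (subst (2) d(1)[symmetric], subst nn_integral_distr) auto
    show "(\<integral>\<^sup>+ y. f (mmul ?m u y) \<partial>\<mu>') = (\<integral>\<^sup>+ y. f y \<partial>\<mu>')"
      by (subst (2) d(2)[symmetric], subst nn_integral_distr) auto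
  qed
  let ?f = "indicator B :: cmat \<Rightarrow> ennreal"
  \<comment> \<open>With x fixed, \<mu> absorbs the left factor. In the other order, below, the
    integrand is a function of the adjoint of y* x, so \<mu>' absorbs y* and only the adjoint
    remains.\<close>
  have "(\<integral>\<^sup>+ x. \<integral>\<^sup>+ y. ?f (mmul ?m (ctr ?m x) y) \<partial>\<mu> \<partial>\<mu>') = (\<integral>\<^sup>+ x. emeasure \<mu> B \<partial>\<mu>')"
  proof (rule nn_integral_cong_AE)
    show "AE x in \<mu>'. (\<integral>\<^sup>+ y. ?f (mmul ?m (ctr ?m x) y) \<partial>\<mu>) = emeasure \<mu> B"
      using AE(2)
    proof eventually_elim
      case (elim x)
      show ?case by (subst inv(1)[OF UF_ctr[OF elim]]) (auto simp: s)
    qed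
  qed
  also have "\<dots> = emeasure \<mu> B" by (simp add: \<mu>'.emeasure_space_1)
  finally have 1: "(\<integral>\<^sup>+ x. \<integral>\<^sup>+ y. ?f (mmul ?m (ctr ?m x) y) \<partial>\<mu> \<partial>\<mu>') = emeasure \<mu> B" .
  have "(\<integral>\<^sup>+ y. \<integral>\<^sup>+ x. ?f (mmul ?m (ctr ?m x) y) \<partial>\<mu>' \<partial>\<mu>) = (\<integral>\<^sup>+ y. emeasure \<mu>' (ctr ?m -` B) \<partial>\<mu>)"
  proof (rule nn_integral_cong_AE)
    show "AE y in \<mu>. (\<integral>\<^sup>+ x. ?f (mmul ?m (ctr ?m x) y) \<partial>\<mu>') = emeasure \<mu>' (ctr ?m -` B)"
      using AE(1)
    proof eventually_elim
    case (elim y)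
    have "(\<integral>\<^sup>+ x. ?f (mmul ?m (ctr ?m x) y) \<partial>\<mu>') = (\<integral>\<^sup>+ x. ?f (ctr ?m (mmul ?m (ctr ?m y) x)) \<partial>\<mu>')"
      by (simp add: ctr_mmul ctr_ctr UF_in_mat[OF elim])
    also have "\<dots> = (\<integral>\<^sup>+ x. ?f (ctr ?m x) \<partial>\<mu>')"
      by (rule inv(2)[OF UF_ctr[OF elim]]) measurable
    also have "\<dots> = (\<integral>\<^sup>+ x. indicator (ctr ?m -` B) x \<partial>\<mu>')"
      by (intro nn_integral_cong) (simp add: indicator_def)
    also have "\<dots> = emeasure \<mu>' (ctr ?m -` B)"
    proof (rule nn_integral_indicator)
      have "ctr ?m -` B \<inter> space borel \<in> sets borel" by (rule measurable_sets[OF _ B]) measurable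
      then show "ctr ?m -` B \<in> sets \<mu>'" by (simp add: s)
    qed
    finally show ?case .
    qed
  qed
  also have "\<dots> = emeasure \<mu>' (ctr ?m -` B)" by (simp add: \<mu>.emeasure_space_1)
  finally have 2: "(\<integral>\<^sup>+ y. \<integral>\<^sup>+ x. ?f (mmul ?m (ctr ?m x) y) \<partial>\<mu>' \<partial>\<mu>) = emeasure \<mu>' (ctr ?m -` B)" .
  have "(\<integral>\<^sup>+ y. \<integral>\<^sup>+ x. ?f (mmul ?m (ctr ?m x) y) \<partial>\<mu>' \<partial>\<mu>) = (\<integral>\<^sup>+ x. \<integral>\<^sup>+ y. ?f (mmul ?m (ctr ?m x) y) \<partial>\<mu> \<partial>\<mu>')"
    by (rule Fubini') measurable
  with 1 2 show ?thesis by simp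
qed

text \<open>Inversion for the pair \<mu>, \<mu>' and for \<mu>', \<mu>' expresses both measures of B
  by the same number.\<close>

lemma haar_unique:
  assumes "is_haar F q \<mu>" "is_haar F q \<mu>'" shows "\<mu> = \<mu>'"
proof (rule measure_eqI)
  show s: "sets \<mu> = sets \<mu>'" using assms by (simp add: is_haar_def)
  fix B assume "B \<in> sets \<mu>"
  then have "B \<in> sets borel" using assms by (simp add: is_haar_def)
  then show "emeasure \<mu> B = emeasure \<mu>' B"
    using haar_inversion[OF assms] haar_inversion[OF assms(2,2)] by simp
qed

text \<open>The step law itself provides a Haar measure: the law of the unitary factor in the Gram-Schmidt
  decomposition.\<close>

locale biinvariant_law =
  fixes F :: fld and q :: nat and \<nu> :: "cmat measure"
  assumes prob: "prob_space \<nu>" and sets_\<nu>: "sets \<nu> = sets borel" and GL: "emeasure \<nu> (GLF F q) = 1"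
    and biinv: "\<And>u v. u \<in> UF F q \<Longrightarrow> v \<in> UF F q \<Longrightarrow>
      distr \<nu> borel (\<lambda>g. mmul (msz F q) (mmul (msz F q) u g) v) = \<nu>"
begin

sublocale prob_space \<nu> by (rule prob)

declare sets_\<nu> [measurable_cong]

abbreviation "m \<equiv> msz F q"

lemma space_\<nu> [simp]: "space \<nu> = UNIV"
  using sets_\<nu>[THEN sets_eq_imp_space_eq] by simp

text \<open>\<open>emeasure\<close> is 0 outside the sigma-algebra, so the value 1 already forces
  measurability and no topological argument is required.\<close>

lemma GLF_sets: "GLF F q \<in> sets borel"
  using emeasure_notin_sets[of "GLF F q" \<nu>] GL sets_\<nu> by (metis zero_neq_one)

lemma AE_GLF: "AE g in \<nu>. g \<in> GLF F q"
  using GL GLF_sets by (intro AE_prob_1) (simp add: emeasure_eq_measure)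

lemma left_invariant:
  assumes u: "u \<in> UF F q" shows "distr \<nu> borel (mmul m u) = \<nu>"
proof -
  have "mmul m (mmul m u g) (idm m) = mmul m u g" for g by (simp add: mmul_idm_right)
  then show ?thesis using biinv[OF u UF_idm] by simp
qed

text \<open>The candidate inherits left invariance from \<nu> because \<open>gs\<close> commutes
  with unitary left factors; uniqueness then identifies it with the definite description.\<close>

lemma is_haar_haar: "is_haar F q (haar F q)"
proof -
  let ?\<mu> = "distr \<nu> borel (gs m)"
  have ex: "is_haar F q ?\<mu>"
    unfolding is_haar_def
  proof (intro conjI ballI)
    show "prob_space ?\<mu>" by (rule prob_space_distr) measurable
    have "1 = emeasure \<nu> (GLF F q)" using GL by simp
    also have "\<dots> \<le> emeasure \<nu> (gs m -` UF F q \<inter> space \<nu>)"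
    proof (rule emeasure_mono)
      show "gs m -` UF F q \<inter> space \<nu> \<in> sets \<nu>" by measurable
    qed (auto simp: gs_UF)
    also have "\<dots> = emeasure ?\<mu> (UF F q)" by (subst emeasure_distr) auto
    finally show "emeasure ?\<mu> (UF F q) = 1"
      using prob_space.measure_le_1[OF \<open>prob_space ?\<mu>\<close>, of "UF F q"]
        prob_space.emeasure_le_1[OF \<open>prob_space ?\<mu>\<close>, of "UF F q"] by (auto intro: antisym)
    fix u assume u: "u \<in> UF F q"
    have "distr ?\<mu> borel (mmul m u) = distr \<nu> borel (\<lambda>g. mmul m u (gs m g))"
      by (subst distr_distr) (auto simp: comp_def)
    also have "\<dots> = distr \<nu> borel (\<lambda>g. gs m (mmul m u g))"
      by (simp add: gs_equivariant[OF UF_ctr_left[OF u]])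
    also have "\<dots> = distr (distr \<nu> borel (mmul m u)) borel (gs m)"
      by (subst distr_distr) (auto simp: comp_def)
    finally show "distr ?\<mu> borel (mmul m u) = ?\<mu>" by (simp add: left_invariant[OF u])
  qed simp
  have "haar F q = (THE \<mu>. is_haar F q \<mu>)" by (simp add: haar_def is_haar_def)
  also have "is_haar F q \<dots>"
    by (rule theI[where P = "is_haar F q", OF ex]) (rule haar_unique[OF _ ex])
  finally show ?thesis .
qed

lemma sets_haar [measurable_cong]: "sets (haar F q) = sets borel"
  using is_haar_haar by (simp add: is_haar_def)

lemma prob_haar: "prob_space (haar F q)"
  using is_haar_haar by (simp add: is_haar_def)

lemma AE_haar: "AE u in haar F q. u \<in> UF F q"
proof -
  interpret haar: prob_space "haar F q" by (rule prob_haar)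
  show ?thesis using is_haar_haar by (intro haar.AE_prob_1) (simp add: is_haar_def haar.emeasure_eq_measure)
qed

lemma integral_haar_left:
  assumes u: "u \<in> UF F q" and [measurable]: "f \<in> borel_measurable borel"
  shows "(\<integral>v. f (mmul m u v) \<partial>haar F q) = (\<integral>v. (f v :: real) \<partial>haar F q)"
proof -
  have "distr (haar F q) borel (mmul m u) = haar F q" using is_haar_haar u by (simp add: is_haar_def)
  then have "(\<integral>v. f v \<partial>haar F q) = (\<integral>v. f v \<partial>distr (haar F q) borel (mmul m u))" by simp
  also have "\<dots> = (\<integral>v. f (mmul m u v) \<partial>haar F q)" by (rule integral_distr) measurable
  finally show ?thesis by simp
qed

lemma measurable_exp2diag:
  "exp2diag F q \<in> borel_measurable borel"
proof (rule measurable_cmatI)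
  fix i j
  have "(\<lambda>t. t (i div cF F) :: real) \<in> borel_measurable borel" by measurable
  then show "(\<lambda>t. exp2diag F q t i j) \<in> borel_measurable borel"
    unfolding exp2diag_def by (cases "i < m \<and> j = i") (simp_all add: borel_measurable_of_real)
qed

text \<open>The inverse equals the adjoint only almost everywhere, and replacing it under the
  integral asks for measurability of both integrands; this is where measurability of
  \<open>minv\<close> on all matrices enters.\<close>

lemma m1_eq:
  "m1 F q t j = (\<integral>u. iwa F j (mmul m (mmul m (ctr m u) (exp2diag F q t)) u) \<partial>haar F q)"
proof -
  have "(\<integral>u. iwa F j (mmul m (mmul m (minv m u) (exp2diag F q t)) u) \<partial>haar F q) =
      (\<integral>u. iwa F j (mmul m (mmul m (ctr m u) (exp2diag F q t)) u) \<partial>haar F q)"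
    using AE_haar by (intro integral_cong_AE) (measurable, auto simp: minv_UF)
  then show ?thesis by (simp add: m1_def iwa_def Let_def)
qed

lemma measurable_m1 [measurable]: "(\<lambda>t. m1 F q t j) \<in> borel_measurable borel"
proof -
  interpret haar: prob_space "haar F q" by (rule prob_haar)
  note [measurable] = measurable_exp2diag
  show ?thesis unfolding m1_eq
    by (rule sigma_finite_measure.borel_measurable_lebesgue_integral[OF prob_space_imp_sigma_finite[OF prob_haar]]) measurable
qed

text \<open>Diagonalise the Gram matrix of g by V; the substitution of V* u for u, under which Haar
  measure is invariant, leaves the diagonal matrix of the moment function.\<close>

lemma integral_haar_iwa:
  assumes g: "g \<in> GLF F q"
  shows "(\<integral>u. iwa F j (gram m (mmul m (ctr m u) g)) \<partial>haar F q) = m1 F q (ln_sing F q g) j"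
proof -
  let ?D = "exp2diag F q (ln_sing F q g)"
  obtain V where V: "V \<in> UF F q" "gram m g = mmul m V (mmul m ?D (ctr m V))"
    using gram_ln_sing[OF g] by blast
  let ?f = "\<lambda>u. iwa F j (mmul m (mmul m (ctr m u) ?D) u)"
  have "gram m (mmul m (ctr m u) g) = mmul m (mmul m (ctr m (mmul m (ctr m V) u)) ?D) (mmul m (ctr m V) u)"
    if "u \<in> UF F q" for u
    using UF_in_mat[OF that] UF_in_mat[OF V(1)] by (simp add: gram_mmul V(2) ctr_mmul ctr_ctr mmul_assoc)
  then have "(\<integral>u. iwa F j (gram m (mmul m (ctr m u) g)) \<partial>haar F q) = (\<integral>u. ?f (mmul m (ctr m V) u) \<partial>haar F q)"
    using AE_haar by (intro integral_cong_AE) (measurable, auto)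
  also have "\<dots> = (\<integral>u. ?f u \<partial>haar F q)"
    by (rule integral_haar_left[OF UF_ctr[OF V(1)]]) measurable
  finally show ?thesis by (simp add: m1_eq)
qed

text \<open>The double integral over u and g is evaluated in both orders: the inner integral over u
  is the moment function, the inner integral over g does not depend on u by left invariance of
  \<nu>.\<close>

lemma iwa_mean:
  assumes j: "j < q" and int: "integrable \<nu> (\<lambda>g. iwa F j (gram m g))"
  shows "(\<integral>g. iwa F j (gram m g) \<partial>\<nu>) = m1_meas F q (distr \<nu> borel (ln_sing F q)) j"
proof -
  let ?b = "\<lambda>g. iwa F j (gram m g)"
  interpret haar: prob_space "haar F q" by (rule prob_haar)
  interpret pair_sigma_finite "haar F q" \<nu> ..
  have inv: "(\<integral>g. h (mmul m u g) \<partial>\<nu>) = (\<integral>g. h g \<partial>\<nu>)" "integrable \<nu> (\<lambda>g. h (mmul m u g)) \<longleftrightarrow> integrable \<nu> h"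
    if u: "u \<in> UF F q" and [measurable]: "h \<in> borel_measurable borel" for u and h :: "cmat \<Rightarrow> real"
    by (subst (2) left_invariant[OF u, symmetric], simp add: integral_distr integrable_distr_eq)+
  have m [measurable]: "(\<lambda>(u, g). ?b (mmul m (ctr m u) g)) \<in> borel_measurable (haar F q \<Otimes>\<^sub>M \<nu>)" by measurable
  have b [measurable]: "?b \<in> borel_measurable borel" by measurable
  \<comment> \<open>Left invariance makes the inner integral of the absolute value constant in u, so
    integrability of one walk increment is enough for Fubini.\<close>
  have intp: "integrable (haar F q \<Otimes>\<^sub>M \<nu>) (\<lambda>(u, g). ?b (mmul m (ctr m u) g))"
  proof (rule Fubini_integrable[OF m], simp_all only: split_conv)
    have "AE u in haar F q. (\<integral>g. norm (?b (mmul m (ctr m u) g)) \<partial>\<nu>) = (\<integral>g. norm (?b g) \<partial>\<nu>)"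
      using AE_haar by eventually_elim (rule inv(1)[OF UF_ctr], auto)
    moreover have "integrable (haar F q) (\<lambda>u. \<integral>g. norm (?b g) \<partial>\<nu>)" by simp
    moreover have "(\<lambda>u. \<integral>g. norm (?b (mmul m (ctr m u) g)) \<partial>\<nu>) \<in> borel_measurable (haar F q)"
      by (rule sigma_finite_measure.borel_measurable_lebesgue_integral[OF prob_space_imp_sigma_finite[OF prob]]) measurable
    ultimately show "integrable (haar F q) (\<lambda>u. \<integral>g. norm (?b (mmul m (ctr m u) g)) \<partial>\<nu>)"
      by (subst integrable_cong_AE) auto
    show "AE u in haar F q. integrable \<nu> (\<lambda>g. ?b (mmul m (ctr m u) g))"
      using AE_haar by eventually_elim (subst inv(2)[OF UF_ctr], auto simp: int)
  qed
  have "m1_meas F q (distr \<nu> borel (ln_sing F q)) j = (\<integral>g. m1 F q (ln_sing F q g) j \<partial>\<nu>)"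
    unfolding m1_meas_def by (rule integral_distr) measurable
  also have "\<dots> = (\<integral>g. \<integral>u. ?b (mmul m (ctr m u) g) \<partial>haar F q \<partial>\<nu>)"
  proof (rule integral_cong_AE)
    show "(\<lambda>g. \<integral>u. ?b (mmul m (ctr m u) g) \<partial>haar F q) \<in> borel_measurable \<nu>"
      by (rule sigma_finite_measure.borel_measurable_lebesgue_integral[OF prob_space_imp_sigma_finite[OF prob_haar]]) measurable
    show "AE g in \<nu>. m1 F q (ln_sing F q g) j = (\<integral>u. ?b (mmul m (ctr m u) g) \<partial>haar F q)"
      using AE_GLF by eventually_elim (simp add: integral_haar_iwa)
  qed measurable
  also have "\<dots> = (\<integral>u. \<integral>g. ?b (mmul m (ctr m u) g) \<partial>\<nu> \<partial>haar F q)"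
    using Fubini_integral[OF intp] by simp
  also have "\<dots> = (\<integral>u. \<integral>g. ?b g \<partial>\<nu> \<partial>haar F q)"
  proof (rule integral_cong_AE)
    show "(\<lambda>u. \<integral>g. ?b (mmul m (ctr m u) g) \<partial>\<nu>) \<in> borel_measurable (haar F q)"
      by (rule sigma_finite_measure.borel_measurable_lebesgue_integral[OF prob_space_imp_sigma_finite[OF prob]]) measurable
    show "AE u in haar F q. (\<integral>g. ?b (mmul m (ctr m u) g) \<partial>\<nu>) = (\<integral>g. ?b g \<partial>\<nu>)"
      using AE_haar by eventually_elim (rule inv(1)[OF UF_ctr], auto)
  qed simp
  also have "\<dots> = (\<integral>g. ?b g \<partial>\<nu>)" by (simp add: haar.prob_space)
  finally show ?thesis by simp
qed

text \<open>The form in which the cocycle enters the probabilistic part: started from any invertible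
  h, the next increment has the same law.\<close>

lemma distr_iwa_increment:
  assumes h: "h \<in> GLF F q" and j: "j < q"
  shows "distr \<nu> borel (\<lambda>g. iwa F j (gram m (mmul m h g)) - iwa F j (gram m h)) =
    distr \<nu> borel (\<lambda>g. iwa F j (gram m g))"
proof -
  obtain u where u: "u \<in> UF F q" "\<And>g. g \<in> GLF F q \<Longrightarrow>
    iwa F j (gram m (mmul m h g)) = iwa F j (gram m h) + iwa F j (gram m (mmul m u g))"
    using iwa_cocycle[OF h j] by blast
  have "distr \<nu> borel (\<lambda>g. iwa F j (gram m (mmul m h g)) - iwa F j (gram m h)) =
      distr \<nu> borel (\<lambda>g. iwa F j (gram m (mmul m u g)))"
  proof (rule distr_cong_AE)
    show "AE g in \<nu>. iwa F j (gram m (mmul m h g)) - iwa F j (gram m h) = iwa F j (gram m (mmul m u g))"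
      using AE_GLF by eventually_elim (simp add: u(2))
  qed (simp, measurable)
  also have "\<dots> = distr (distr \<nu> borel (mmul m u)) borel (\<lambda>g. iwa F j (gram m g))"
    by (subst distr_distr) (auto simp: comp_def)
  finally show ?thesis by (simp add: left_invariant[OF u(1)])
qed

end

subsection \<open>Strong laws of large numbers\<close>

text \<open>The partial sums stopped at their first exceedance of a. In this recursive form each
  summand is multiplied by an event that depends on earlier summands only.\<close>

primrec stopped_sum :: "real \<Rightarrow> (nat \<Rightarrow> real) \<Rightarrow> nat \<Rightarrow> real" where
  "stopped_sum a z 0 = 0"
| "stopped_sum a z (Suc n) = stopped_sum a z n + (if \<bar>stopped_sum a z n\<bar> < a then z (Suc n) else 0)"

lemma stopped_sum_cong:
  "(\<And>i. 1 \<le> i \<Longrightarrow> i \<le> n \<Longrightarrow> z i = z' i) \<Longrightarrow> stopped_sum a z n = stopped_sum a z' n"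
  by (induction n) auto

text \<open>Both cases are needed in one induction: until the threshold is reached the stopped sum
  is the true one, afterwards it is frozen. Positivity of a excludes an exceedance by the empty
  sum.\<close>

lemma stopped_sum_exceeds:
  assumes "a > 0"
  shows "if \<exists>k\<le>n. a \<le> \<bar>\<Sum>i=1..k. z i\<bar> then a \<le> \<bar>stopped_sum a z n\<bar>
    else stopped_sum a z n = (\<Sum>i=1..n. z i)"
proof (induction n)
  case (Suc n)
  let ?E = "\<lambda>n. \<exists>k\<le>n. a \<le> \<bar>\<Sum>i=1..k. z i\<bar>"
  show ?case
  proof (cases "?E n")
    case True
    then have "?E (Suc n)" using le_SucI by blast
    moreover have "a \<le> \<bar>stopped_sum a z n\<bar>" using Suc True by simp
    ultimately show ?thesis by simp
  next
    case False
    then have "\<bar>\<Sum>i=1..n. z i\<bar> < a" by (meson not_le order_refl)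
    then have eq: "stopped_sum a z (Suc n) = (\<Sum>i=1..Suc n. z i)" using Suc False by simp
    have "?E (Suc n) \<longleftrightarrow> a \<le> \<bar>\<Sum>i=1..Suc n. z i\<bar>"
      using False by (metis le_Suc_eq order_refl)
    then show ?thesis unfolding eq by (simp only: split: if_split) simp
  qed
qed (use assms in auto)

text \<open>Stated on a finite product space, so that independence of disjoint blocks of variables
  applies.\<close>

lemma measurable_stopped_sum:
  "n \<le> N \<Longrightarrow> (\<lambda>z. stopped_sum a z n) \<in> borel_measurable (PiM {1..N} (\<lambda>_. borel))"
proof (induction n)
  case (Suc n)
  then have [measurable]: "(\<lambda>z. stopped_sum a z n) \<in> borel_measurable (PiM {1..N} (\<lambda>_. borel))"
    "(\<lambda>z. z (Suc n)) \<in> borel_measurable (PiM {1..N} (\<lambda>_. borel :: real measure))"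
    by (auto intro: measurable_component_singleton)
  show ?case unfolding stopped_sum.simps by measurable
qed auto

context prob_space
begin

text \<open>Stopping the partial sums at the first exceedance keeps them a martingale, so their second
  moment still grows by at most the variance of each summand.\<close>

lemma stopped_sum_second_moment:
  fixes Z :: "nat \<Rightarrow> 'a \<Rightarrow> real"
  assumes ind: "indep_vars (\<lambda>_. borel) Z {1..}"
    and sq: "\<And>i. i \<ge> 1 \<Longrightarrow> integrable M (\<lambda>\<omega>. (Z i \<omega>)\<^sup>2)"
    and mean: "\<And>i. i \<ge> 1 \<Longrightarrow> expectation (Z i) = 0"
  shows "integrable M (\<lambda>\<omega>. (stopped_sum a (\<lambda>i. Z i \<omega>) n)\<^sup>2) \<and>
    expectation (\<lambda>\<omega>. (stopped_sum a (\<lambda>i. Z i \<omega>) n)\<^sup>2) \<le> (\<Sum>i=1..n. expectation (\<lambda>\<omega>. (Z i \<omega>)\<^sup>2))"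
proof (induction n)
  case (Suc n)
  let ?T = "\<lambda>\<omega>. stopped_sum a (\<lambda>i. Z i \<omega>) n"
  have rv: "random_variable borel (Z i)" if "i \<ge> 1" for i
    using ind that by (auto simp: indep_vars_def)
  have rT [measurable]: "random_variable borel ?T"
  proof -
    have "(\<lambda>\<omega>. stopped_sum a (\<lambda>i\<in>{1..n}. Z i \<omega>) n) \<in> borel_measurable M"
      by (rule measurable_compose[OF _ measurable_stopped_sum[OF order_refl]])
         (auto intro!: measurable_restrict rv)
    also have "(\<lambda>\<omega>. stopped_sum a (\<lambda>i\<in>{1..n}. Z i \<omega>) n) = ?T"
      by (intro ext stopped_sum_cong) auto
    finally show ?thesis .
  qed
  have rZ [measurable]: "random_variable borel (Z (Suc n))" by (rule rv) simp
  \<comment> \<open>The stopped sum while it is still running: bounded by a, hence integrable, and a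
    function of the first n variables. It is independent of the next summand, so the cross term of
    the square has mean 0.\<close>
  let ?G = "\<lambda>\<omega>. if \<bar>?T \<omega>\<bar> < a then ?T \<omega> else 0"
  let ?g = "\<lambda>z. if \<bar>stopped_sum a z n\<bar> < a then stopped_sum a z n else 0"
  have iG: "integrable M ?G"
    by (rule integrable_const_bound[of _ "\<bar>a\<bar>"]) auto
  have iZ: "integrable M (Z (Suc n))"
    by (rule square_integrable_imp_integrable) (use sq in auto)
  have [measurable]: "(\<lambda>z. stopped_sum a z n) \<in> borel_measurable (PiM {1..n} (\<lambda>_. borel))"
    by (rule measurable_stopped_sum) simp
  have "indep_var borel (?g \<circ> (\<lambda>\<omega>. \<lambda>i\<in>{1..n}. Z i \<omega>)) borel ((\<lambda>z. z (Suc n)) \<circ> (\<lambda>\<omega>. \<lambda>i\<in>{Suc n}. Z i \<omega>))"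
  proof (rule indep_var_compose[OF indep_var_restrict[OF ind]])
    show "?g \<in> borel_measurable (PiM {1..n} (\<lambda>_. borel))" by measurable
  qed auto
  moreover have "?g \<circ> (\<lambda>\<omega>. \<lambda>i\<in>{1..n}. Z i \<omega>) = ?G"
    using stopped_sum_cong[of n "\<lambda>i\<in>{1..n}. Z i _" "\<lambda>i. Z i _"] by (auto simp: fun_eq_iff)
  moreover have "(\<lambda>z. z (Suc n)) \<circ> (\<lambda>\<omega>. \<lambda>i\<in>{Suc n}. Z i \<omega>) = Z (Suc n)" by (auto simp: fun_eq_iff)
  ultimately have indGZ: "indep_var borel ?G borel (Z (Suc n))" by simp
  have iGZ: "integrable M (\<lambda>\<omega>. ?G \<omega> * Z (Suc n) \<omega>)"
    by (rule indep_var_integrable[OF indGZ iG iZ])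
  have eGZ: "expectation (\<lambda>\<omega>. ?G \<omega> * Z (Suc n) \<omega>) = 0"
    using indep_var_lebesgue_integral[OF indGZ iG iZ] mean[of "Suc n"] by simp
  let ?N = "\<lambda>\<omega>. if \<bar>?T \<omega>\<bar> < a then (Z (Suc n) \<omega>)\<^sup>2 else 0"
  have iN: "integrable M ?N"
    by (rule Bochner_Integration.integrable_bound[OF sq[of "Suc n"]]) auto
  have eN: "expectation ?N \<le> expectation (\<lambda>\<omega>. (Z (Suc n) \<omega>)\<^sup>2)"
    by (rule integral_mono[OF iN sq]) auto
  have eq: "(stopped_sum a (\<lambda>i. Z i \<omega>) (Suc n))\<^sup>2 = (?T \<omega>)\<^sup>2 + 2 * (?G \<omega> * Z (Suc n) \<omega>) + ?N \<omega>" for \<omega>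
    by (auto simp: power2_eq_square algebra_simps)
  note IH = Suc[THEN conjunct1] Suc[THEN conjunct2]
  show ?case unfolding eq using IH iGZ iN eGZ eN by auto
qed auto

text \<open>An exceedance at any k \<le> n is still visible in the stopped sum at time n, so
  Markov's inequality for its square suffices.\<close>

lemma kolmogorov_maximal_inequality:
  fixes Z :: "nat \<Rightarrow> 'a \<Rightarrow> real"
  assumes ind: "indep_vars (\<lambda>_. borel) Z {1..}"
    and sq: "\<And>i. i \<ge> 1 \<Longrightarrow> integrable M (\<lambda>\<omega>. (Z i \<omega>)\<^sup>2)"
    and mean: "\<And>i. i \<ge> 1 \<Longrightarrow> expectation (Z i) = 0"
    and a: "a > 0"
  shows "prob {\<omega>\<in>space M. \<exists>k\<le>n. a \<le> \<bar>\<Sum>i=1..k. Z i \<omega>\<bar>} \<le> (\<Sum>i=1..n. expectation (\<lambda>\<omega>. (Z i \<omega>)\<^sup>2)) / a\<^sup>2"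
proof -
  let ?T = "\<lambda>\<omega>. stopped_sum a (\<lambda>i. Z i \<omega>) n"
  note T = stopped_sum_second_moment[OF ind sq mean, of a n]
  have "{\<omega>\<in>space M. \<exists>k\<le>n. a \<le> \<bar>\<Sum>i=1..k. Z i \<omega>\<bar>} \<subseteq> {\<omega>\<in>space M. a\<^sup>2 \<le> (?T \<omega>)\<^sup>2}"
  proof safe
    fix \<omega> k assume "k \<le> n" "a \<le> \<bar>\<Sum>i=1..k. Z i \<omega>\<bar>"
    then have "a \<le> \<bar>?T \<omega>\<bar>" using stopped_sum_exceeds[OF a, of n "\<lambda>i. Z i \<omega>"] by (auto split: if_splits)
    then show "a\<^sup>2 \<le> (?T \<omega>)\<^sup>2" using a power_mono[of a "\<bar>?T \<omega>\<bar>" 2] by simp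
  qed
  then have "prob {\<omega>\<in>space M. \<exists>k\<le>n. a \<le> \<bar>\<Sum>i=1..k. Z i \<omega>\<bar>} \<le> prob {\<omega>\<in>space M. a\<^sup>2 \<le> (?T \<omega>)\<^sup>2}"
    by (rule finite_measure_mono) (use borel_measurable_integrable[OF T[THEN conjunct1]] in measurable)
  also have "\<dots> \<le> expectation (\<lambda>\<omega>. (?T \<omega>)\<^sup>2) / a\<^sup>2"
    by (rule integral_Markov_inequality_measure[where A = "{}"]) (use T a in auto)
  also have "\<dots> \<le> (\<Sum>i=1..n. expectation (\<lambda>\<omega>. (Z i \<omega>)\<^sup>2)) / a\<^sup>2"
    using T by (intro divide_right_mono) auto
  finally show ?thesis .
qed

end

lemma sum_power_tail_le:
  fixes r :: real assumes "0 < r" "r < 1"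
  shows "(\<Sum>n\<in>{n0..<N}. r ^ n) \<le> r ^ n0 / (1 - r)"
proof -
  have "(1 - r) * (\<Sum>n\<in>{n0..<N}. r ^ n) \<le> r ^ n0"
  proof (cases "n0 \<le> N")
    case True
    then obtain d where N: "N = n0 + d" by (auto simp: le_iff_add)
    have "(1 - r) * (\<Sum>n\<in>{n0..<n0 + d}. r ^ n) = r ^ n0 - r ^ (n0 + d)"
    proof (induction d)
      case (Suc d)
      have "(1 - r) * (\<Sum>n\<in>{n0..<n0 + Suc d}. r ^ n) =
          (1 - r) * (\<Sum>n\<in>{n0..<n0 + d}. r ^ n) + (1 - r) * r ^ (n0 + d)"
        by (simp add: distrib_left)
      also have "\<dots> = r ^ n0 - r ^ (n0 + Suc d)" unfolding Suc.IH by (simp add: left_diff_distrib)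
      finally show ?case .
    qed auto
    then have "(1 - r) * (\<Sum>n\<in>{n0..<N}. r ^ n) = r ^ n0 - r ^ N" by (simp only: N)
    then show ?thesis using assms by simp
  qed (use assms in auto)
  then show ?thesis using assms by (simp add: field_simps)
qed

lemma dyadic_bracket:
  assumes "k \<ge> (1::nat)" obtains n where "k \<le> 2 ^ n" "2 ^ n \<le> 2 * k"
proof -
  define n where "n = (LEAST n. k \<le> 2 ^ n)"
  have ex: "k \<le> 2 ^ k" by (rule less_imp_le) (rule less_exp)
  have 1: "k \<le> 2 ^ n" unfolding n_def by (rule LeastI[of _ k]) (rule ex)
  have "2 ^ n \<le> 2 * k"
  proof (cases n)
    case (Suc l)
    then have "\<not> k \<le> 2 ^ l" using not_less_Least[of l "\<lambda>n. k \<le> 2 ^ n"] by (simp add: n_def)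
    then show ?thesis using Suc by simp
  qed (use assms in auto)
  with 1 show ?thesis using that by blast
qed

text \<open>After exchanging the sums, V i collects a geometric tail of ratio r = 2^(-2\<epsilon>)
  from the least n with i \<le> 2^n on, which is at most i^(-2\<epsilon>) / (1 - r).\<close>

lemma dyadic_double_sum_summable:
  fixes V :: "nat \<Rightarrow> real"
  assumes V: "\<And>i. 0 \<le> V i" and e: "\<epsilon> > 0"
    and sm: "summable (\<lambda>i. V i / real i powr (2 * \<epsilon>))"
  shows "summable (\<lambda>n. (\<Sum>i=1..2^n. V i) / (2 ^ n) powr (2 * \<epsilon>))"
proof (rule summableI_nonneg_bounded)
  define r :: real where "r = 2 powr (- 2 * \<epsilon>)"
  have r: "0 < r" "r < 1" using e by (auto simp: r_def powr_less_one)
  have rn: "r ^ n = (2 ^ n) powr (- 2 * \<epsilon>)" for n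
  proof -
    have "r ^ n = 2 powr (real n * (- 2 * \<epsilon>))" by (simp add: r_def powr_power)
    also have "\<dots> = (2 powr real n) powr (- 2 * \<epsilon>)" by (simp only: powr_powr)
    finally show ?thesis by (simp add: powr_realpow)
  qed
  fix N
  show "0 \<le> (\<Sum>i=1..2^N. V i) / (2 ^ N) powr (2 * \<epsilon>)" using V by (auto intro!: divide_nonneg_nonneg sum_nonneg)
  have inner: "(\<Sum>n<N. if i \<le> 2 ^ n then r ^ n else 0) \<le> (1 / (1 - r)) * (1 / real i powr (2 * \<epsilon>))"
    if i: "i \<ge> 1" for i :: nat
  proof -
    obtain n0 where n0: "i \<le> 2 ^ n0" "2 ^ n0 \<le> 2 * i" using dyadic_bracket[OF i] .
    define n1 where "n1 = (LEAST n. i \<le> 2 ^ n)"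
    have n1: "i \<le> 2 ^ n1" unfolding n1_def using n0(1) by (rule LeastI)
    have "(\<Sum>n<N. if i \<le> 2 ^ n then r ^ n else 0) = (\<Sum>n\<in>{n\<in>{..<N}. i \<le> 2 ^ n}. r ^ n)"
      by (simp add: sum.If_cases Int_def)
    also have "\<dots> \<le> (\<Sum>n\<in>{n1..<N}. r ^ n)"
      using r by (intro sum_mono2) (auto simp: n1_def intro: Least_le)
    also have "\<dots> \<le> r ^ n1 / (1 - r)" by (rule sum_power_tail_le[OF r])
    also have "r ^ n1 \<le> real i powr (- 2 * \<epsilon>)"
    proof -
      have "real i \<le> 2 ^ n1" using n1 by (metis of_nat_le_iff of_nat_numeral of_nat_power)
      then show ?thesis unfolding rn using e i by (intro powr_mono2') auto
    qed
    also have "real i powr (- 2 * \<epsilon>) = 1 / real i powr (2 * \<epsilon>)" using powr_minus_divide[of "real i" "2 * \<epsilon>"] by simp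
    finally show ?thesis using r by (simp add: divide_right_mono mult.commute)
  qed
  have "(\<Sum>n<N. (\<Sum>i=1..2^n. V i) / (2 ^ n) powr (2 * \<epsilon>)) = (\<Sum>n<N. \<Sum>i=1..2^N. V i * (if i \<le> 2 ^ n then r ^ n else 0))"
  proof (rule sum.cong)
    fix n assume n: "n \<in> {..<N}"
    have "{1..2 ^ n} = {i\<in>{1..2 ^ N}. i \<le> (2::nat) ^ n}"
      using n power_increasing[of n N "2::nat"] by (auto intro: order_trans)
    then have "(\<Sum>i=1..2^n. V i) * r ^ n = (\<Sum>i\<in>{i\<in>{1..2 ^ N}. i \<le> 2 ^ n}. V i * r ^ n)"
      by (simp add: sum_distrib_right)
    also have "\<dots> = (\<Sum>i=1..2^N. V i * (if i \<le> 2 ^ n then r ^ n else 0))"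
      by (simp add: if_distrib[of "\<lambda>x. _ * x"] sum.If_cases Int_def cong: if_cong)
    finally show "(\<Sum>i=1..2^n. V i) / (2 ^ n) powr (2 * \<epsilon>) = \<dots>"
      using powr_minus_divide[of "2 ^ n" "2 * \<epsilon>"] by (simp add: rn)
  qed simp
  also have "\<dots> = (\<Sum>i=1..2^N. V i * (\<Sum>n<N. if i \<le> 2 ^ n then r ^ n else 0))"
    by (subst sum.swap) (simp add: sum_distrib_left)
  also have "\<dots> \<le> (\<Sum>i=1..2^N. V i * ((1 / (1 - r)) * (1 / real i powr (2 * \<epsilon>))))"
    using inner V by (intro sum_mono mult_left_mono) auto
  also have "\<dots> = (1 / (1 - r)) * (\<Sum>i=1..2^N. V i / real i powr (2 * \<epsilon>))"
    by (simp add: sum_distrib_left)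
  also have "\<dots> \<le> (1 / (1 - r)) * (\<Sum>i. V i / real i powr (2 * \<epsilon>))"
    using r V by (intro mult_left_mono sum_le_suminf[OF sm]) auto
  finally show "(\<Sum>n<N. (\<Sum>i=1..2^n. V i) / (2 ^ n) powr (2 * \<epsilon>)) \<le> (1 / (1 - r)) * (\<Sum>i. V i / real i powr (2 * \<epsilon>))" .
qed

text \<open>The maximal inequality up to the times 2^n together with Borel-Cantelli controls all
  partial sums by multiples of (2^n)^\<epsilon>; a time k with k \<le> 2^n \<le> 2k then loses only
  a factor 2^\<epsilon>.\<close>

lemma (in prob_space) kolmogorov_strong_law:
  fixes Z :: "nat \<Rightarrow> 'a \<Rightarrow> real"
  assumes ind: "indep_vars (\<lambda>_. borel) Z {1..}"
    and sq: "\<And>i. i \<ge> 1 \<Longrightarrow> integrable M (\<lambda>\<omega>. (Z i \<omega>)\<^sup>2)"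
    and mean: "\<And>i. i \<ge> 1 \<Longrightarrow> expectation (Z i) = 0"
    and e: "\<epsilon> > 0"
    and sm: "summable (\<lambda>i. expectation (\<lambda>\<omega>. (Z i \<omega>)\<^sup>2) / real i powr (2 * \<epsilon>))"
  shows "AE \<omega> in M. (\<lambda>k. (\<Sum>i=1..k. Z i \<omega>) / real k powr \<epsilon>) \<longlonglongrightarrow> 0"
proof -
  let ?V = "\<lambda>i. expectation (\<lambda>\<omega>. (Z i \<omega>)\<^sup>2)"
  have rv: "random_variable borel (Z i)" if "i \<ge> 1" for i
    using ind that by (auto simp: indep_vars_def)
  have rS [measurable]: "random_variable borel (\<lambda>\<omega>. \<Sum>i=1..k. Z i \<omega>)" for k
    by (intro borel_measurable_sum rv) auto
  have sm2: "summable (\<lambda>n. (\<Sum>i=1..2^n. ?V i) / (2 ^ n) powr (2 * \<epsilon>))"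
    by (rule dyadic_double_sum_summable[OF _ e sm]) auto
  \<comment> \<open>Thresholds 1/(p+1) rather than all positive reals keep the union of exceptional
    sets countable.\<close>
  have AE_p: "AE \<omega> in M. \<forall>\<^sub>F n in sequentially. \<forall>k\<le>2^n. \<bar>\<Sum>i=1..k. Z i \<omega>\<bar> < inverse (Suc p) * (2 ^ n) powr \<epsilon>" for p
  proof -
    define d :: real where "d = inverse (Suc p)"
    have d: "d > 0" by (simp add: d_def)
    let ?A = "\<lambda>n. {\<omega>\<in>space M. \<exists>k\<le>2^n. d * (2 ^ n) powr \<epsilon> \<le> \<bar>\<Sum>i=1..k. Z i \<omega>\<bar>}"
    have A: "?A n \<in> events" for n by measurable
    have bd: "prob (?A n) \<le> (1 / d\<^sup>2) * ((\<Sum>i=1..2^n. ?V i) / (2 ^ n) powr (2 * \<epsilon>))" for n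
    proof -
      have "(d * (2 ^ n) powr \<epsilon>)\<^sup>2 = d\<^sup>2 * (2 ^ n) powr (2 * \<epsilon>)"
        by (simp add: power_mult_distrib powr_power mult.commute)
      then show ?thesis
        using kolmogorov_maximal_inequality[OF ind sq mean, of "d * (2 ^ n) powr \<epsilon>" "2 ^ n"] d by simp
    qed
    have "summable (\<lambda>n. prob (?A n))"
      by (rule summable_comparison_test'[OF summable_mult[OF sm2, of "1 / d\<^sup>2"], of 0]) (use bd in auto)
    then have "AE \<omega> in M. \<forall>\<^sub>F n in sequentially. \<omega> \<in> space M - ?A n"
      by (intro borel_cantelli_AE1 A) (simp_all add: less_top[symmetric])
    then show ?thesis
    proof eventually_elim
      case (elim \<omega>)
      then show ?case by (rule eventually_mono) (force simp: d_def not_le)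
    qed
  qed
  then have "AE \<omega> in M. \<forall>p. \<forall>\<^sub>F n in sequentially. \<forall>k\<le>2^n. \<bar>\<Sum>i=1..k. Z i \<omega>\<bar> < inverse (Suc p) * (2 ^ n) powr \<epsilon>"
    by (simp add: AE_all_countable)
  then show ?thesis
  proof eventually_elim
    case (elim \<omega>)
    let ?S = "\<lambda>k. \<Sum>i=1..k. Z i \<omega>"
    show ?case
    proof (rule LIMSEQ_I)
      fix r :: real assume r: "r > 0"
      \<comment> \<open>The divisor 2^\<epsilon> pays for passing from 2^n to 2k.\<close>
      then obtain p where p: "inverse (Suc p) < r / 2 powr \<epsilon>"
        using reals_Archimedean[of "r / 2 powr \<epsilon>"] by (auto simp: powr_gt_zero)
      obtain n0 where n0: "\<And>n k. n \<ge> n0 \<Longrightarrow> k \<le> 2 ^ n \<Longrightarrow> \<bar>?S k\<bar> < inverse (Suc p) * (2 ^ n) powr \<epsilon>"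
        using elim[rule_format, of p] by (auto simp: eventually_sequentially)
      have "norm (?S k / real k powr \<epsilon> - 0) < r" if k: "k \<ge> Suc (2 ^ n0)" for k
      proof -
        have k1: "k \<ge> 1" using k by simp
        obtain n where n: "k \<le> 2 ^ n" "2 ^ n \<le> 2 * k" using dyadic_bracket[OF k1] .
        have "n \<ge> n0"
        proof (rule ccontr)
          assume "\<not> n \<ge> n0"
          then have "(2::nat) ^ n \<le> 2 ^ n0" by (intro power_increasing) auto
          then show False using n k by linarith
        qed
        then have "\<bar>?S k\<bar> < inverse (Suc p) * (2 ^ n) powr \<epsilon>" using n0 n by blast
        also have "(2 ^ n) powr \<epsilon> \<le> (2 * real k) powr \<epsilon>"
          using n(2) e by (intro powr_mono2) (auto simp flip: of_nat_le_iff[where 'a = real])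
        also have "(2 * real k) powr \<epsilon> = 2 powr \<epsilon> * real k powr \<epsilon>" by (simp add: powr_mult)
        also have "inverse (Suc p) * (2 powr \<epsilon> * real k powr \<epsilon>) \<le> r / 2 powr \<epsilon> * (2 powr \<epsilon> * real k powr \<epsilon>)"
          using p by (intro mult_right_mono) auto
        finally have "\<bar>?S k\<bar> < r * real k powr \<epsilon>" by simp
        then show ?thesis using k1 by (simp add: divide_simps)
      qed
      then show "\<exists>no. \<forall>k\<ge>no. norm (?S k / real k powr \<epsilon> - 0) < r" by blast
    qed
  qed
qed

lemma cesaro_null:
  fixes d :: "nat \<Rightarrow> real" assumes "d \<longlonglongrightarrow> 0"
  shows "(\<lambda>k. (\<Sum>i=1..k. d i) / real k) \<longlonglongrightarrow> 0"
proof (rule LIMSEQ_I)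
  fix r :: real assume r: "r > 0"
  obtain N where N: "\<And>i. i \<ge> N \<Longrightarrow> \<bar>d i\<bar> < r / 2"
    using LIMSEQ_D[OF assms, of "r / 2"] r by auto
  define C where "C = (\<Sum>i=1..N. \<bar>d i\<bar>)"
  obtain N2 where N2: "2 * C / r < real N2" using reals_Archimedean2 by blast
  have "norm ((\<Sum>i=1..k. d i) / real k - 0) < r" if k: "k \<ge> Suc (max N N2)" for k
  proof -
    have "\<bar>\<Sum>i=1..k. d i\<bar> \<le> (\<Sum>i=1..k. \<bar>d i\<bar>)" by (rule sum_abs)
    also have "\<dots> = C + (\<Sum>i=N+1..k. \<bar>d i\<bar>)" unfolding C_def using k
      by (subst sum.union_disjoint[symmetric]) (auto intro!: sum.cong)
    also have "(\<Sum>i=N+1..k. \<bar>d i\<bar>) \<le> (\<Sum>i=N+1..k. r / 2)" using N by (intro sum_mono less_imp_le) auto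
    also have "\<dots> \<le> real k * (r / 2)" using r by (auto intro!: mult_right_mono)
    also have "C < r / 2 * real N2" using N2 r by (simp add: field_simps)
    also have "r / 2 * real N2 \<le> r / 2 * real k" using k r by (intro mult_left_mono) auto
    finally have "\<bar>\<Sum>i=1..k. d i\<bar> < r * real k" by (simp add: algebra_simps)
    then show ?thesis using k by (simp add: divide_simps)
  qed
  then show "\<exists>no. \<forall>k\<ge>no. norm ((\<Sum>i=1..k. d i) / real k - 0) < r" by blast
qed


text \<open>Integrated over the law, this bounds the sum of the probabilities of exceeding i by the
  first absolute moment, as Borel-Cantelli requires.\<close>

lemma abs_tail_count_le: "(\<Sum>i=1..N. if real i < y then 1 else 0) \<le> max 0 y" for y :: real
proof -
  have "{i\<in>{1..N}. real i < y} \<subseteq> {1..nat \<lfloor>y\<rfloor>}" by (auto simp: le_nat_iff le_floor_iff)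
  then have "card {i\<in>{1..N}. real i < y} \<le> nat \<lfloor>y\<rfloor>" using card_mono[of "{1..nat \<lfloor>y\<rfloor>}"] by fastforce
  then have "real (card {i\<in>{1..N}. real i < y}) \<le> max 0 y" by linarith
  then show ?thesis by (simp add: sum.If_cases Int_def)
qed

text \<open>The induction carries the sharper bound 2/n0 - 1/N, since 1/(N+1)^2 \<le> 1/N -
  1/(N+1).\<close>

lemma sum_inverse_squares_tail_le:
  assumes "n0 \<ge> (1::nat)" shows "(\<Sum>i=n0..N. 1 / (real i)\<^sup>2) \<le> 2 / real n0"
proof (cases "n0 \<le> N")
  case True
  then have "(\<Sum>i=n0..N. 1 / (real i)\<^sup>2) \<le> 2 / real n0 - 1 / real N"
  proof (induction N rule: nat_induct_at_least)
    case base
    have "1 / (real n0)\<^sup>2 \<le> 1 / real n0" using assms by (simp add: field_simps power2_eq_square)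
    then show ?case by simp
  next
    case (Suc N)
    have "1 / (real (Suc N))\<^sup>2 \<le> 1 / (real N * real (Suc N))"
      unfolding power2_eq_square using assms Suc(1)
      by (intro divide_left_mono mult_right_mono) auto
    also have "\<dots> = 1 / real N - 1 / real (Suc N)"
      using assms Suc(1) by (simp add: field_simps)
    finally have "1 / (real (Suc N))\<^sup>2 \<le> 1 / real N - 1 / real (Suc N)" .
    then show ?case using Suc by simp
  qed
  moreover have "0 \<le> 1 / real N" by simp
  ultimately show ?thesis by linarith
qed auto

text \<open>Pointwise version of the variance estimate for truncated variables: only i \<ge> |x|
  contribute, and the tail of the inverse squares is of order 1/|x|.\<close>

lemma truncated_square_sum_le:
  "(\<Sum>i=1..N. (if \<bar>x\<bar> \<le> real i then x\<^sup>2 else 0) / (real i)\<^sup>2) \<le> 2 * \<bar>x\<bar>" for x :: real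
proof -
  \<comment> \<open>The maximum with 1 keeps the tail away from index 0 when x = 0.\<close>
  define n0 where "n0 = max 1 (nat \<lceil>\<bar>x\<bar>\<rceil>)"
  have n0: "n0 \<ge> 1" "\<bar>x\<bar> \<le> real n0" unfolding n0_def by (simp, linarith)
  have "(\<Sum>i=1..N. (if \<bar>x\<bar> \<le> real i then x\<^sup>2 else 0) / (real i)\<^sup>2)
      = (\<Sum>i=1..N. if \<bar>x\<bar> \<le> real i then x\<^sup>2 / (real i)\<^sup>2 else 0)"
    by (intro sum.cong) auto
  also have "\<dots> = (\<Sum>i\<in>{i\<in>{1..N}. \<bar>x\<bar> \<le> real i}. x\<^sup>2 / (real i)\<^sup>2)"
    by (simp add: sum.If_cases Int_def)
  also have "\<dots> \<le> (\<Sum>i=n0..N. x\<^sup>2 / (real i)\<^sup>2)"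
    by (intro sum_mono2) (auto simp: n0_def ceiling_le_iff nat_le_iff)
  also have "\<dots> = x\<^sup>2 * (\<Sum>i=n0..N. 1 / (real i)\<^sup>2)" by (simp add: sum_distrib_left)
  also have "\<dots> \<le> x\<^sup>2 * (2 / real n0)"
    by (intro mult_left_mono sum_inverse_squares_tail_le n0) auto
  also have "\<dots> \<le> 2 * \<bar>x\<bar>"
  proof -
    have "\<bar>x\<bar> * \<bar>x\<bar> \<le> \<bar>x\<bar> * real n0" using n0 by (intro mult_left_mono) auto
    then show ?thesis using n0 by (simp add: field_simps power2_eq_square)
  qed
  finally show ?thesis .
qed

context prob_space
begin

text \<open>The centred summands have constant variance, and 2\<epsilon> > 1 is the condition for
  the series of i^(-2\<epsilon>) to converge.\<close>

lemma strong_law_square_integrable: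
  fixes \<xi> :: "nat \<Rightarrow> 'a \<Rightarrow> real"
  assumes ind: "indep_vars (\<lambda>_. borel) \<xi> {1..}"
    and law: "\<And>i. i \<ge> 1 \<Longrightarrow> distr M borel (\<xi> i) = D"
    and sq: "integrable D (\<lambda>x. x\<^sup>2)" and e: "\<epsilon> > 1 / 2"
  shows "AE \<omega> in M. (\<lambda>k. (\<Sum>i=1..k. \<xi> i \<omega>) / real k powr \<epsilon> - real k * (\<integral>x. x \<partial>D) / real k powr \<epsilon>) \<longlonglongrightarrow> 0"
proof -
  have rv: "random_variable borel (\<xi> i)" if "i \<ge> 1" for i
    using ind that by (auto simp: indep_vars_def)
  define m where "m = (\<integral>x. x \<partial>D)"
  have tr: "integrable M (\<lambda>\<omega>. f (\<xi> i \<omega>)) \<longleftrightarrow> integrable D f"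
    "expectation (\<lambda>\<omega>. f (\<xi> i \<omega>)) = (\<integral>x. f x \<partial>D)"
    if "i \<ge> 1" "f \<in> borel_measurable borel" for i and f :: "real \<Rightarrow> real"
    using rv[OF that(1)] that by (auto simp flip: law[OF that(1)] simp: integrable_distr_eq integral_distr)
  have int1: "integrable M (\<xi> i)" if "i \<ge> 1" for i
    by (rule square_integrable_imp_integrable) (use rv[OF that] tr(1)[OF that, of "\<lambda>x. x\<^sup>2"] sq in auto)
  have e1: "expectation (\<xi> i) = m" if "i \<ge> 1" for i
    using tr(2)[OF that, of "\<lambda>x. x"] by (simp add: m_def)
  define Z where "Z i \<omega> = \<xi> i \<omega> - m" for i \<omega>
  have "integrable D (\<lambda>x. (x - m)\<^sup>2)"
  proof -
    have "integrable M (\<lambda>\<omega>. (\<xi> 1 \<omega>)\<^sup>2 - 2 * m * \<xi> 1 \<omega> + m\<^sup>2)"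
      using tr(1)[of 1 "\<lambda>x. x\<^sup>2"] sq int1[of 1] by auto
    then have "integrable M (\<lambda>\<omega>. (\<xi> 1 \<omega> - m)\<^sup>2)" by (simp add: power2_diff algebra_simps)
    then show ?thesis using tr(1)[of 1 "\<lambda>x. (x - m)\<^sup>2"] by simp
  qed
  then have sqZ: "integrable M (\<lambda>\<omega>. (Z i \<omega>)\<^sup>2)" if "i \<ge> 1" for i
    using tr(1)[OF that, of "\<lambda>x. (x - m)\<^sup>2"] by (simp add: Z_def)
  have VZ: "expectation (\<lambda>\<omega>. (Z i \<omega>)\<^sup>2) = (\<integral>x. (x - m)\<^sup>2 \<partial>D)" if "i \<ge> 1" for i
    using tr(2)[OF that, of "\<lambda>x. (x - m)\<^sup>2"] by (simp add: Z_def)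
  have "AE \<omega> in M. (\<lambda>k. (\<Sum>i=1..k. Z i \<omega>) / real k powr \<epsilon>) \<longlonglongrightarrow> 0"
  proof (rule kolmogorov_strong_law[OF _ sqZ])
    show "indep_vars (\<lambda>_. borel) Z {1..}"
      using indep_vars_compose2[OF ind, of "\<lambda>_ x. x - m" "\<lambda>_. borel"] by (simp add: Z_def[abs_def])
    show "expectation (Z i) = 0" if "i \<ge> 1" for i
      using int1[OF that] e1[OF that] by (simp add: Z_def[abs_def] prob_space)
    have "summable (\<lambda>i. (\<integral>x. (x - m)\<^sup>2 \<partial>D) * real i powr (- (2 * \<epsilon>)))"
      using e by (intro summable_mult) (simp add: summable_real_powr_iff)
    then show "summable (\<lambda>i. expectation (\<lambda>\<omega>. (Z i \<omega>)\<^sup>2) / real i powr (2 * \<epsilon>))"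
      by (rule summable_cong[THEN iffD1, rotated])
         (auto simp: eventually_sequentially VZ powr_minus_divide intro!: exI[of _ 1])
  qed (use e in auto)
  then show ?thesis by (simp add: Z_def sum_subtractf m_def diff_divide_distrib)
qed

text \<open>Kolmogorov's truncation: cut the i-th summand at level i, apply the preceding strong law
  with exponent 1 to the centred truncations, and show that the truncation error and the shift of
  the means vanish on average.\<close>

lemma strong_law_integrable:
  fixes \<xi> :: "nat \<Rightarrow> 'a \<Rightarrow> real"
  assumes ind: "indep_vars (\<lambda>_. borel) \<xi> {1..}"
    and law: "\<And>i. i \<ge> 1 \<Longrightarrow> distr M borel (\<xi> i) = D"
    and int: "integrable D (\<lambda>x. x)"
  shows "AE \<omega> in M. (\<lambda>k. (\<Sum>i=1..k. \<xi> i \<omega>) / real k - (\<integral>x. x \<partial>D)) \<longlonglongrightarrow> 0"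
proof -
  have rv: "random_variable borel (\<xi> i)" if "i \<ge> 1" for i
    using ind that by (auto simp: indep_vars_def)
  have sD [measurable_cong]: "sets D = sets borel" using law[of 1] by auto
  interpret D: prob_space D using law[of 1] prob_space_distr[OF rv, of 1] by simp
  define m where "m = (\<integral>x. x \<partial>D)"
  have tr: "integrable M (\<lambda>\<omega>. f (\<xi> i \<omega>)) \<longleftrightarrow> integrable D f"
    "expectation (\<lambda>\<omega>. f (\<xi> i \<omega>)) = (\<integral>x. f x \<partial>D)"
    if "i \<ge> 1" "f \<in> borel_measurable borel" for i and f :: "real \<Rightarrow> real"
    using rv[OF that(1)] that by (auto simp flip: law[OF that(1)] simp: integrable_distr_eq integral_distr)
  define t where "t i x = (if \<bar>x\<bar> \<le> real i then x else 0)" for i and x :: real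
  have [measurable]: "t i \<in> borel_measurable borel" for i unfolding t_def by measurable
  have t_bd: "\<bar>t i x\<bar> \<le> real i" "\<bar>t i x\<bar> \<le> \<bar>x\<bar>" for i x by (auto simp: t_def)
  have intt: "integrable D (t i)" for i
    by (rule D.integrable_const_bound[of _ "real i"]) (use t_bd in auto)
  have t2: "(t i x)\<^sup>2 \<le> (real i)\<^sup>2" for i x using t_bd(1)[of i x] power_mono[of "\<bar>t i x\<bar>" "real i" 2] by simp
  have intt2: "integrable D (\<lambda>x. (t i x)\<^sup>2)" for i
    by (rule D.integrable_const_bound[of _ "(real i)\<^sup>2"]) (use t2 in auto)
  define m' where "m' i = (\<integral>x. t i x \<partial>D)" for i
  define Z where "Z i \<omega> = t i (\<xi> i \<omega>) - m' i" for i \<omega>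
  have eqZ: "(\<lambda>x. (t i x - m' i)\<^sup>2) = (\<lambda>x. (t i x)\<^sup>2 - 2 * m' i * t i x + (m' i)\<^sup>2)" for i
    by (auto simp: power2_diff algebra_simps)
  have iZ: "integrable D (\<lambda>x. (t i x - m' i)\<^sup>2)" for i
    unfolding eqZ using intt intt2 by auto
  have VD: "(\<integral>x. (t i x - m' i)\<^sup>2 \<partial>D) \<le> (\<integral>x. (t i x)\<^sup>2 \<partial>D)" for i
    unfolding eqZ using intt[of i] intt2[of i]
    by (simp add: D.prob_space power2_eq_square flip: m'_def)
  have sqZ: "integrable M (\<lambda>\<omega>. (Z i \<omega>)\<^sup>2)" and VZ: "expectation (\<lambda>\<omega>. (Z i \<omega>)\<^sup>2) \<le> (\<integral>x. (t i x)\<^sup>2 \<partial>D)" if "i \<ge> 1" for i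
    using tr[OF that, of "\<lambda>x. (t i x - m' i)\<^sup>2"] VD[of i] iZ[of i] by (simp_all add: Z_def)
  \<comment> \<open>Integrating \<open>truncated_square_sum_le\<close> bounds every partial sum by
    twice the first absolute moment; the term with i = 0 is 0 by division by zero.\<close>
  have sumV: "summable (\<lambda>i. (\<integral>x. (t i x)\<^sup>2 \<partial>D) / (real i)\<^sup>2)"
  proof (rule summableI_nonneg_bounded)
    fix N
    have "(\<Sum>i<N. (\<integral>x. (t i x)\<^sup>2 \<partial>D) / (real i)\<^sup>2)
        \<le> (\<Sum>i\<in>insert 0 {1..N}. (\<integral>x. (t i x)\<^sup>2 \<partial>D) / (real i)\<^sup>2)"
      by (rule sum_mono2) auto
    also have "\<dots> = (\<Sum>i=1..N. (\<integral>x. (t i x)\<^sup>2 \<partial>D) / (real i)\<^sup>2)" by simp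
    also have "\<dots> = (\<integral>x. (\<Sum>i=1..N. (t i x)\<^sup>2 / (real i)\<^sup>2) \<partial>D)"
      using intt2 by simp
    also have "\<dots> \<le> (\<integral>x. 2 * \<bar>x\<bar> \<partial>D)"
    proof (rule integral_mono)
      show "(\<Sum>i=1..N. (t i x)\<^sup>2 / (real i)\<^sup>2) \<le> 2 * \<bar>x\<bar>" for x
        using truncated_square_sum_le[of x N] by (simp add: t_def if_distrib[of "\<lambda>x. x\<^sup>2"] cong: if_cong)
    qed (use int intt2 in auto)
    finally show "(\<Sum>i<N. (\<integral>x. (t i x)\<^sup>2 \<partial>D) / (real i)\<^sup>2) \<le> (\<integral>x. 2 * \<bar>x\<bar> \<partial>D)" .
  qed auto
  have main: "AE \<omega> in M. (\<lambda>k. (\<Sum>i=1..k. Z i \<omega>) / real k powr 1) \<longlonglongrightarrow> 0"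
  proof (rule kolmogorov_strong_law[OF _ sqZ])
    show "indep_vars (\<lambda>_. borel) Z {1..}"
      using indep_vars_compose2[OF ind, of "\<lambda>i x. t i x - m' i" "\<lambda>_. borel"] by (simp add: Z_def[abs_def])
    show "expectation (Z i) = 0" if "i \<ge> 1" for i
      using tr[OF that, of "t i"] intt[of i] by (simp add: Z_def[abs_def] prob_space m'_def)
    show "summable (\<lambda>i. expectation (\<lambda>\<omega>. (Z i \<omega>)\<^sup>2) / real i powr (2 * 1))"
      by (rule summable_comparison_test'[OF sumV, of 1])
         (auto intro!: divide_right_mono VZ simp: powr_numeral)
  qed auto
  \<comment> \<open>The events on which truncation takes effect. The guard i \<ge> 1 makes B 0
    empty, since nothing is assumed about \<xi> 0, not even measurability.\<close>
  define B where "B i = {\<omega>\<in>space M. i \<ge> 1 \<and> real i < \<bar>\<xi> i \<omega>\<bar>}" for i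
  have sumB: "summable (\<lambda>i. prob (B i))"
    unfolding B_def
  proof (rule summableI_nonneg_bounded)
    fix N
    have 1: "prob {\<omega>\<in>space M. i \<ge> 1 \<and> real i < \<bar>\<xi> i \<omega>\<bar>} = (\<integral>x. (if real i < \<bar>x\<bar> then 1 else 0) \<partial>D)"
      if i: "i \<ge> 1" for i
    proof -
      have [measurable]: "random_variable borel (\<xi> i)" by (rule rv[OF i])
      have "prob {\<omega>\<in>space M. i \<ge> 1 \<and> real i < \<bar>\<xi> i \<omega>\<bar>} =
          expectation (indicator {\<omega>\<in>space M. real i < \<bar>\<xi> i \<omega>\<bar>})" using i by simp
      also have "\<dots> = expectation (\<lambda>\<omega>. if real i < \<bar>\<xi> i \<omega>\<bar> then 1 else 0)"
        by (intro Bochner_Integration.integral_cong) (auto simp: indicator_def)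
      finally show ?thesis using tr(2)[OF i, of "\<lambda>x. if real i < \<bar>x\<bar> then 1 else 0"] by simp
    qed
    have ii: "integrable D (\<lambda>x. if real i < \<bar>x\<bar> then 1 else 0 :: real)" for i
      by (rule D.integrable_const_bound[of _ 1]) auto
    have "(\<Sum>i<N. prob {\<omega>\<in>space M. i \<ge> 1 \<and> real i < \<bar>\<xi> i \<omega>\<bar>})
        \<le> (\<Sum>i\<in>insert 0 {1..N}. prob {\<omega>\<in>space M. i \<ge> 1 \<and> real i < \<bar>\<xi> i \<omega>\<bar>})"
      by (rule sum_mono2) auto
    also have "\<dots> = (\<Sum>i=1..N. \<integral>x. (if real i < \<bar>x\<bar> then 1 else 0) \<partial>D)" using 1 by simp
    also have "\<dots> = (\<integral>x. (\<Sum>i=1..N. if real i < \<bar>x\<bar> then 1 else 0) \<partial>D)"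
      using ii by simp
    also have "\<dots> \<le> (\<integral>x. \<bar>x\<bar> \<partial>D)"
    proof (rule integral_mono)
      show "(\<Sum>i=1..N. if real i < \<bar>x\<bar> then 1 else 0) \<le> \<bar>x\<bar>" for x
        using abs_tail_count_le[where N = N and y = "\<bar>x\<bar>"] by simp
    qed (use int ii in auto)
    finally show "(\<Sum>i<N. prob {\<omega>\<in>space M. i \<ge> 1 \<and> real i < \<bar>\<xi> i \<omega>\<bar>}) \<le> (\<integral>x. \<bar>x\<bar> \<partial>D)" .
  qed auto
  have "B i \<in> events" for i
    unfolding B_def using rv[of i] by (cases "i \<ge> 1") auto
  from borel_cantelli_AE1[OF this _ sumB]
  have trunc: "AE \<omega> in M. \<forall>\<^sub>F i in sequentially. \<omega> \<in> space M - B i"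
    by (simp add: less_top[symmetric])
  have m'_lim: "m' \<longlonglongrightarrow> m"
    unfolding m'_def m_def
  proof (rule integral_dominated_convergence[where w = "\<lambda>x. \<bar>x\<bar>"])
    show "AE x in D. (\<lambda>i. t i x) \<longlonglongrightarrow> x"
    proof (rule AE_I2)
      fix x :: real
      obtain N where N: "\<bar>x\<bar> \<le> real N" using real_arch_simple by blast
      then have "\<forall>\<^sub>F i in sequentially. t i x = x"
        by (auto simp: eventually_sequentially t_def intro!: exI[of _ N])
      then show "(\<lambda>i. t i x) \<longlonglongrightarrow> x" by (rule tendsto_eventually)
    qed
    show "AE x in D. norm (t i x) \<le> \<bar>x\<bar>" for i by (simp add: t_bd)
    show "integrable D abs" using int by (rule integrable_abs)
    show "(\<lambda>x. x) \<in> borel_measurable D" "t i \<in> borel_measurable D" for i by measurable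
  qed
  show ?thesis using main trunc
  proof eventually_elim
    case (elim \<omega>)
    have "\<forall>\<^sub>F i in sequentially. \<xi> i \<omega> - t i (\<xi> i \<omega>) = 0"
      using elim(2) eventually_ge_at_top[of 1] by eventually_elim (auto simp: t_def B_def)
    then have "(\<lambda>i. \<xi> i \<omega> - t i (\<xi> i \<omega>)) \<longlonglongrightarrow> 0" by (rule tendsto_eventually)
    then have "(\<lambda>i. \<xi> i \<omega> - t i (\<xi> i \<omega>) + (m' i - m)) \<longlonglongrightarrow> 0 + (m - m)"
      by (intro tendsto_intros m'_lim)
    then have "(\<lambda>i. \<xi> i \<omega> - m - Z i \<omega>) \<longlonglongrightarrow> 0" by (simp add: Z_def algebra_simps)
    from tendsto_add[OF cesaro_null[OF this] elim(1)]
    have "(\<lambda>k. (\<Sum>i=1..k. \<xi> i \<omega> - m - Z i \<omega>) / real k + (\<Sum>i=1..k. Z i \<omega>) / real k powr 1) \<longlonglongrightarrow> 0" by simp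
    then show ?case
    proof (rule Lim_transform_eventually)
      show "\<forall>\<^sub>F k in sequentially. (\<Sum>i=1..k. \<xi> i \<omega> - m - Z i \<omega>) / real k + (\<Sum>i=1..k. Z i \<omega>) / real k powr 1
          = (\<Sum>i=1..k. \<xi> i \<omega>) / real k - (\<integral>x. x \<partial>D)"
        using eventually_ge_at_top[of 1]
        by eventually_elim (simp add: sum_subtractf m_def diff_divide_distrib)
    qed
  qed
qed

end

subsection \<open>Increments of a walk with state-independent step law\<close>

text \<open>The state before step n + 1 is a function of the first n variables, and given any state
  in \<Gamma> the increment has law D; hence it is independent of the past. States outside \<Gamma>
  may behave differently but have probability 0.\<close>

lemma (in prob_space) state_increments:
  fixes X :: "nat \<Rightarrow> 'a \<Rightarrow> 'b" and H :: "nat \<Rightarrow> 'a \<Rightarrow> 'c" and G :: "'c \<Rightarrow> 'b \<Rightarrow> real"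
  assumes ind: "indep_vars (\<lambda>_. N) X {1..}"
    and law: "\<And>k. k \<ge> 1 \<Longrightarrow> distr M N (X k) = \<nu>"
    and Fm: "(\<lambda>(h, x). F h x) \<in> measurable (L \<Otimes>\<^sub>M N) L"
    and Gm: "(\<lambda>(h, x). G h x) \<in> borel_measurable (L \<Otimes>\<^sub>M N)"
    and H0: "\<And>\<omega>. H 0 \<omega> = h0" "h0 \<in> space L"
    and HS: "\<And>k \<omega>. H (Suc k) \<omega> = F (H k \<omega>) (X (Suc k) \<omega>)"
    and \<Gamma>: "\<Gamma> \<in> sets L" "\<And>k. AE \<omega> in M. H k \<omega> \<in> \<Gamma>"
    and D: "\<And>h. h \<in> \<Gamma> \<Longrightarrow> distr \<nu> borel (G h) = D"
  shows "indep_vars (\<lambda>_. borel) (\<lambda>k \<omega>. G (H (k - 1) \<omega>) (X k \<omega>)) {1..}"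
    and "\<And>k. k \<ge> 1 \<Longrightarrow> distr M borel (\<lambda>\<omega>. G (H (k - 1) \<omega>) (X k \<omega>)) = D"
proof -
  note One_nat_def [simp del]
  define \<xi> where "\<xi> k \<omega> = G (H (k - 1) \<omega>) (X k \<omega>)" for k \<omega>
  \<comment> \<open>The state as a function of the sequence of inputs, so that it can be evaluated
    on a finite product space.\<close>
  define hh where "hh k x = rec_nat h0 (\<lambda>k h. F h (x (Suc k))) k" for k and x :: "nat \<Rightarrow> 'b"
  have hh_simps: "hh 0 x = h0" "hh (Suc k) x = F (hh k x) (x (Suc k))" for k x
    by (simp_all add: hh_def)
  have hh_cong: "hh k x = hh k y" if "\<And>i. 1 \<le> i \<Longrightarrow> i \<le> k \<Longrightarrow> x i = y i" for k x y
    using that by (induction k) (auto simp: hh_simps)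
  have H_eq: "H k \<omega> = hh k (\<lambda>i. X i \<omega>)" for k \<omega>
    by (induction k) (auto simp: hh_simps H0 HS)
  have H_restrict: "H k \<omega> = hh k (\<lambda>i\<in>{1..n}. X i \<omega>)" if "k \<le> n" for k n \<omega>
    unfolding H_eq using that by (intro hh_cong) auto
  let ?P = "\<lambda>n. PiM {1..n} (\<lambda>_. N)"
  let ?R = "\<lambda>n \<omega>. \<lambda>i\<in>{1..n}. X i \<omega>"
  have rv: "random_variable N (X k)" if "k \<ge> 1" for k using ind that by (auto simp: indep_vars_def)
  have rR: "?R n \<in> measurable M (?P n)" for n
    by (rule measurable_restrict) (auto intro: rv)
  have hh_m: "hh k \<in> measurable (?P n) L" if "k \<le> n" for k n
    using that
  proof (induction k)
    case 0 then show ?case using H0(2) by (simp add: hh_simps(1)[abs_def])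
  next
    case (Suc k)
    have "(\<lambda>x. (hh k x, x (Suc k))) \<in> measurable (?P n) (L \<Otimes>\<^sub>M N)"
      using Suc by (intro measurable_Pair measurable_component_singleton) auto
    from measurable_compose[OF this Fm] show ?case by (simp add: hh_simps(2)[abs_def])
  qed
  have Gh_m: "G h \<in> borel_measurable N" if "h \<in> space L" for h
    using measurable_compose[OF measurable_Pair1'[OF that] Gm] by simp
  have hhG_m: "(\<lambda>(y, x). G (hh n y) x) \<in> borel_measurable (?P n \<Otimes>\<^sub>M N)" for n
  proof -
    have "(\<lambda>z. (hh n (fst z), snd z)) \<in> measurable (?P n \<Otimes>\<^sub>M N) (L \<Otimes>\<^sub>M N)"
      by (intro measurable_Pair measurable_compose[OF measurable_fst hh_m] measurable_snd) simp
    from measurable_compose[OF this Gm] show ?thesis by (simp add: case_prod_beta)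
  qed
  have \<xi>_step: "\<xi> (Suc n) \<omega> = G (hh n (?R n \<omega>)) (X (Suc n) \<omega>)" for n \<omega>
    unfolding \<xi>_def using H_restrict[of n n \<omega>] by simp
  have r\<xi>: "random_variable borel (\<xi> k)" if k: "k \<ge> 1" for k
  proof -
    obtain n where n: "k = Suc n" using k by (cases k) auto
    have "(\<lambda>\<omega>. (?R n \<omega>, X (Suc n) \<omega>)) \<in> measurable M (?P n \<Otimes>\<^sub>M N)"
      by (intro measurable_Pair rR rv) simp
    from measurable_compose[OF this hhG_m] show ?thesis
      unfolding n by (simp add: \<xi>_step[abs_def])
  qed
  \<comment> \<open>The Markov step: the next increment is independent of the whole vector of
    earlier inputs. It is Fubini over the past and the next input, the latter kept as a one-point
    family because independence of index blocks delivers it in that shape.\<close>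
  have key: "emeasure M {\<omega>\<in>space M. ?R n \<omega> \<in> E \<and> \<xi> (Suc n) \<omega> \<in> A} =
      emeasure D A * emeasure M {\<omega>\<in>space M. ?R n \<omega> \<in> E}"
    if E: "E \<in> sets (?P n)" and A: "A \<in> sets borel" for n E A
  proof -
    let ?\<mu> = "distr M (?P n) (?R n)"
    let ?N = "PiM {Suc n} (\<lambda>_. N)" and ?X = "\<lambda>\<omega>. \<lambda>i\<in>{Suc n}. X i \<omega>"
    let ?\<nu> = "distr M ?N ?X"
    have rX: "?X \<in> measurable M ?N" by (rule measurable_restrict) (auto intro: rv)
    interpret \<nu>': prob_space ?\<nu> by (rule prob_space_distr[OF rX])
    have "indep_var (?P n) (?R n) ?N ?X" by (rule indep_var_restrict[OF ind]) auto
    then have joint: "distr M (?P n \<Otimes>\<^sub>M ?N) (\<lambda>\<omega>. (?R n \<omega>, ?X \<omega>)) = ?\<mu> \<Otimes>\<^sub>M ?\<nu>"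
      by (simp add: indep_var_distribution_eq)
    have last: "(\<lambda>z. z (Suc n)) \<in> measurable ?N N" by (rule measurable_component_singleton) simp
    have Gl: "(\<lambda>z. G (hh n (fst z)) (snd z (Suc n))) \<in> borel_measurable (?P n \<Otimes>\<^sub>M ?N)"
    proof -
      have "(\<lambda>z. (fst z, snd z (Suc n))) \<in> measurable (?P n \<Otimes>\<^sub>M ?N) (?P n \<Otimes>\<^sub>M N)"
        by (intro measurable_Pair measurable_fst measurable_compose[OF measurable_snd last])
      from measurable_compose[OF this hhG_m] show ?thesis by simp
    qed
    define Q where "Q = {z \<in> space (?P n \<Otimes>\<^sub>M ?N). fst z \<in> E \<and> G (hh n (fst z)) (snd z (Suc n)) \<in> A}"
    have Q: "Q \<in> sets (?P n \<Otimes>\<^sub>M ?N)"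
    proof -
      have "Q = (fst -` E \<inter> space (?P n \<Otimes>\<^sub>M ?N)) \<inter>
          ((\<lambda>z. G (hh n (fst z)) (snd z (Suc n))) -` A \<inter> space (?P n \<Otimes>\<^sub>M ?N))"
        by (auto simp: Q_def)
      then show ?thesis
        by (simp only:) (rule sets.Int[OF measurable_sets[OF measurable_fst E] measurable_sets[OF Gl A]])
    qed
    have pairm: "(\<lambda>\<omega>. (?R n \<omega>, ?X \<omega>)) \<in> measurable M (?P n \<Otimes>\<^sub>M ?N)"
      by (intro measurable_Pair rR rX)
    have "{\<omega>\<in>space M. ?R n \<omega> \<in> E \<and> \<xi> (Suc n) \<omega> \<in> A} = (\<lambda>\<omega>. (?R n \<omega>, ?X \<omega>)) -` Q \<inter> space M"
      using measurable_space[OF pairm] by (auto simp: Q_def \<xi>_step)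
    then have "emeasure M {\<omega>\<in>space M. ?R n \<omega> \<in> E \<and> \<xi> (Suc n) \<omega> \<in> A} = emeasure (?\<mu> \<Otimes>\<^sub>M ?\<nu>) Q"
      unfolding joint[symmetric] emeasure_distr[OF pairm Q] by (simp only:)
    also have "\<dots> = (\<integral>\<^sup>+ y. emeasure ?\<nu> (Pair y -` Q) \<partial>?\<mu>)"
    proof (rule \<nu>'.emeasure_pair_measure_alt)
      have "sets (?\<mu> \<Otimes>\<^sub>M ?\<nu>) = sets (?P n \<Otimes>\<^sub>M ?N)" by (rule sets_pair_measure_cong) simp_all
      then show "Q \<in> sets (?\<mu> \<Otimes>\<^sub>M ?\<nu>)" using Q by simp
    qed
    also have "\<dots> = (\<integral>\<^sup>+ y. emeasure D A * indicator E y \<partial>?\<mu>)"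
    proof (rule nn_integral_cong_AE)
      have "AE \<omega> in M. hh n (?R n \<omega>) \<in> \<Gamma>"
        using \<Gamma>(2)[of n] H_restrict[of n n] by simp
      then have "AE y in ?\<mu>. hh n y \<in> \<Gamma>"
      proof (subst AE_distr_iff[OF rR])
        have "hh n -` \<Gamma> \<inter> space (?P n) \<in> sets (?P n)" by (rule measurable_sets[OF hh_m \<Gamma>(1)]) simp
        moreover have "hh n -` \<Gamma> \<inter> space (?P n) = {y \<in> space (?P n). hh n y \<in> \<Gamma>}" by auto
        ultimately show "{y \<in> space (?P n). hh n y \<in> \<Gamma>} \<in> sets (?P n)" by simp
      qed
      then show "AE y in ?\<mu>. emeasure ?\<nu> (Pair y -` Q) = emeasure D A * indicator E y"
        using AE_space
      proof eventually_elim
        case (elim y)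
        then have y: "y \<in> space (?P n)" "hh n y \<in> \<Gamma>" by auto
        then have hL: "hh n y \<in> space L" using sets.sets_into_space[OF \<Gamma>(1)] by auto
        note G_hh = Gh_m[OF hL]
        show ?case
        proof (cases "y \<in> E")
          case True
          have Gz: "(\<lambda>z. G (hh n y) (z (Suc n))) \<in> borel_measurable ?N"
            by (rule measurable_compose[OF last G_hh])
          have "Pair y -` Q = (\<lambda>z. G (hh n y) (z (Suc n))) -` A \<inter> space ?N"
            using True y by (auto simp: Q_def space_pair_measure)
          then have "emeasure ?\<nu> (Pair y -` Q) = emeasure (distr ?\<nu> borel (\<lambda>z. G (hh n y) (z (Suc n)))) A"
            using Gz A by (simp add: emeasure_distr)
          also have "distr ?\<nu> borel (\<lambda>z. G (hh n y) (z (Suc n))) = distr M borel (\<lambda>\<omega>. G (hh n y) (X (Suc n) \<omega>))"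
            by (subst distr_distr[OF Gz rX]) (simp add: comp_def)
          also have "\<dots> = distr (distr M N (X (Suc n))) borel (G (hh n y))"
            by (subst distr_distr[OF G_hh rv]) (simp_all add: comp_def)
          also have "\<dots> = D" using law[of "Suc n"] D[OF y(2)] by simp
          finally have "emeasure ?\<nu> (Pair y -` Q) = emeasure D A" .
          moreover have "indicator E y = (1 :: ennreal)" using True by simp
          ultimately show ?thesis by (simp only: mult_1_right)
        next
          case False
          then have "Pair y -` Q = {}" by (auto simp: Q_def)
          then show ?thesis using False by simp
        qed
      qed
    qed
    also have "\<dots> = emeasure D A * emeasure ?\<mu> E" 
      by (rule nn_integral_cmult_indicator) (use E in simp)
    also have "emeasure ?\<mu> E = emeasure M {\<omega>\<in>space M. ?R n \<omega> \<in> E}"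
    proof -
      have "?R n -` E \<inter> space M = {\<omega>\<in>space M. ?R n \<omega> \<in> E}" by auto
      then show ?thesis unfolding emeasure_distr[OF rR E] by (simp only:)
    qed
    finally show ?thesis .
  qed
  \<comment> \<open>A state in \<Gamma> exhibits D as an image measure and thereby fixes its
    sigma-algebra.\<close>
  have "\<exists>h. h \<in> \<Gamma>"
  proof (rule ccontr)
    assume "\<not> (\<exists>h. h \<in> \<Gamma>)"
    then have "AE \<omega> in M. False" using \<Gamma>(2)[of 0] by simp
    then show False by simp
  qed
  then obtain h where h: "h \<in> \<Gamma>" by blast
  have setsD: "sets D = sets borel" using D[OF h] by auto
  have law_\<xi>: "emeasure M {\<omega>\<in>space M. \<xi> (Suc n) \<omega> \<in> A} = emeasure D A" if A: "A \<in> sets borel" for n A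
  proof -
    have "?R n \<omega> \<in> space (?P n)" if "\<omega> \<in> space M" for \<omega> using measurable_space[OF rR that] .
    then have "{\<omega>\<in>space M. ?R n \<omega> \<in> space (?P n) \<and> \<xi> (Suc n) \<omega> \<in> A} = {\<omega>\<in>space M. \<xi> (Suc n) \<omega> \<in> A}"
      "{\<omega>\<in>space M. ?R n \<omega> \<in> space (?P n)} = space M" by auto
    then show ?thesis using key[OF sets.top A, of n] by (simp add: emeasure_space_1)
  qed
  show "distr M borel (\<lambda>\<omega>. G (H (k - 1) \<omega>) (X k \<omega>)) = D" if k: "k \<ge> 1" for k
  proof -
    obtain n where n: "k = Suc n" using k by (cases k) auto
    have "distr M borel (\<xi> k) = D"
    proof (rule measure_eqI)
      fix A assume "A \<in> sets (distr M borel (\<xi> k))"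
      then have A: "A \<in> sets borel" by simp
      have "\<xi> k -` A \<inter> space M = {\<omega>\<in>space M. \<xi> k \<omega> \<in> A}" by auto
      then show "emeasure (distr M borel (\<xi> k)) A = emeasure D A"
        unfolding emeasure_distr[OF r\<xi>[OF k] A] using law_\<xi>[OF A, of n] by (simp add: n)
    qed (simp add: setsD)
    then show ?thesis by (simp add: \<xi>_def[abs_def])
  qed
  \<comment> \<open>The largest index is split off by \<open>key\<close>, the event for the smaller
    ones being an event E of the earlier inputs.\<close>
  have product: "emeasure M {\<omega>\<in>space M. \<forall>j\<in>J. \<xi> j \<omega> \<in> A j} = (\<Prod>j\<in>J. emeasure D (A j))"
    if "J \<subseteq> {1..n}" "\<And>j. j \<in> J \<Longrightarrow> A j \<in> sets borel" for n J A
    using that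
  proof (induction n arbitrary: J)
    case 0 then show ?case by (simp add: emeasure_space_1)
  next
    case (Suc n)
    show ?case
    proof (cases "Suc n \<in> J")
      case False
      then have "J \<subseteq> {1..n}" using Suc.prems(1) by (auto simp: le_Suc_eq)
      then show ?thesis using Suc by blast
    next
      case True
      define J' where "J' = J - {Suc n}"
      have J: "J = insert (Suc n) J'" "Suc n \<notin> J'" using True by (auto simp: J'_def)
      have J': "J' \<subseteq> {1..n}" using Suc.prems(1) by (auto simp: J'_def le_Suc_eq)
      have fin: "finite J'" by (rule finite_subset[OF J']) simp
      define E where "E = {y \<in> space (?P n). \<forall>j\<in>J'. G (hh (j - 1) y) (y j) \<in> A j}"
      have "E \<in> sets (?P n)"
      proof -
        have "(\<lambda>y. G (hh (j - 1) y) (y j)) \<in> borel_measurable (?P n)" if "j \<in> J'" for j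
        proof -
          have "(\<lambda>y. (hh (j - 1) y, y j)) \<in> measurable (?P n) (L \<Otimes>\<^sub>M N)"
          proof (intro measurable_Pair hh_m measurable_component_singleton)
            show j: "j \<in> {1..n}" using J' that by blast
            then show "j - 1 \<le> n" by (auto intro: le_trans[OF diff_le_self])
          qed
          from measurable_compose[OF this Gm] show ?thesis by simp
        qed
        then have "{y \<in> space (?P n). G (hh (j - 1) y) (y j) \<in> A j} \<in> sets (?P n)" if "j \<in> J'" for j
          using measurable_sets[of "\<lambda>y. G (hh (j - 1) y) (y j)" "?P n" borel "A j"] that Suc.prems(2) J(1)
          by (simp add: vimage_def Int_def conj_commute)
        then show ?thesis unfolding E_def using fin by (intro sets.sets_Collect_finite_All) auto
      qed
      moreover have E_eq: "{\<omega>\<in>space M. ?R n \<omega> \<in> E} = {\<omega>\<in>space M. \<forall>j\<in>J'. \<xi> j \<omega> \<in> A j}"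
      proof -
        have "G (hh (j - 1) (?R n \<omega>)) (?R n \<omega> j) = \<xi> j \<omega>" if "j \<in> J'" for j \<omega>
        proof -
          have j: "j \<in> {1..n}" using J' that by blast
          then have "H (j - 1) \<omega> = hh (j - 1) (?R n \<omega>)" by (intro H_restrict) (auto intro: le_trans[OF diff_le_self])
          then show ?thesis using j by (simp add: \<xi>_def)
        qed
        then show ?thesis using measurable_space[OF rR] by (auto simp: E_def)
      qed
      moreover have "{\<omega>\<in>space M. \<forall>j\<in>J. \<xi> j \<omega> \<in> A j} = {\<omega>\<in>space M. ?R n \<omega> \<in> E \<and> \<xi> (Suc n) \<omega> \<in> A (Suc n)}"
        using E_eq unfolding J(1) by blast
      ultimately have "emeasure M {\<omega>\<in>space M. \<forall>j\<in>J. \<xi> j \<omega> \<in> A j} =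
          emeasure D (A (Suc n)) * emeasure M {\<omega>\<in>space M. \<forall>j\<in>J'. \<xi> j \<omega> \<in> A j}"
        using key[of E n "A (Suc n)"] Suc.prems(2)[OF True] by simp
      also have "\<dots> = (\<Prod>j\<in>J. emeasure D (A j))"
        using Suc.IH[OF J'] Suc.prems(2) J fin by simp
      finally show ?thesis .
    qed
  qed
  have "indep_vars (\<lambda>_. borel) \<xi> {1..}"
    unfolding indep_vars_def2
  proof (intro conjI ballI indep_setsI)
    fix k :: nat assume "k \<in> {1..}"
    then have k: "k \<ge> 1" by simp
    show "random_variable borel (\<xi> k)" by (rule r\<xi>[OF k])
    show "{\<xi> k -` A \<inter> space M |A. A \<in> sets borel} \<subseteq> events"
      using measurable_sets[OF r\<xi>[OF k]] by auto
  next
    fix B J assume J: "J \<noteq> {}" "J \<subseteq> {1::nat..}" "finite J"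
      and B: "\<forall>j\<in>J. B j \<in> {\<xi> j -` A \<inter> space M |A. A \<in> sets borel}"
    then have "\<forall>j\<in>J. \<exists>A. B j = \<xi> j -` A \<inter> space M \<and> A \<in> sets borel" by blast
    then obtain A where A: "\<And>j. j \<in> J \<Longrightarrow> B j = \<xi> j -` A j \<inter> space M" "\<And>j. j \<in> J \<Longrightarrow> A j \<in> sets borel"
      by metis
    have J': "J \<subseteq> {1..Max J}" using J by auto
    have "(\<Inter>j\<in>J. B j) = {\<omega>\<in>space M. \<forall>j\<in>J. \<xi> j \<omega> \<in> A j}" using A(1) J(1) by auto
    then have "emeasure M (\<Inter>j\<in>J. B j) = (\<Prod>j\<in>J. emeasure D (A j))"
      using product[OF J' A(2)] by simp
    also have "\<dots> = (\<Prod>j\<in>J. emeasure M (B j))"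
    proof (rule prod.cong)
      fix j assume j: "j \<in> J"
      have "emeasure M {\<omega>\<in>space M. \<forall>j\<in>{j}. \<xi> j \<omega> \<in> A j} = (\<Prod>j\<in>{j}. emeasure D (A j))"
        using J' j A(2) by (intro product[of _ "Max J"]) auto
      moreover have "B j = {\<omega>\<in>space M. \<forall>j\<in>{j}. \<xi> j \<omega> \<in> A j}" using A(1)[OF j] by auto
      ultimately show "emeasure D (A j) = emeasure M (B j)" by simp
    qed simp
    finally show "prob (\<Inter>j\<in>J. B j) = (\<Prod>j\<in>J. prob (B j))"
      by (simp add: emeasure_eq_measure prod_ennreal prod_nonneg)
  qed
  then show "indep_vars (\<lambda>_. borel) (\<lambda>k \<omega>. G (H (k - 1) \<omega>) (X k \<omega>)) {1..}"
    by (simp add: \<xi>_def[abs_def])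
qed

subsection \<open>Limit theorems\<close>

text \<open>Each singular value is controlled from above by finitely many of the walks, and their sum is
  one of the walks; this gives the control from below.\<close>

lemma ln_sing_sandwich:
  assumes g: "\<And>k. g k \<in> GLF F q" and \<kappa>: "filterlim \<kappa> at_top sequentially"
    and base: "\<And>j. j < q \<Longrightarrow> (\<lambda>k. (iwa F j (gram (msz F q) (g k)) - real k * c j) / \<kappa> k) \<longlonglongrightarrow> 0"
    and swap: "\<And>i j. i < q \<Longrightarrow> j < q \<Longrightarrow>
      (\<lambda>k. (iwa F j (gram (msz F q) (mmul (msz F q) (swap_mat F q j i) (g k))) - real k * c j) / \<kappa> k) \<longlonglongrightarrow> 0"
    and j: "j < q"
  shows "(\<lambda>k. (ln_sing F q (g k) j - real k * c j) / \<kappa> k) \<longlonglongrightarrow> 0"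
proof -
  let ?m = "msz F q"
  let ?b = "\<lambda>i j k. (iwa F j (gram ?m (mmul ?m (swap_mat F q j i) (g k))) - real k * c j) / \<kappa> k"
  \<comment> \<open>Upper error: the maximum over the finitely many walks is replaced by the sum of
    absolute values, and the pivoting loss is divided by \<kappa>, which tends to infinity.\<close>
  define U where "U j k = (\<Sum>i<q. \<bar>?b i j k\<bar>) + ln (real ?m) / 2 / \<kappa> k" for j k
  define B where "B k = (\<Sum>i<q. (iwa F i (gram ?m (g k)) - real k * c i) / \<kappa> k)" for k
  have U_lim: "U j \<longlonglongrightarrow> 0" if "j < q" for j
  proof -
    have "(\<lambda>k. (\<Sum>i<q. \<bar>?b i j k\<bar>) + ln (real ?m) / 2 / \<kappa> k) \<longlonglongrightarrow> (\<Sum>i<q. \<bar>0\<bar>) + 0"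
      using that
      by (intro tendsto_add tendsto_sum tendsto_rabs swap
          real_tendsto_divide_at_top[OF tendsto_const \<kappa>]) auto
    then show ?thesis by (simp add: U_def[abs_def])
  qed
  have B_lim: "B \<longlonglongrightarrow> 0"
  proof -
    have "B \<longlonglongrightarrow> (\<Sum>i<q. 0)" unfolding B_def[abs_def] using base by (intro tendsto_sum) auto
    then show ?thesis by simp
  qed
  have upper: "(ln_sing F q (g k) j - real k * c j) / \<kappa> k \<le> U j k" if j: "j < q" and pos: "\<kappa> k > 0" for j k
  proof -
    obtain i where i: "i < q" "ln_sing F q (g k) j - ln (real ?m) / 2 \<le>
        iwa F j (gram ?m (mmul ?m (swap_mat F q j i) (g k)))"
      using iwa_pivot[OF g j] by blast
    have "(ln_sing F q (g k) j - real k * c j) / \<kappa> k \<le>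
        (iwa F j (gram ?m (mmul ?m (swap_mat F q j i) (g k))) - real k * c j + ln (real ?m) / 2) / \<kappa> k"
      using i(2) pos by (intro divide_right_mono) auto
    also have "\<dots> = ?b i j k + ln (real ?m) / 2 / \<kappa> k" by (simp add: add_divide_distrib)
    also have "?b i j k \<le> (\<Sum>i<q. \<bar>?b i j k\<bar>)"
      by (rule order_trans[OF abs_ge_self member_le_sum[of i "{..<q}" "\<lambda>i. \<bar>?b i j k\<bar>"]])
         (use i(1) in auto)
    finally show ?thesis by (simp add: U_def)
  qed
  have ev: "\<forall>\<^sub>F k in sequentially. \<kappa> k > 0"
    using \<kappa> by (simp add: filterlim_at_top_dense)
  show ?thesis
  \<comment> \<open>Lower bound for index j: the normalised sum B over all indices minus the upper
    bounds for the others.\<close>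
  proof (rule tendsto_sandwich[where f = "\<lambda>k. B k - (\<Sum>i\<in>{..<q} - {j}. U i k)" and h = "U j"])
    show "\<forall>\<^sub>F k in sequentially. (ln_sing F q (g k) j - real k * c j) / \<kappa> k \<le> U j k"
      using ev by eventually_elim (rule upper[OF j])
    show "\<forall>\<^sub>F k in sequentially. B k - (\<Sum>i\<in>{..<q} - {j}. U i k) \<le> (ln_sing F q (g k) j - real k * c j) / \<kappa> k"
      using ev
    proof eventually_elim
      case (elim k)
      let ?t = "\<lambda>i. (ln_sing F q (g k) i - real k * c i) / \<kappa> k"
      have "B k = (\<Sum>i<q. ?t i)"
        unfolding B_def sum_divide_distrib[symmetric] sum_subtractf sum_iwa_gram[OF g] ..
      also have "\<dots> = ?t j + (\<Sum>i\<in>{..<q} - {j}. ?t i)" using j by (simp add: sum.remove)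
      also have "(\<Sum>i\<in>{..<q} - {j}. ?t i) \<le> (\<Sum>i\<in>{..<q} - {j}. U i k)"
        using upper[OF _ elim] by (intro sum_mono) auto
      finally show ?case by simp
    qed
    have "(\<lambda>k. B k - (\<Sum>i\<in>{..<q} - {j}. U i k)) \<longlonglongrightarrow> 0 - (\<Sum>i\<in>{..<q} - {j}. 0)"
      using U_lim by (intro tendsto_diff tendsto_sum B_lim) auto
    then show "(\<lambda>k. B k - (\<Sum>i\<in>{..<q} - {j}. U i k)) \<longlonglongrightarrow> 0" by simp
  qed (rule U_lim[OF j])
qed

text \<open>The Gram matrix is the identity, so every walk starts at 0.\<close>

lemma iwa_UF: assumes "w \<in> UF F q" "j < q" shows "iwa F j (gram (msz F q) w) = 0"
proof -
  have "Delta F r (idm (msz F q)) = 1" if "r \<le> q" for r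
  proof -
    have "detm (cF F * r) (idm (msz F q)) = 1"
    proof -
      have "cF F * r \<le> msz F q" using that by (simp add: msz_def)
      then show ?thesis by (subst detm_upper) (auto simp: idm_def)
    qed
    then show ?thesis by (cases F) (auto simp: Delta_def)
  qed
  then show ?thesis using assms(2) UF_ctr_right[OF assms(1)] by (simp add: iwa_def gram_def)
qed

lemma Sprod_GLF: "(\<And>k. k \<ge> 1 \<Longrightarrow> X k \<omega> \<in> GLF F q) \<Longrightarrow> Sprod (msz F q) X k \<omega> \<in> GLF F q"
  by (induction k) (auto intro: GLF_mmul UF_GLF)

locale biinvariant_walk = biinvariant_law F q \<nu> + P: prob_space P
  for F q \<nu> and P :: "'w measure" +
  fixes X :: "nat \<Rightarrow> 'w \<Rightarrow> cmat"
  assumes X_indep: "P.indep_vars (\<lambda>_. borel) X {1..}"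
    and X_law: "\<And>k. k \<ge> 1 \<Longrightarrow> distr P borel (X k) = \<nu>"
begin

abbreviation "S \<equiv> Sprod m X"

lemma AE_X_GLF: "AE \<omega> in P. \<forall>k\<ge>1. X k \<omega> \<in> GLF F q"
proof -
  have "AE \<omega> in P. k \<ge> 1 \<longrightarrow> X k \<omega> \<in> GLF F q" for k
  proof (cases "k \<ge> 1")
    case True
    have "X k \<in> borel_measurable P" using X_indep True by (auto simp: P.indep_vars_def)
    then show ?thesis using AE_GLF GLF_sets unfolding X_law[OF True, symmetric]
      by (subst (asm) AE_distr_iff) auto
  qed simp
  then show ?thesis by (simp add: AE_all_countable)
qed

text \<open>\<open>state_increments\<close> for the state \<open>w S_k\<close>; the increments
  telescope, and the initial value is 0 by \<open>iwa_UF\<close>.\<close>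

lemma iwa_walk:
  assumes w: "w \<in> UF F q" and j: "j < q"
  obtains \<xi> where "P.indep_vars (\<lambda>_. borel) \<xi> {1..}"
    "\<And>k. k \<ge> 1 \<Longrightarrow> distr P borel (\<xi> k) = distr \<nu> borel (\<lambda>g. iwa F j (gram m g))"
    "\<And>k \<omega>. (\<Sum>i=1..k. \<xi> i \<omega>) = iwa F j (gram m (mmul m w (S k \<omega>)))"
proof -
  let ?b = "\<lambda>g. iwa F j (gram m g)"
  let ?G = "\<lambda>h x. ?b (mmul m h x) - ?b h"
  let ?H = "\<lambda>k \<omega>. mmul m w (S k \<omega>)"
  let ?\<xi> = "\<lambda>k \<omega>. ?G (?H (k - 1) \<omega>) (X k \<omega>)"
  have good: "AE \<omega> in P. ?H k \<omega> \<in> GLF F q" for k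
    using AE_X_GLF by eventually_elim (rule GLF_mmul[OF UF_GLF[OF w] Sprod_GLF], auto)
  have Fm: "(\<lambda>(h, x). mmul m h x) \<in> measurable (borel \<Otimes>\<^sub>M borel) borel" by measurable
  have Gm: "(\<lambda>(h, x). ?G h x) \<in> borel_measurable (borel \<Otimes>\<^sub>M borel)" by measurable
  have H0: "?H 0 \<omega> = w" for \<omega> using w by (simp add: mmul_idm_right UF_in_mat)
  have HS: "?H (Suc k) \<omega> = mmul m (?H k \<omega>) (X (Suc k) \<omega>)" for k \<omega> by (simp add: mmul_assoc)
  have w_space: "w \<in> space borel" by simp
  note incr = P.state_increments[where H = ?H and G = ?G and F = "mmul m" and L = borel
      and \<Gamma> = "GLF F q", OF X_indep X_law Fm Gm H0 w_space HS GLF_sets good distr_iwa_increment[OF _ j]]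
  have sum: "(\<Sum>i=1..k. ?\<xi> i \<omega>) = ?b (?H k \<omega>)" for k \<omega>
  proof (induction k)
    case 0 then show ?case using iwa_UF[OF w j] H0 by simp
  next
    case (Suc k) then show ?case by (simp add: mmul_assoc)
  qed
  show ?thesis by (rule that[OF incr sum])
qed

text \<open>Only the identity and the finitely many swap matrices occur as w, so the exceptional
  sets can be united before the deterministic sandwich is applied path by path.\<close>

lemma AE_ln_sing_limit:
  assumes e: "\<epsilon> > 0"
    and walk: "\<And>w j. w \<in> UF F q \<Longrightarrow> j < q \<Longrightarrow>
      AE \<omega> in P. (\<lambda>k. (iwa F j (gram m (mmul m w (S k \<omega>))) - real k * c j) / real k powr \<epsilon>) \<longlonglongrightarrow> 0"
  shows "AE \<omega> in P. \<forall>j<q. (\<lambda>k. (ln_sing F q (S k \<omega>) j - real k * c j) / real k powr \<epsilon>) \<longlonglongrightarrow> 0"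
proof -
  let ?L = "\<lambda>w j \<omega>. (\<lambda>k. (iwa F j (gram m (mmul m w (S k \<omega>))) - real k * c j) / real k powr \<epsilon>) \<longlonglongrightarrow> 0"
  have base: "AE \<omega> in P. \<forall>j\<in>{..<q}. ?L (idm m) j \<omega>"
    using walk[OF UF_idm] by (subst AE_ball_countable) auto
  have swaps: "AE \<omega> in P. \<forall>j\<in>{..<q}. \<forall>i\<in>{..<q}. ?L (swap_mat F q j i) j \<omega>"
    using walk[OF swap_mat_UF] by (simp add: AE_ball_countable)
  have \<kappa>: "filterlim (\<lambda>k. real k powr \<epsilon>) at_top sequentially"
  proof -
    have "filterlim (\<lambda>k. exp (\<epsilon> * ln (real k))) at_top sequentially"
      by (intro filterlim_compose[OF exp_at_top] filterlim_tendsto_pos_mult_at_top[OF tendsto_const e]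
          filterlim_compose[OF ln_at_top filterlim_real_sequentially])
    moreover have "\<forall>\<^sub>F k in sequentially. exp (\<epsilon> * ln (real k)) = real k powr \<epsilon>"
      using eventually_gt_at_top[of 0] by eventually_elim (simp add: powr_def)
    ultimately show ?thesis by (rule filterlim_cong[OF refl refl, THEN iffD1, rotated])
  qed
  show ?thesis using AE_X_GLF base swaps
  proof eventually_elim
    case (elim \<omega>)
    have S: "S k \<omega> \<in> GLF F q" for k using elim(1) by (intro Sprod_GLF) auto
    have "mmul m (idm m) (S k \<omega>) = S k \<omega>" for k using S by (simp add: mmul_idm_left GLF_in_mat)
    note base = elim(2)[unfolded this, THEN bspec]
    show ?case
    proof (intro allI impI)
      fix j assume "j < q"
      then show "(\<lambda>k. (ln_sing F q (S k \<omega>) j - real k * c j) / real k powr \<epsilon>) \<longlonglongrightarrow> 0"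
        by (rule ln_sing_sandwich[where g = "\<lambda>k. S k \<omega>" and \<kappa> = "\<lambda>k. real k powr \<epsilon>", OF S \<kappa>, rotated 2])
           (use base elim(3) in auto)
    qed
  qed
qed

lemma measurable_ln_sing_entry [measurable]: "(\<lambda>g. ln_sing F q g i) \<in> borel_measurable borel"
  by (rule measurable_product_then_coordinatewise) measurable

lemma integrable_iwa:
  assumes "\<forall>j<q. (\<integral>\<^sup>+ t. ennreal \<bar>t j\<bar> \<partial>distr \<nu> borel (ln_sing F q)) < \<infinity>" and j: "j < q"
  shows "integrable \<nu> (\<lambda>g. iwa F j (gram m g))"
proof -
  have int: "integrable \<nu> (\<lambda>g. \<bar>ln_sing F q g i\<bar>)" if "i < q" for i
  proof (rule integrableI_nonneg)
    have "(\<integral>\<^sup>+ t. ennreal \<bar>t i\<bar> \<partial>distr \<nu> borel (ln_sing F q)) = (\<integral>\<^sup>+ g. ennreal \<bar>ln_sing F q g i\<bar> \<partial>\<nu>)"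
      by (rule nn_integral_distr) measurable
    then show "(\<integral>\<^sup>+ g. ennreal \<bar>ln_sing F q g i\<bar> \<partial>\<nu>) < \<infinity>" using assms(1)[rule_format, OF that] by simp
  qed auto
  show ?thesis
  proof (rule Bochner_Integration.integrable_bound)
    show "integrable \<nu> (\<lambda>g. real q * (\<Sum>i<q. \<bar>ln_sing F q g i\<bar>))"
      using int by (intro integrable_mult_right Bochner_Integration.integrable_sum) auto
    show "AE g in \<nu>. norm (iwa F j (gram m g)) \<le> norm (real q * (\<Sum>i<q. \<bar>ln_sing F q g i\<bar>))"
      using AE_GLF by eventually_elim (use abs_iwa_gram_le[OF _ j] in \<open>auto simp: abs_mult intro: order_trans\<close>)
  qed measurable
qed

lemma integrable_iwa_square:
  assumes "\<forall>j<q. (\<integral>\<^sup>+ t. ennreal ((t j)\<^sup>2) \<partial>distr \<nu> borel (ln_sing F q)) < \<infinity>" and j: "j < q"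
  shows "integrable \<nu> (\<lambda>g. (iwa F j (gram m g))\<^sup>2)"
proof -
  have int: "integrable \<nu> (\<lambda>g. (ln_sing F q g i)\<^sup>2)" if "i < q" for i
  proof (rule integrableI_nonneg)
    have "(\<integral>\<^sup>+ t. ennreal ((t i)\<^sup>2) \<partial>distr \<nu> borel (ln_sing F q)) = (\<integral>\<^sup>+ g. ennreal ((ln_sing F q g i)\<^sup>2) \<partial>\<nu>)"
      by (rule nn_integral_distr) measurable
    then show "(\<integral>\<^sup>+ g. ennreal ((ln_sing F q g i)\<^sup>2) \<partial>\<nu>) < \<infinity>" using assms(1)[rule_format, OF that] by simp
  qed auto
  show ?thesis
  proof (rule Bochner_Integration.integrable_bound)
    show "integrable \<nu> (\<lambda>g. (real q)\<^sup>2 * ((\<Sum>i<q. (ln_sing F q g i)\<^sup>2) * real q))"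
      using int by (intro integrable_mult_right integrable_mult_left Bochner_Integration.integrable_sum) auto
    show "AE g in \<nu>. norm ((iwa F j (gram m g))\<^sup>2) \<le> norm ((real q)\<^sup>2 * ((\<Sum>i<q. (ln_sing F q g i)\<^sup>2) * real q))"
      using AE_GLF
    proof eventually_elim
      case (elim g)
      have "(iwa F j (gram m g))\<^sup>2 \<le> (real q * (\<Sum>i<q. \<bar>ln_sing F q g i\<bar>))\<^sup>2"
        using abs_iwa_gram_le[OF elim j] by (metis abs_ge_zero power2_abs power_mono)
      also have "\<dots> = (real q)\<^sup>2 * (\<Sum>i<q. \<bar>ln_sing F q g i\<bar>)\<^sup>2" by (simp add: power_mult_distrib)
      also have "(\<Sum>i<q. \<bar>ln_sing F q g i\<bar>)\<^sup>2 \<le> (\<Sum>i<q. \<bar>ln_sing F q g i\<bar>\<^sup>2) * real q"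
        using sum_squared_le_sum_of_squares[of "\<lambda>i. \<bar>ln_sing F q g i\<bar>" "{..<q}"] by simp
      finally have "(iwa F j (gram m g))\<^sup>2 \<le> (real q)\<^sup>2 * ((\<Sum>i<q. (ln_sing F q g i)\<^sup>2) * real q)"
        by (simp add: mult_left_mono)
      then show ?case by (simp add: sum_nonneg abs_mult)
    qed
  qed measurable
qed

lemma integral_distr_iwa:
  assumes "j < q" "integrable \<nu> (\<lambda>g. iwa F j (gram m g))"
  shows "(\<integral>x. x \<partial>distr \<nu> borel (\<lambda>g. iwa F j (gram m g))) = m1_meas F q (distr \<nu> borel (ln_sing F q)) j"
  unfolding iwa_mean[OF assms, symmetric] by (rule integral_distr) measurable

theorem strong_law:
  assumes fin: "\<forall>j<q. (\<integral>\<^sup>+ t. ennreal \<bar>t j\<bar> \<partial>distr \<nu> borel (ln_sing F q)) < \<infinity>"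
  shows "AE \<omega> in P. \<forall>j<q. (\<lambda>k. ln_sing F q (S k \<omega>) j / real k)
      \<longlonglongrightarrow> m1_meas F q (distr \<nu> borel (ln_sing F q)) j"
proof -
  let ?c = "m1_meas F q (distr \<nu> borel (ln_sing F q))"
  \<comment> \<open>At k = 0 the left side is -a and the right side 0, both by division by zero; the
    equality starts at k = 1.\<close>
  have tail: "\<forall>\<^sub>F k in sequentially. x k / real k - a = (x k - real k * a) / real k powr 1" for x and a :: real
    using eventually_ge_at_top[of 1] by eventually_elim (simp add: diff_divide_distrib)
  have "AE \<omega> in P. \<forall>j<q. (\<lambda>k. (ln_sing F q (S k \<omega>) j - real k * ?c j) / real k powr 1) \<longlonglongrightarrow> 0"
  proof (rule AE_ln_sing_limit)
    fix w j assume w: "w \<in> UF F q" and j: "j < q"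
    note int = integrable_iwa[OF fin j]
    obtain \<xi> where \<xi>: "P.indep_vars (\<lambda>_. borel) \<xi> {1..}"
      "\<And>k. k \<ge> 1 \<Longrightarrow> distr P borel (\<xi> k) = distr \<nu> borel (\<lambda>g. iwa F j (gram m g))"
      "\<And>k \<omega>. (\<Sum>i=1..k. \<xi> i \<omega>) = iwa F j (gram m (mmul m w (S k \<omega>)))"
      using iwa_walk[OF w j] by blast
    have "integrable (distr \<nu> borel (\<lambda>g. iwa F j (gram m g))) (\<lambda>x. x)"
      by (subst integrable_distr_eq) (measurable, use int in simp)
    from P.strong_law_integrable[OF \<xi>(1,2) this]
    have "AE \<omega> in P. (\<lambda>k. iwa F j (gram m (mmul m w (S k \<omega>))) / real k - ?c j) \<longlonglongrightarrow> 0"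
      unfolding \<xi>(3) integral_distr_iwa[OF j int] .
    then show "AE \<omega> in P. (\<lambda>k. (iwa F j (gram m (mmul m w (S k \<omega>))) - real k * ?c j) / real k powr 1) \<longlonglongrightarrow> 0"
      by eventually_elim (rule Lim_transform_eventually[OF _ tail])
  qed simp
  then show ?thesis
  proof eventually_elim
    case (elim \<omega>)
    show ?case
    proof (intro allI impI)
      fix j assume "j < q"
      then have "(\<lambda>k. (ln_sing F q (S k \<omega>) j - real k * ?c j) / real k powr 1) \<longlonglongrightarrow> 0"
        using elim by blast
      then have "(\<lambda>k. ln_sing F q (S k \<omega>) j / real k - ?c j) \<longlonglongrightarrow> 0"
        by (rule Lim_transform_eventually)
           (rule eventually_mono[OF tail[of "\<lambda>k. ln_sing F q (S k \<omega>) j" "?c j"]], rule sym)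
      then show "(\<lambda>k. ln_sing F q (S k \<omega>) j / real k) \<longlonglongrightarrow> ?c j" by (rule LIM_zero_cancel)
    qed
  qed
qed

theorem strong_law_rate:
  assumes fin: "\<forall>j<q. (\<integral>\<^sup>+ t. ennreal ((t j)\<^sup>2) \<partial>distr \<nu> borel (ln_sing F q)) < \<infinity>"
    and e: "\<epsilon> > 1 / 2"
  shows "AE \<omega> in P. \<forall>j<q. (\<lambda>k. (ln_sing F q (S k \<omega>) j
      - real k * m1_meas F q (distr \<nu> borel (ln_sing F q)) j) / real k powr \<epsilon>) \<longlonglongrightarrow> 0"
proof (rule AE_ln_sing_limit)
  let ?c = "m1_meas F q (distr \<nu> borel (ln_sing F q))"
  fix w j assume w: "w \<in> UF F q" and j: "j < q"
  note sq = integrable_iwa_square[OF fin j]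
  have int: "integrable \<nu> (\<lambda>g. iwa F j (gram m g))"
    by (rule square_integrable_imp_integrable[OF _ sq]) measurable
  obtain \<xi> where \<xi>: "P.indep_vars (\<lambda>_. borel) \<xi> {1..}"
    "\<And>k. k \<ge> 1 \<Longrightarrow> distr P borel (\<xi> k) = distr \<nu> borel (\<lambda>g. iwa F j (gram m g))"
    "\<And>k \<omega>. (\<Sum>i=1..k. \<xi> i \<omega>) = iwa F j (gram m (mmul m w (S k \<omega>)))"
    using iwa_walk[OF w j] by blast
  have "integrable (distr \<nu> borel (\<lambda>g. iwa F j (gram m g))) (\<lambda>x. x\<^sup>2)"
    by (subst integrable_distr_eq) (measurable, use sq in simp)
  from P.strong_law_square_integrable[OF \<xi>(1,2) this e]
  show "AE \<omega> in P. (\<lambda>k. (iwa F j (gram m (mmul m w (S k \<omega>))) - real k * ?c j) / real k powr \<epsilon>) \<longlonglongrightarrow> 0"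
    unfolding \<xi>(3) integral_distr_iwa[OF j int] diff_divide_distrib .
qed (use e in simp)

end

theorem theorem2p4:
  fixes F :: fld and q :: nat and \<nu>G :: "cmat measure"
    and P :: "'w measure" and X :: "nat \<Rightarrow> 'w \<Rightarrow> cmat"
  assumes q2: "q \<ge> 2"
    and nuG_prob: "prob_space \<nu>G" and nuG_sets: "sets \<nu>G = sets borel"
    and nuG_GL: "emeasure \<nu>G (GLF F q) = 1"
    and nuG_biinv: "\<forall>u\<in>UF F q. \<forall>v\<in>UF F q.
          distr \<nu>G borel (\<lambda>g. mmul (msz F q) (mmul (msz F q) u g) v) = \<nu>G"
    and P_prob: "prob_space P"
    and X_indep: "prob_space.indep_vars P (\<lambda>_. borel) X {1..}"
    and X_law: "\<forall>k\<ge>1. distr P borel (X k) = \<nu>G"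
  shows
    "((\<forall>j<q. (\<integral>\<^sup>+ t. ennreal \<bar>t j\<bar> \<partial>(distr \<nu>G borel (ln_sing F q))) < \<infinity>) \<longrightarrow>
       (AE \<omega> in P. \<forall>j<q.
          (\<lambda>k. ln_sing F q (Sprod (msz F q) X k \<omega>) j / real k)
            \<longlonglongrightarrow> m1_meas F q (distr \<nu>G borel (ln_sing F q)) j))
   \<and> ((\<forall>j<q. (\<integral>\<^sup>+ t. ennreal ((t j)\<^sup>2) \<partial>(distr \<nu>G borel (ln_sing F q))) < \<infinity>) \<longrightarrow>
       (\<forall>\<epsilon>::real. \<epsilon> > 1/2 \<longrightarrow>
         (AE \<omega> in P. \<forall>j<q.
          (\<lambda>k. (ln_sing F q (Sprod (msz F q) X k \<omega>) j
                 - real k * m1_meas F q (distr \<nu>G borel (ln_sing F q)) j) / (real k powr \<epsilon>))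
            \<longlonglongrightarrow> 0)))"
proof -
  interpret biinvariant_walk F q \<nu>G P X
    using assms by (auto simp: biinvariant_walk_def biinvariant_law_def biinvariant_walk_axioms_def)
  show ?thesis using strong_law strong_law_rate by blast
qed

end
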